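(* Let $\mathcal{H}$ be a normalized complete Pick space and let $h \in \mathcal{H}\odot\mathcal{H}$. Then there exist $f,g\in\mathcal{H}$ with $h = fg$ and $\|f\|_{\mathcal{H}}\,\|g\|_{\mathcal{H}} = \|h\|_{\mathcal{H}\odot\mathcal{H}}$.
   Context: All reproducing kernel Hilbert spaces (RKHS) consist of complex-valued functions on a set $X$ and are assumed separable. Normalized complete Pick space: an RKHS $\mathcal{H}$ on $X$ with kernel $K$ such that there is $z_0\in X$ with $K(z,z_0)=1$ for all $z\in X$, and $\mathcal{H}$ has the complete Pick property: for every finite $Y\subset X$ and all $M,N\in\mathbb{N}$, the restriction map from $N\times M$ matrices of multipliers of $\mathcal{H}$ to $N\times M$ matrices of multipliers of $\mathcal{H}|_Y$ (the RKHS on $Y$ with kernel $K|_{Y\times Y}$) maps the closed unit ball onto the closed unit ball, where matrices carry the operator norm of the induced multiplication operator. Equivalently (Agler--McCarthy, McCullough, Quiggin), there are $d\in\mathbb{N}\cup\{\infty\}$ and $b:X\to\mathbb{B}_d$ with $b(z_0)=0$ and $K(z,w)=\frac{1}{1-\langle b(z),b(w)\rangle}$ for all $z,w \in X$, where $\mathbb{B}_d$ is the open unit ball of $\mathbb{C}^d$ (of $\ell^2$ if $d=\infty$). Either description may be taken as the definition. Weak product space: $\mathcal{H}\odot\mathcal{H}$ is the space of functions on $X$ of the form $h=\sum_{n=1}^\infty f_n g_n$ (pointwise) with $f_n,g_n\in\mathcal{H}$ and $\sum_n\|f_n\|\|g_n\|<\infty$, with the norm $\|h\|_{\mathcal{H}\odot\mathcal{H}}=\inf\{\sum_n\|f_n\|\|g_n\|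 : h=\sum_n f_ng_n\}$; it is a Banach function space. *)

theory Defs
  imports "HOL-Analysis.Analysis" "HOL-Library.Extended_Nat"
begin

section \<open>Reproducing kernel Hilbert spaces\<close>

text \<open>
  The underlying set \<open>X\<close> is the type \<open>'x\<close>. A space of functions on \<open>X\<close> is given by its carrier
  \<open>H\<close> and its inner product \<open>ip\<close>, which is linear in the first argument; only the values of \<open>ip\<close>
  on \<open>H\<close> matter.
\<close>

definition hnorm :: "(('x \<Rightarrow> complex) \<Rightarrow> ('x \<Rightarrow> complex) \<Rightarrow> complex) \<Rightarrow> ('x \<Rightarrow> complex) \<Rightarrow> real"
  where "hnorm ip f = sqrt (Re (ip f f))"

text \<open>The value \<open>0\<close> outside \<open>H\<close> is only there because \<open>Metric_space\<close> asks for a total \<open>d \<ge> 0\<close>.\<close>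

definition hdist ::
    "('x \<Rightarrow> complex) set \<Rightarrow> (('x \<Rightarrow> complex) \<Rightarrow> ('x \<Rightarrow> complex) \<Rightarrow> complex) \<Rightarrow>
      ('x \<Rightarrow> complex) \<Rightarrow> ('x \<Rightarrow> complex) \<Rightarrow> real"
  where "hdist H ip f g = (if f \<in> H \<and> g \<in> H then hnorm ip (\<lambda>x. f x - g x) else 0)"

locale inner_function_space =
  fixes H :: "('x \<Rightarrow> complex) set"
    and ip :: "('x \<Rightarrow> complex) \<Rightarrow> ('x \<Rightarrow> complex) \<Rightarrow> complex"
  assumes zero_mem: "(\<lambda>x. 0) \<in> H"
    and add_mem: "f \<in> H \<Longrightarrow> g \<in> H \<Longrightarrow> (\<lambda>x. f x + g x) \<in> H"
    and scale_mem: "f \<in> H \<Longrightarrow> (\<lambda>x. c * f x) \<in> H"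
    and ip_add: "f \<in> H \<Longrightarrow> g \<in> H \<Longrightarrow> k \<in> H \<Longrightarrow> ip (\<lambda>x. f x + g x) k = ip f k + ip g k"
    and ip_scale: "f \<in> H \<Longrightarrow> k \<in> H \<Longrightarrow> ip (\<lambda>x. c * f x) k = c * ip f k"
    and ip_cnj: "f \<in> H \<Longrightarrow> g \<in> H \<Longrightarrow> ip g f = cnj (ip f g)"
    and ip_nonneg: "f \<in> H \<Longrightarrow> 0 \<le> Re (ip f f)"
    and ip_definite: "f \<in> H \<Longrightarrow> ip f f = 0 \<Longrightarrow> f = (\<lambda>x. 0)"
begin

lemma diff_mem: "f \<in> H \<Longrightarrow> g \<in> H \<Longrightarrow> (\<lambda>x. f x - g x) \<in> H"
  using add_mem[of f "\<lambda>x. (-1) * g x"] scale_mem[of g "-1"] by simp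

lemma ip_self: "f \<in> H \<Longrightarrow> ip f f = of_real ((hnorm ip f)\<^sup>2)"
  using ip_cnj[of f f] ip_nonneg[of f] by (simp add: hnorm_def complex_eq_iff)

lemma hnorm_nonneg: "f \<in> H \<Longrightarrow> 0 \<le> hnorm ip f"
  by (simp add: hnorm_def ip_nonneg)

lemma hnorm_eq_0: "f \<in> H \<Longrightarrow> hnorm ip f = 0 \<longleftrightarrow> f = (\<lambda>x. 0)"
  using ip_self[of f] ip_definite[of f] ip_scale[of f f 0] by (auto simp: hnorm_def)

lemma ip_add_right: "f \<in> H \<Longrightarrow> g \<in> H \<Longrightarrow> k \<in> H \<Longrightarrow> ip k (\<lambda>x. f x + g x) = ip k f + ip k g"
  using ip_cnj[of "\<lambda>x. f x + g x" k] ip_cnj[of f k] ip_cnj[of g k] add_mem[of f g] ip_add[of f g k]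
  by simp

lemma ip_scale_right: "f \<in> H \<Longrightarrow> k \<in> H \<Longrightarrow> ip k (\<lambda>x. c * f x) = cnj c * ip k f"
  using ip_cnj[of "\<lambda>x. c * f x" k] ip_cnj[of f k] scale_mem[of f c] ip_scale[of f k c] by simp

lemma hnorm_scale: "f \<in> H \<Longrightarrow> hnorm ip (\<lambda>x. c * f x) = norm c * hnorm ip f"
proof -
  assume f: "f \<in> H"
  have "ip (\<lambda>x. c * f x) (\<lambda>x. c * f x) = (c * cnj c) * ip f f"
    using f by (simp add: ip_scale ip_scale_right scale_mem)
  also have "\<dots> = of_real ((norm c)\<^sup>2 * (hnorm ip f)\<^sup>2)"
    using f by (simp add: ip_self complex_norm_square[symmetric])
  finally have "Re (ip (\<lambda>x. c * f x) (\<lambda>x. c * f x)) = (norm c * hnorm ip f)\<^sup>2"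
    by (simp add: power_mult_distrib)
  then show ?thesis
    using f hnorm_nonneg[of f] unfolding hnorm_def[of ip "\<lambda>x. c * f x"] by simp
qed

lemma hnorm_add_sq:
  assumes "f \<in> H" "g \<in> H"
  shows "(hnorm ip (\<lambda>x. f x + g x))\<^sup>2 = (hnorm ip f)\<^sup>2 + (hnorm ip g)\<^sup>2 + 2 * Re (ip f g)"
proof -
  have "ip (\<lambda>x. f x + g x) (\<lambda>x. f x + g x) = ip f f + ip g g + (ip f g + cnj (ip f g))"
    using assms ip_cnj[of f g] by (simp add: ip_add ip_add_right add_mem)
  then have "Re (ip (\<lambda>x. f x + g x) (\<lambda>x. f x + g x)) = Re (ip f f) + Re (ip g g) + 2 * Re (ip f g)"
    by simp
  moreover have "(hnorm ip k)\<^sup>2 = Re (ip k k)" if "k \<in> H" for k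
    using that by (simp add: hnorm_def ip_nonneg)
  ultimately show ?thesis
    using assms add_mem by simp
qed

lemma Re_ip_le:
  assumes f: "f \<in> H" and g: "g \<in> H"
  shows "Re (ip f g) \<le> hnorm ip f * hnorm ip g"
proof (cases "hnorm ip f = 0 \<or> hnorm ip g = 0")
  case True
  then have "ip f g = 0"
    using f g hnorm_eq_0 ip_scale[of f g 0] ip_scale_right[of g f 0] by auto
  then show ?thesis
    using True by auto
next
  case False
  let ?a = "hnorm ip f" and ?b = "hnorm ip g"
  have pos: "?a > 0" "?b > 0"
    using False hnorm_nonneg f g by (auto simp: less_le)
  have mem: "(\<lambda>x. of_real ?b * f x) \<in> H" "(\<lambda>x. of_real (- ?a) * g x) \<in> H"
    by (rule scale_mem[OF f], rule scale_mem[OF g])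
  have "0 \<le> (hnorm ip (\<lambda>x. of_real ?b * f x + of_real (- ?a) * g x))\<^sup>2"
    by simp
  also have "\<dots> = (?b * ?a)\<^sup>2 + (?a * ?b)\<^sup>2
      + 2 * Re (ip (\<lambda>x. of_real ?b * f x) (\<lambda>x. of_real (- ?a) * g x))"
    unfolding hnorm_add_sq[OF mem] using f g pos by (simp only: hnorm_scale norm_of_real) simp
  also have "ip (\<lambda>x. of_real ?b * f x) (\<lambda>x. of_real (- ?a) * g x) = of_real (- (?a * ?b)) * ip f g"
    using f g mem by (simp only: ip_scale ip_scale_right) simp
  also have "Re (of_real (- (?a * ?b)) * ip f g) = - (?a * ?b) * Re (ip f g)"
    by simp
  finally have "(?a * ?b) * Re (ip f g) \<le> (?a * ?b) * (?a * ?b)"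
    by (simp add: power2_eq_square algebra_simps)
  then show ?thesis
    using pos by simp
qed

lemma hnorm_triangle:
  assumes f: "f \<in> H" and g: "g \<in> H"
  shows "hnorm ip (\<lambda>x. f x + g x) \<le> hnorm ip f + hnorm ip g"
proof (rule power2_le_imp_le)
  show "(hnorm ip (\<lambda>x. f x + g x))\<^sup>2 \<le> (hnorm ip f + hnorm ip g)\<^sup>2"
    using Re_ip_le[OF f g] unfolding hnorm_add_sq[OF f g] power2_sum by simp
  show "0 \<le> hnorm ip f + hnorm ip g"
    using f g hnorm_nonneg by simp
qed

sublocale Metric_space H "hdist H ip"
proof
  fix f g k :: "'x \<Rightarrow> complex"
  show "0 \<le> hdist H ip f g"
    by (simp add: hdist_def hnorm_nonneg diff_mem)
  show "hdist H ip f g = hdist H ip g f"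
    using hnorm_scale[of "\<lambda>x. f x - g x" "-1"] diff_mem[of f g] by (simp add: hdist_def)
  assume f: "f \<in> H" and g: "g \<in> H"
  show "hdist H ip f g = 0 \<longleftrightarrow> f = g"
    using f g by (simp add: hdist_def hnorm_eq_0 diff_mem fun_eq_iff)
  assume k: "k \<in> H"
  show "hdist H ip f k \<le> hdist H ip f g + hdist H ip g k"
    using f g k hnorm_triangle[of "\<lambda>x. f x - g x" "\<lambda>x. g x - k x"] by (simp add: hdist_def diff_mem)
qed

end

locale rkhs = inner_function_space H ip
  for H :: "('x \<Rightarrow> complex) set" and ip :: "('x \<Rightarrow> complex) \<Rightarrow> ('x \<Rightarrow> complex) \<Rightarrow> complex" +
  assumes complete: "mcomplete"
    and separable: "separable_space mtopology"
    and bounded_evaluation: "\<exists>C. \<forall>f\<in>H. norm (f x) \<le> C * hnorm ip f"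

definition is_reproducing_kernel ::
    "('x \<Rightarrow> complex) set \<Rightarrow> (('x \<Rightarrow> complex) \<Rightarrow> ('x \<Rightarrow> complex) \<Rightarrow> complex) \<Rightarrow>
      ('x \<Rightarrow> 'x \<Rightarrow> complex) \<Rightarrow> bool"
  where "is_reproducing_kernel H ip K \<longleftrightarrow>
    (\<forall>w. (\<lambda>z. K z w) \<in> H \<and> (\<forall>f\<in>H. ip f (\<lambda>z. K z w) = f w))"


section \<open>Normalized complete Pick spaces\<close>

text \<open>
  For finite \<open>d\<close>, a vector of \<open>\<complex>\<^sup>d\<close> is a sequence whose entries with index \<open>\<ge> d\<close> vanish;
  \<open>d = \<infinity>\<close> gives the unit ball of \<open>\<ell>\<^sup>2\<close>.
\<close>

definition seq_inner :: "(nat \<Rightarrow> complex) \<Rightarrow> (nat \<Rightarrow> complex) \<Rightarrow> complex"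
  where "seq_inner u v = (\<Sum>i. u i * cnj (v i))"

definition open_unit_ball :: "enat \<Rightarrow> (nat \<Rightarrow> complex) set"
  where "open_unit_ball d =
    {u. (\<forall>i. d \<le> enat i \<longrightarrow> u i = 0) \<and> summable (\<lambda>i. (norm (u i))\<^sup>2) \<and> (\<Sum>i. (norm (u i))\<^sup>2) < 1}"

text \<open>
  The complete Pick property is taken in the form of Agler--McCarthy, McCullough and Quiggin.
\<close>

locale normalized_complete_pick = rkhs H ip
  for H :: "('x \<Rightarrow> complex) set" and ip :: "('x \<Rightarrow> complex) \<Rightarrow> ('x \<Rightarrow> complex) \<Rightarrow> complex" +
  fixes K :: "'x \<Rightarrow> 'x \<Rightarrow> complex" and z0 :: 'x
  assumes kernel: "is_reproducing_kernel H ip K"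
    and normalized: "K z z0 = 1"
    and complete_pick: "\<exists>d b. (\<forall>z. b z \<in> open_unit_ball d) \<and> b z0 = (\<lambda>i. 0) \<and>
      (\<forall>z w. K z w = 1 / (1 - seq_inner (b z) (b w)))"


section \<open>Weak products\<close>

definition weak_product_representation ::
    "('x \<Rightarrow> complex) set \<Rightarrow> (('x \<Rightarrow> complex) \<Rightarrow> ('x \<Rightarrow> complex) \<Rightarrow> complex) \<Rightarrow> ('x \<Rightarrow> complex) \<Rightarrow>
      (nat \<Rightarrow> 'x \<Rightarrow> complex) \<Rightarrow> (nat \<Rightarrow> 'x \<Rightarrow> complex) \<Rightarrow> bool"
  where "weak_product_representation H ip h f g \<longleftrightarrow>
    (\<forall>n. f n \<in> H \<and> g n \<in> H) \<and>
    summable (\<lambda>n. hnorm ip (f n) * hnorm ip (g n)) \<and>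
    (\<forall>x. (\<lambda>n. f n x * g n x) sums h x)"

definition weak_product ::
    "('x \<Rightarrow> complex) set \<Rightarrow> (('x \<Rightarrow> complex) \<Rightarrow> ('x \<Rightarrow> complex) \<Rightarrow> complex) \<Rightarrow> ('x \<Rightarrow> complex) set"
  where "weak_product H ip = {h. \<exists>f g. weak_product_representation H ip h f g}"

definition weak_product_norm ::
    "('x \<Rightarrow> complex) set \<Rightarrow> (('x \<Rightarrow> complex) \<Rightarrow> ('x \<Rightarrow> complex) \<Rightarrow> complex) \<Rightarrow> ('x \<Rightarrow> complex) \<Rightarrow> real"
  where "weak_product_norm H ip h =
    Inf {(\<Sum>n. hnorm ip (f n) * hnorm ip (g n)) | f g. weak_product_representation H ip h f g}"

end

theory Submission
  imports Defs
begin

text \<open>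
  On a finite subset, a positive semidefinite kernel \<open>T\<close>, written as a sum of rank one kernels \<open>t t*\<close>, has the
  form \<open>q \<mapsto> \<Sum> \<parallel>q t\<parallel>\<^sup>2\<close>. Among the kernels whose form dominates that of \<open>T\<^sub>0\<close> and whose row sums against the
  inverse Gram matrix are those of \<open>T\<^sub>0\<close>, one of minimal degree has rank one. For
  \<open>T\<^sub>0 = \<Sum> g\<^sub>i g\<^sub>i* + \<epsilon> 1\<close> this gives a zero-free \<open>l\<close> with \<open>\<parallel>l\<parallel>\<^sup>2 = \<Sum> \<parallel>g\<^sub>i\<parallel>\<^sup>2 + \<epsilon>\<close> and
  \<open>\<Sum> \<parallel>q g\<^sub>i\<parallel>\<^sup>2 \<le> \<parallel>q l\<parallel>\<^sup>2\<close> for all \<open>q\<close>.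

  The other factor is \<open>p = \<Sum> f\<^sub>i g\<^sub>i / l\<close>. If \<open>k k*\<close> is the minimizer for \<open>p p* + s 1\<close> and
  \<open>B(x, y) = \<langle>x y / k, p\<rangle>\<close>, then \<open>\<parallel>p\<parallel>\<^sup>2 = \<Sum> B(g\<^sub>i k / l, f\<^sub>i)\<close>, so that \<open>\<parallel>p\<parallel>\<^sup>2 \<le> \<Sum> \<parallel>f\<^sub>i\<parallel>\<^sup>2 + s\<close> as soon
  as \<open>B\<close> has norm at most \<open>1\<close>. This is clear for large \<open>s\<close>. The norm of \<open>B\<close> is never exactly \<open>1\<close>, and it
  depends continuously on \<open>s\<close> because minimizers are unique, hence it is less than \<open>1\<close> for every \<open>s > 0\<close>.

  Balls of \<open>H\<close> are compact in the topology of pointwise convergence; this removes the \<open>\<epsilon>\<close> and the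
  restriction to finite subsets.
\<close>

section \<open>Positive semidefinite kernels\<close>

text \<open>Domination says that the quotients \<open>g i / l\<close> form a contractive column of
  multipliers, while the bound on \<open>p = \<Sum> f i * (g i / l)\<close> asks for a contractive
  row, and the two norms differ in general. The form \<open>B\<close> gets around the row: the
  column is applied to \<open>k\<close>, which yields functions of total squared norm at most that
  of \<open>k\<close>, and these are paired with the \<open>f i\<close> through \<open>B\<close>. A
  scalar bound on \<open>B\<close>, for the particular \<open>p\<close> at hand, then suffices.

  The row sums of a rank one kernel \<open>t t*\<close> encode the functional
  \<open>q -> <q t, t>\<close>. They are linear in the kernel and fix its total norm, so domination
  is gained at no cost in norm.

  The point \<open>z0\<close> matters because a decomposition of \<open>Q = 1 - 1 / K\<close> gives
  a row of multipliers whose range is the orthogonal complement of the constants: exactly the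
  functions vanishing at \<open>z0\<close> can be divided by that row.

  The positive \<open>\<epsilon>\<close> serves twice: it keeps \<open>l\<close> and
  \<open>k\<close> free of zeros, so that quotients make sense, and it is the surplus that forces
  the fixed vectors of the conjugation to vanish at \<open>z0\<close>.\<close>

definition sform :: "'a set \<Rightarrow> ('a \<Rightarrow> 'a \<Rightarrow> complex) \<Rightarrow> ('a \<Rightarrow> complex) \<Rightarrow> ('a \<Rightarrow> complex) \<Rightarrow> complex"
  where "sform Y T c e = (\<Sum>x\<in>Y. \<Sum>y\<in>Y. c x * cnj (e y) * T x y)"

definition psd :: "'a set \<Rightarrow> ('a \<Rightarrow> 'a \<Rightarrow> complex) \<Rightarrow> bool"
  where "psd Y T \<longleftrightarrow> (\<forall>x\<in>Y. \<forall>y\<in>Y. cnj (T x y) = T y x) \<and> (\<forall>c. 0 \<le> Re (sform Y T c c))"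

lemma mult_cnj_self: "z * cnj z = (complex_of_real (norm z))\<^sup>2"
  by (metis complex_norm_square of_real_power)

lemma sform_add_left: "sform Y T (\<lambda>x. c x + d x) e = sform Y T c e + sform Y T d e"
  by (simp add: sform_def sum.distrib algebra_simps)

lemma sform_add_right: "sform Y T c (\<lambda>x. d x + e x) = sform Y T c d + sform Y T c e"
  by (simp add: sform_def sum.distrib algebra_simps)

lemma sform_scale_left: "sform Y T (\<lambda>x. a * c x) e = a * sform Y T c e"
  by (simp add: sform_def sum_distrib_left mult.assoc)

lemma sform_scale_right: "sform Y T c (\<lambda>x. a * e x) = cnj a * sform Y T c e"
  by (simp add: sform_def sum_distrib_left mult_ac)

lemma sform_cong:
  "(\<And>x. x \<in> Y \<Longrightarrow> c x = c' x) \<Longrightarrow> (\<And>x. x \<in> Y \<Longrightarrow> e x = e' x) \<Longrightarrow>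
    (\<And>x y. x \<in> Y \<Longrightarrow> y \<in> Y \<Longrightarrow> T x y = T' x y) \<Longrightarrow> sform Y T c e = sform Y T' c' e'"
  by (auto simp: sform_def intro!: sum.cong)

lemma sform_cnj:
  assumes "\<And>x y. x \<in> Y \<Longrightarrow> y \<in> Y \<Longrightarrow> cnj (T x y) = T y x"
  shows "sform Y T e c = cnj (sform Y T c e)"
proof -
  have "sform Y T e c = (\<Sum>x\<in>Y. \<Sum>y\<in>Y. cnj (c y * cnj (e x) * T y x))"
    unfolding sform_def using assms by (intro sum.cong refl) (simp add: mult_ac)
  also have "\<dots> = (\<Sum>y\<in>Y. \<Sum>x\<in>Y. cnj (c y * cnj (e x) * T y x))"
    by (rule sum.swap)
  finally show ?thesis
    by (simp add: sform_def)
qed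

lemma sform_indicator_right:
  assumes "finite Y" "z \<in> Y"
  shows "sform Y T c (\<lambda>x. if x = z then 1 else 0) = (\<Sum>x\<in>Y. c x * T x z)"
proof -
  have "(\<Sum>y\<in>Y. c x * cnj (if y = z then 1 else 0) * T x y) = c x * T x z" for x
  proof -
    have "(\<Sum>y\<in>Y. c x * cnj (if y = z then 1 else 0) * T x y) = (\<Sum>y\<in>Y. if y = z then c x * T x z else 0)"
      by (intro sum.cong) auto
    then show ?thesis
      using assms by simp
  qed
  then show ?thesis
    by (simp add: sform_def)
qed

lemma sform_indicator:
  assumes "finite Y" "z \<in> Y" "w \<in> Y"
  shows "sform Y T (\<lambda>x. if x = w then 1 else 0) (\<lambda>x. if x = z then 1 else 0) = T w z"
proof -
  have "(\<Sum>x\<in>Y. (if x = w then 1 else 0) * T x z) = (\<Sum>x\<in>Y. if x = w then T w z else 0)"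
    by (intro sum.cong) auto
  then show ?thesis
    using assms by (simp add: sform_indicator_right)
qed

lemma sform_rank_one: "sform Y (\<lambda>x y. s x * cnj (t y)) c e = (\<Sum>x\<in>Y. c x * s x) * cnj (\<Sum>x\<in>Y. e x * t x)"
  by (simp add: sform_def sum_product mult_ac)

lemma sform_kernel_add: "sform Y (\<lambda>x y. S x y + T x y) c e = sform Y S c e + sform Y T c e"
  by (simp add: sform_def sum.distrib algebra_simps)

lemma sform_kernel_diff: "sform Y (\<lambda>x y. S x y - T x y) c e = sform Y S c e - sform Y T c e"
  by (simp add: sform_def sum_subtractf algebra_simps)

lemma sform_kernel_scale: "sform Y (\<lambda>x y. a * T x y) c e = a * sform Y T c e"
  by (simp add: sform_def sum_distrib_left mult_ac)

lemma sform_kernel_sum: "sform Y (\<lambda>x y. \<Sum>i\<in>I. T i x y) c e = (\<Sum>i\<in>I. sform Y (T i) c e)"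
proof -
  have "sform Y (\<lambda>x y. \<Sum>i\<in>I. T i x y) c e = (\<Sum>x\<in>Y. \<Sum>y\<in>Y. \<Sum>i\<in>I. c x * cnj (e y) * T i x y)"
    by (simp add: sform_def sum_distrib_left)
  also have "\<dots> = (\<Sum>x\<in>Y. \<Sum>i\<in>I. \<Sum>y\<in>Y. c x * cnj (e y) * T i x y)"
    by (intro sum.cong refl sum.swap)
  also have "\<dots> = (\<Sum>i\<in>I. \<Sum>x\<in>Y. \<Sum>y\<in>Y. c x * cnj (e y) * T i x y)"
    by (rule sum.swap)
  finally show ?thesis
    by (simp add: sform_def)
qed

lemma psd_herm: "psd Y T \<Longrightarrow> x \<in> Y \<Longrightarrow> y \<in> Y \<Longrightarrow> cnj (T x y) = T y x"
  by (simp add: psd_def)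

lemma psd_nonneg: "psd Y T \<Longrightarrow> 0 \<le> Re (sform Y T c c)"
  by (simp add: psd_def)

lemma psd_sform_cnj: "psd Y T \<Longrightarrow> sform Y T e c = cnj (sform Y T c e)"
  by (rule sform_cnj) (simp add: psd_herm)

lemma psd_rank_one: "psd Y (\<lambda>x y. s x * cnj (s y))"
  unfolding psd_def sform_rank_one complex_norm_square[symmetric] by simp

lemma psd_add: "psd Y S \<Longrightarrow> psd Y T \<Longrightarrow> psd Y (\<lambda>x y. S x y + T x y)"
  unfolding psd_def by (auto simp: sform_kernel_add)

lemma psd_scale: "psd Y T \<Longrightarrow> 0 \<le> a \<Longrightarrow> psd Y (\<lambda>x y. complex_of_real a * T x y)"
  unfolding psd_def by (auto simp: sform_kernel_scale)

lemma psd_sum: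
  assumes "\<And>i. i \<in> I \<Longrightarrow> psd Y (T i)"
  shows "psd Y (\<lambda>x y. \<Sum>i\<in>I. T i x y)"
proof -
  have "cnj (\<Sum>i\<in>I. T i x y) = (\<Sum>i\<in>I. T i y x)" if "x \<in> Y" "y \<in> Y" for x y
    unfolding cnj_sum using psd_herm[OF assms that] by (rule sum.cong[OF refl])
  then show ?thesis
    using psd_nonneg[OF assms] by (simp add: psd_def sform_kernel_sum sum_nonneg)
qed

lemma psd_diag:
  assumes "finite Y" "psd Y T" "x \<in> Y"
  shows "T x x = of_real (Re (T x x))" "0 \<le> Re (T x x)"
proof -
  show "0 \<le> Re (T x x)"
    using psd_nonneg[OF assms(2), of "\<lambda>u. if u = x then 1 else 0"] assms by (simp add: sform_indicator)
  show "T x x = of_real (Re (T x x))"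
    using arg_cong[OF psd_herm[OF assms(2,3,3)], of Im] by (simp add: complex_eq_iff)
qed

lemma psd_perturb:
  assumes "psd Y T"
  shows "0 \<le> Re (sform Y T c c) + 2 * Re (a * sform Y T e c) + (norm a)\<^sup>2 * Re (sform Y T e e)"
proof -
  have "sform Y T (\<lambda>x. c x + a * e x) (\<lambda>x. c x + a * e x) =
      sform Y T c c + (a * sform Y T e c + cnj (a * sform Y T e c)) + (a * cnj a) * sform Y T e e"
    using psd_sform_cnj[OF assms, of c e]
    by (simp add: sform_add_left sform_add_right sform_scale_left sform_scale_right algebra_simps)
  moreover have "a * cnj a = of_real ((norm a)\<^sup>2)"
    by (simp add: complex_norm_square[symmetric])
  ultimately show ?thesis
    using psd_nonneg[OF assms, of "\<lambda>x. c x + a * e x"] by simp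
qed

lemma psd_sform_eq_0:
  assumes "psd Y T" "Re (sform Y T e e) = 0"
  shows "sform Y T e c = 0"
proof (rule ccontr)
  let ?s = "sform Y T e c" and ?m = "Re (sform Y T c c)"
  assume nz: "?s \<noteq> 0"
  \<comment> \<open>Along \<open>e\<close> the form is affine in the step, since its quadratic part
    vanishes. This step makes the linear term \<open>- 2 * (m + 1)\<close>, where \<open>m\<close>
    is the value at \<open>c\<close>, and the total would be negative.\<close>
  define a where "a = - complex_of_real (?m + 1) * cnj ?s / of_real ((norm ?s)\<^sup>2)"
  have "a * ?s = - of_real (?m + 1) * (?s * cnj ?s) / of_real ((norm ?s)\<^sup>2)"
    by (simp add: a_def)
  also have "\<dots> = - of_real (?m + 1)"
    using nz by (simp add: complex_norm_square[symmetric])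
  finally have "0 \<le> ?m - 2 * (?m + 1)"
    using psd_perturb[OF assms(1), of c a e] assms(2) by simp
  then show False
    using psd_nonneg[OF assms(1), of c] by simp
qed

text \<open>One Cholesky elimination step at \<open>z\<close>. If \<open>T z z = 0\<close>, division
  by zero makes \<open>s\<close> vanish, which is the right value: positivity then forces the whole
  column at \<open>z\<close> to be 0.\<close>

lemma psd_schur:
  assumes fin: "finite Y" and z: "z \<in> Y" and T: "psd Y T"
  defines "s \<equiv> \<lambda>x. T x z / of_real (sqrt (Re (T z z)))"
  shows "psd Y (\<lambda>x y. T x y - s x * cnj (s y))"
    and "\<And>x. x \<in> Y \<Longrightarrow> T x z = s x * cnj (s z)"
proof -
  obtain d where d: "T z z = of_real d" "0 \<le> d"
    using psd_diag[OF fin T z] by metis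
  have s: "s x = T x z / of_real (sqrt d)" for x
    by (simp add: s_def d)
  let ?i = "\<lambda>x. if x = z then 1 else (0::complex)"
  have ii: "sform Y T ?i ?i = of_real d"
    using fin z by (simp add: sform_indicator d)
  have ci: "sform Y T c ?i = (\<Sum>x\<in>Y. c x * T x z)" for c
    using fin z by (simp add: sform_indicator_right)
  have sqd: "complex_of_real (sqrt d) * complex_of_real (sqrt d) = of_real d"
    using d(2) by (simp flip: of_real_mult)
  show col: "T x z = s x * cnj (s z)" if x: "x \<in> Y" for x
  proof (cases "d = 0")
    case True
    then have "sform Y T ?i (\<lambda>u. if u = x then 1 else 0) = 0"
      using psd_sform_eq_0[OF T] ii by simp
    then have "T z x = 0"
      using fin z x by (simp add: sform_indicator)
    then show ?thesis
      using psd_herm[OF T z x] by (simp add: s)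
  next
    case False
    have "s x * cnj (s z) = T x z * of_real d / (complex_of_real (sqrt d) * complex_of_real (sqrt d))"
      by (simp add: s d)
    then show ?thesis
      using False sqd by simp
  qed
  have "0 \<le> Re (sform Y (\<lambda>x y. T x y - s x * cnj (s y)) c c)" for c
  proof (cases "d = 0")
    case True
    then have "sform Y (\<lambda>x y. T x y - s x * cnj (s y)) c c = sform Y T c c"
      by (intro sform_cong) (auto simp: s)
    then show ?thesis
      using psd_nonneg[OF T] by simp
  next
    case False
    define L where "L = (\<Sum>x\<in>Y. c x * T x z)"
    have ic: "sform Y T ?i c = cnj L"
      using psd_sform_cnj[OF T, of ?i c] by (simp add: ci L_def)
    have "(\<Sum>x\<in>Y. c x * s x) = L / of_real (sqrt d)"
      by (simp add: s L_def sum_divide_distrib)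
    then have "sform Y (\<lambda>x y. T x y - s x * cnj (s y)) c c
        = sform Y T c c - (L * cnj L) / (complex_of_real (sqrt d) * complex_of_real (sqrt d))"
      by (simp add: sform_kernel_diff sform_rank_one)
    also have "\<dots> = sform Y T c c - of_real ((norm L)\<^sup>2 / d)"
      unfolding sqd by (simp add: mult_cnj_self)
    finally have 1: "Re (sform Y (\<lambda>x y. T x y - s x * cnj (s y)) c c)
        = Re (sform Y T c c) - (norm L)\<^sup>2 / d"
      by simp
    have e: "(- L / of_real d) * cnj L = - of_real ((norm L)\<^sup>2 / d)"
      by (simp add: mult_cnj_self)
    \<comment> \<open>The step \<open>- L / d\<close> minimizes the form along the point mass at
      \<open>z\<close>.\<close>
    have "0 \<le> Re (sform Y T c c) - 2 * ((norm L)\<^sup>2 / d) + (norm L / d)\<^sup>2 * d"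
      using psd_perturb[OF T, of c "- L / of_real d" ?i] d(2) unfolding ic ii e by (simp add: norm_divide)
    also have "(norm L / d)\<^sup>2 * d = (norm L)\<^sup>2 / d"
      using False by (simp add: power2_eq_square)
    finally show ?thesis
      using 1 by simp
  qed
  moreover have "\<forall>x\<in>Y. \<forall>y\<in>Y. cnj (T x y - s x * cnj (s y)) = T y x - s y * cnj (s x)"
    using psd_herm[OF T] by simp
  ultimately show "psd Y (\<lambda>x y. T x y - s x * cnj (s y))"
    unfolding psd_def by blast
qed

lemma psd_subset:
  assumes "psd Y T" "X \<subseteq> Y" "finite Y"
  shows "psd X T"
proof -
  have "0 \<le> Re (sform X T c c)" for c
  proof -
    let ?c = "\<lambda>x. if x \<in> X then c x else 0"
    have "sform Y T ?c ?c = (\<Sum>x\<in>Y. if x \<in> X then (\<Sum>y\<in>X. c x * cnj (c y) * T x y) else 0)"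
      unfolding sform_def
    proof (intro sum.cong refl)
      fix x
      show "(\<Sum>y\<in>Y. ?c x * cnj (?c y) * T x y) = (if x \<in> X then (\<Sum>y\<in>X. c x * cnj (c y) * T x y) else 0)"
        using assms by (auto intro!: sum.mono_neutral_cong_right)
    qed
    also have "\<dots> = sform X T c c"
      unfolding sform_def using assms by (auto intro!: sum.mono_neutral_cong_right)
    finally show ?thesis
      using psd_nonneg[OF assms(1), of ?c] by simp
  qed
  then show ?thesis
    using psd_herm[OF assms(1)] assms(2) by (auto simp: psd_def)
qed

text \<open>Cholesky decomposition, one elimination step per point. The factors found on
  \<open>F\<close> are continued by 0 at \<open>z\<close>, because the row and column of the
  remainder at \<open>z\<close> vanish.\<close>

lemma psd_decomp:
  assumes "finite Y" "psd Y T"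
  shows "\<exists>t. \<forall>x\<in>Y. \<forall>y\<in>Y. T x y = (\<Sum>i\<in>Y. t i x * cnj (t i y))"
  using assms
proof (induction Y arbitrary: T rule: finite_induct)
  case (insert z F)
  define s where "s = (\<lambda>x. T x z / of_real (sqrt (Re (T z z))))"
  have fin: "finite (insert z F)"
    using insert by simp
  have S: "psd (insert z F) (\<lambda>x y. T x y - s x * cnj (s y))"
    "\<And>x. x \<in> insert z F \<Longrightarrow> T x z = s x * cnj (s z)"
    unfolding s_def using psd_schur[OF fin insertI1 insert.prems] by auto
  obtain t where t: "\<And>x y. x \<in> F \<Longrightarrow> y \<in> F \<Longrightarrow> T x y - s x * cnj (s y) = (\<Sum>i\<in>F. t i x * cnj (t i y))"
    using insert.IH[OF psd_subset[OF S(1) subset_insertI fin]] by blast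
  define t' where "t' = (\<lambda>i x. if i = z then s x else if x = z then 0 else t i x)"
  have "T x y = (\<Sum>i\<in>insert z F. t' i x * cnj (t' i y))" if "x \<in> insert z F" "y \<in> insert z F" for x y
  proof -
    have "(\<Sum>i\<in>insert z F. t' i x * cnj (t' i y)) = s x * cnj (s y) + (\<Sum>i\<in>F. t' i x * cnj (t' i y))"
      using insert by (simp add: t'_def)
    also have "(\<Sum>i\<in>F. t' i x * cnj (t' i y)) = (\<Sum>i\<in>F. if x = z \<or> y = z then 0 else t i x * cnj (t i y))"
      using insert by (intro sum.cong) (auto simp: t'_def)
    also have "s x * cnj (s y) + \<dots> = T x y"
    proof (cases "x = z \<or> y = z")
      case True
      have "T x y = s x * cnj (s y)"
      proof (cases "y = z")
        case True
        then show ?thesis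
          using S(2)[OF that(1)] by simp
      next
        case False
        then have "x = z"
          using \<open>x = z \<or> y = z\<close> by simp
        then show ?thesis
          using arg_cong[OF S(2)[OF that(2)], of cnj] psd_herm[OF insert.prems that(2,1)]
          by (simp add: mult.commute)
      qed
      then show ?thesis
        using True by simp
    next
      case False
      then show ?thesis
        using t[of x y] that by (simp add: algebra_simps)
    qed
    finally show ?thesis
      by simp
  qed
  then show ?case
    by blast
qed simp

text \<open>The factor \<open>s\<close> absorbs the whole column at \<open>z\<close>, so the
  diagonal entry of the remainder there is a vanishing sum of squares. Applied at \<open>z0\<close>,
  this leaves only terms that the row of multipliers can divide.\<close>

lemma psd_decomp_at:
  assumes fin: "finite Y" and z: "z \<in> Y" and T: "psd Y T"
  defines "s \<equiv> \<lambda>x. T x z / of_real (sqrt (Re (T z z)))"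
  shows "\<exists>r. (\<forall>i\<in>Y. r i z = 0) \<and>
    (\<forall>x\<in>Y. \<forall>y\<in>Y. T x y = s x * cnj (s y) + (\<Sum>i\<in>Y. r i x * cnj (r i y)))"
proof -
  have S: "psd Y (\<lambda>x y. T x y - s x * cnj (s y))" "\<And>x. x \<in> Y \<Longrightarrow> T x z = s x * cnj (s z)"
    unfolding s_def using psd_schur[OF fin z T] by auto
  obtain r where r: "\<And>x y. x \<in> Y \<Longrightarrow> y \<in> Y \<Longrightarrow> T x y - s x * cnj (s y) = (\<Sum>i\<in>Y. r i x * cnj (r i y))"
    using psd_decomp[OF fin S(1)] by blast
  have "(\<Sum>i\<in>Y. r i z * cnj (r i z)) = 0"
    using r[OF z z] S(2)[OF z] by simp
  then have "complex_of_real (\<Sum>i\<in>Y. (norm (r i z))\<^sup>2) = 0"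
    by (simp add: mult_cnj_self)
  then have "(\<Sum>i\<in>Y. (norm (r i z))\<^sup>2) = 0"
    using of_real_eq_0_iff by blast
  then have "\<forall>i\<in>Y. r i z = 0"
    using fin by (simp add: sum_nonneg_eq_0_iff)
  then show ?thesis
    using r by (intro exI[of _ r]) (auto simp: algebra_simps)
qed

section \<open>Inner product spaces of functions\<close>

context inner_function_space
begin

lemma lincomb_mem:
  assumes "finite Y" "\<And>x. x \<in> Y \<Longrightarrow> g x \<in> H"
  shows "(\<lambda>u. \<Sum>x\<in>Y. c x * g x u) \<in> H"
  using assms
proof (induction Y rule: finite_induct)
  case (insert w F)
  then show ?case
    using add_mem[OF scale_mem[of "g w" "c w"], of "\<lambda>u. \<Sum>x\<in>F. c x * g x u"] by simp
qed (simp add: zero_mem)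

lemma ip_zero_left: "k \<in> H \<Longrightarrow> ip (\<lambda>x. 0) k = 0"
  using ip_scale[OF zero_mem, of k 0] by simp

lemma ip_lincomb_left:
  assumes "finite Y" "\<And>x. x \<in> Y \<Longrightarrow> g x \<in> H" "k \<in> H"
  shows "ip (\<lambda>u. \<Sum>x\<in>Y. c x * g x u) k = (\<Sum>x\<in>Y. c x * ip (g x) k)"
  using assms(1,2)
proof (induction Y rule: finite_induct)
  case (insert w F)
  have "ip (\<lambda>u. c w * g w u + (\<Sum>x\<in>F. c x * g x u)) k = ip (\<lambda>u. c w * g w u) k + ip (\<lambda>u. \<Sum>x\<in>F. c x * g x u) k"
    using insert assms(3) by (intro ip_add scale_mem lincomb_mem) auto
  then show ?case
    using insert assms(3) by (simp add: ip_scale)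
qed (simp add: ip_zero_left assms(3))

lemma ip_lincomb_right:
  assumes "finite Y" "\<And>x. x \<in> Y \<Longrightarrow> g x \<in> H" "k \<in> H"
  shows "ip k (\<lambda>u. \<Sum>x\<in>Y. c x * g x u) = (\<Sum>x\<in>Y. cnj (c x) * ip k (g x))"
proof -
  have "cnj (ip (g x) k) = ip k (g x)" if "x \<in> Y" for x
    using ip_cnj[OF assms(2)[OF that] assms(3)] by simp
  then show ?thesis
    using ip_cnj[OF lincomb_mem[where c = c, OF assms(1,2)] assms(3)] ip_lincomb_left[OF assms, where c = c] by simp
qed

lemma norm_ip_le:
  assumes f: "f \<in> H" and g: "g \<in> H"
  shows "norm (ip f g) \<le> hnorm ip f * hnorm ip g"
proof (cases "ip f g = 0")
  case False
  let ?c = "cnj (ip f g) / of_real (norm (ip f g))"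
  have "ip (\<lambda>x. ?c * f x) g = (ip f g * cnj (ip f g)) / of_real (norm (ip f g))"
    using f g by (simp only: ip_scale) (simp add: mult.commute)
  also have "\<dots> = of_real (norm (ip f g))"
    using False by (simp add: mult_cnj_self power2_eq_square)
  finally have "norm (ip f g) = Re (ip (\<lambda>x. ?c * f x) g)"
    by simp
  also have "\<dots> \<le> hnorm ip (\<lambda>x. ?c * f x) * hnorm ip g"
    by (intro Re_ip_le scale_mem f g)
  also have "hnorm ip (\<lambda>x. ?c * f x) = hnorm ip f"
    using False f by (simp only: hnorm_scale) (simp add: norm_divide)
  finally show ?thesis .
qed (simp add: hnorm_nonneg f g)

text \<open>Pythagoras: \<open>orth\<close> says that \<open>f - g\<close> is orthogonal to
  \<open>g\<close>.\<close>

lemma hnorm_diff_sq: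
  assumes f: "f \<in> H" and g: "g \<in> H" and orth: "ip f g = ip g g"
  shows "(hnorm ip (\<lambda>x. f x - g x))\<^sup>2 = (hnorm ip f)\<^sup>2 - (hnorm ip g)\<^sup>2"
proof -
  have mg: "(\<lambda>x. (-1) * g x) \<in> H"
    by (rule scale_mem[OF g])
  have "(hnorm ip (\<lambda>x. f x + (-1) * g x))\<^sup>2
      = (hnorm ip f)\<^sup>2 + (hnorm ip (\<lambda>x. (-1) * g x))\<^sup>2 + 2 * Re (ip f (\<lambda>x. (-1) * g x))"
    by (rule hnorm_add_sq[OF f mg])
  also have "\<dots> = (hnorm ip f)\<^sup>2 + (hnorm ip g)\<^sup>2 - 2 * Re (ip g g)"
    using f g orth by (simp only: hnorm_scale ip_scale_right) simp
  finally show ?thesis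
    using ip_self[OF g] by simp
qed

end

section \<open>Finite complete Pick spaces\<close>

lemma compact_fun_product:
  fixes A :: "'a \<Rightarrow> 'b::topological_space set"
  assumes "\<And>i. compact (A i)"
  shows "compact {f. \<forall>i. f i \<in> A i}"
proof -
  have "compactin (product_topology (\<lambda>i. euclidean) UNIV) (PiE UNIV A)"
    using assms by (auto simp: compactin_PiE)
  then have "compact (PiE UNIV A)"
    by (simp add: euclidean_product_topology)
  moreover have "PiE UNIV A = {f. \<forall>i. f i \<in> A i}"
    by (auto simp: PiE_def Pi_def)
  ultimately show ?thesis
    by simp
qed

lemma closed_Collect_ball: "(\<And>i. i \<in> I \<Longrightarrow> closed {x. P i x}) \<Longrightarrow> closed {x. \<forall>i\<in>I. P i x}"
  using closed_INT[of I "\<lambda>i. {x. P i x}"] by (simp add: Collect_ball_eq)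

lemma continuous_on_apply2:
  fixes g :: "'c::topological_space \<Rightarrow> 'a \<Rightarrow> 'b \<Rightarrow> 'd::topological_space"
  assumes "continuous_on S g"
  shows "continuous_on S (\<lambda>t. g t x y)"
proof -
  have "continuous_on S (\<lambda>t. g t x)"
    using continuous_on_compose2[OF continuous_on_product_coordinates assms] by simp
  then show ?thesis
    using continuous_on_compose2[OF continuous_on_product_coordinates, of S "\<lambda>t. g t x" y] by simp
qed

text \<open>\<open>K_Q\<close> is \<open>K = 1 / (1 - Q)\<close> without division, and
  \<open>G\<close> is the inverse of the transposed Gram matrix, so that \<open>sform Y G\<close> is
  the inner product with reproducing kernel \<open>K\<close>. Since the Gram matrix is invertible,
  every function on \<open>Y\<close> belongs to the space and every function multiplies it;
  quotients by zero-free functions are therefore always available.\<close>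

locale finite_pick =
  fixes Y :: "'x set" and z0 :: 'x and K Q G :: "'x \<Rightarrow> 'x \<Rightarrow> complex"
  assumes fin: "finite Y" and z0: "z0 \<in> Y"
    and K_herm: "\<And>x y. x \<in> Y \<Longrightarrow> y \<in> Y \<Longrightarrow> cnj (K x y) = K y x"
    and K_Q: "\<And>x y. x \<in> Y \<Longrightarrow> y \<in> Y \<Longrightarrow> Q x y * K x y = K x y - 1"
    and K_z0: "\<And>x. x \<in> Y \<Longrightarrow> K x z0 = 1"
    and Q_psd: "psd Y Q"
    and G_psd: "psd Y G"
    and G_inv: "\<And>x w. x \<in> Y \<Longrightarrow> w \<in> Y \<Longrightarrow> (\<Sum>y\<in>Y. G x y * K w y) = (if x = w then 1 else 0)"
begin

section \<open>The finite dimensional space and its coordinates\<close>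

abbreviation ip :: "('x \<Rightarrow> complex) \<Rightarrow> ('x \<Rightarrow> complex) \<Rightarrow> complex"
  where "ip \<equiv> sform Y G"

definition V :: "('x \<Rightarrow> complex) set"
  where "V = {p. \<forall>x. x \<notin> Y \<longrightarrow> p x = 0}"

definition comb :: "('x \<Rightarrow> complex) \<Rightarrow> 'x \<Rightarrow> complex"
  where "comb a = (\<lambda>u. if u \<in> Y then \<Sum>x\<in>Y. a x * K u x else 0)"

text \<open>The coefficients of \<open>p\<close> in the basis of kernel functions;
  \<open>comb\<close> is the inverse map.\<close>

definition coord :: "('x \<Rightarrow> complex) \<Rightarrow> 'x \<Rightarrow> complex"
  where "coord p = (\<lambda>x. if x \<in> Y then \<Sum>u\<in>Y. p u * G u x else 0)"

lemma V_eqI: "p \<in> V \<Longrightarrow> q \<in> V \<Longrightarrow> (\<And>x. x \<in> Y \<Longrightarrow> p x = q x) \<Longrightarrow> p = q"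
proof (rule ext)
  fix x
  assume "p \<in> V" "q \<in> V" "\<And>x. x \<in> Y \<Longrightarrow> p x = q x"
  then show "p x = q x"
    by (cases "x \<in> Y") (simp_all add: V_def)
qed

lemma comb_mem: "comb a \<in> V"
  by (simp add: comb_def V_def)

lemma mult_mem: "p \<in> V \<Longrightarrow> (\<lambda>x. q x * p x) \<in> V"
  by (simp add: V_def)

lemma K_z0_left: "x \<in> Y \<Longrightarrow> K z0 x = 1"
  using K_herm[OF _ z0, of x] K_z0[of x] by simp

lemma comb_coord: "p \<in> V \<Longrightarrow> comb (coord p) = p"
proof (rule V_eqI[OF comb_mem])
  fix w assume p: "p \<in> V" and w: "w \<in> Y"
  have "comb (coord p) w = (\<Sum>x\<in>Y. \<Sum>u\<in>Y. p u * (G u x * K w x))"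
    using w by (simp add: comb_def coord_def sum_distrib_right mult.assoc)
  also have "\<dots> = (\<Sum>u\<in>Y. p u * (\<Sum>x\<in>Y. G u x * K w x))"
    unfolding sum_distrib_left by (rule sum.swap)
  also have "\<dots> = (\<Sum>u\<in>Y. if u = w then p w else 0)"
    using w by (intro sum.cong) (auto simp: G_inv)
  finally show "comb (coord p) w = p w"
    using fin w by simp
qed

lemma ip_coord: "ip p q = (\<Sum>x\<in>Y. p x * cnj (coord q x))"
proof -
  have "(\<Sum>y\<in>Y. p x * cnj (q y) * G x y) = p x * cnj (coord q x)" if "x \<in> Y" for x
    using that psd_herm[OF G_psd] by (simp add: coord_def sum_distrib_left mult.assoc)
  then show ?thesis
    by (simp add: sform_def)
qed

lemma coord_comb:
  assumes "x \<in> Y"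
  shows "coord (comb a) x = a x"
proof -
  have "cnj (\<Sum>u\<in>Y. G u x * K u w) = (\<Sum>u\<in>Y. G x u * K w u)" if "w \<in> Y" for w
    using assms that psd_herm[OF G_psd] K_herm by simp
  then have inv: "(\<Sum>u\<in>Y. G u x * K u w) = (if w = x then 1 else 0)" if "w \<in> Y" for w
    using G_inv[OF assms that] that by (metis complex_cnj_cnj complex_cnj_one complex_cnj_zero)
  have "coord (comb a) x = (\<Sum>u\<in>Y. \<Sum>w\<in>Y. a w * (G u x * K u w))"
    using assms by (simp add: comb_def coord_def sum_distrib_left mult_ac)
  also have "\<dots> = (\<Sum>w\<in>Y. a w * (\<Sum>u\<in>Y. G u x * K u w))"
    unfolding sum_distrib_left by (rule sum.swap)
  also have "\<dots> = (\<Sum>w\<in>Y. if w = x then a x else 0)"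
    using inv by (intro sum.cong) auto
  finally show ?thesis
    using fin assms by simp
qed

lemma ip_comb: "ip p (comb a) = (\<Sum>x\<in>Y. p x * cnj (a x))"
  by (simp add: ip_coord coord_comb)

lemma Re_ip_nonneg: "0 \<le> Re (ip p p)"
  by (rule psd_nonneg[OF G_psd])

sublocale inner_function_space V ip
proof
  fix f g k c
  show "(\<lambda>x. 0) \<in> V" "f \<in> V \<Longrightarrow> g \<in> V \<Longrightarrow> (\<lambda>x. f x + g x) \<in> V" "f \<in> V \<Longrightarrow> (\<lambda>x. c * f x) \<in> V"
    by (auto simp: V_def)
  show "ip (\<lambda>x. f x + g x) k = ip f k + ip g k"
    by (rule sform_add_left)
  show "ip (\<lambda>x. c * f x) k = c * ip f k"
    by (rule sform_scale_left)
  show "ip g f = cnj (ip f g)"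
    by (rule psd_sform_cnj[OF G_psd])
  show "0 \<le> Re (ip f f)"
    by (rule Re_ip_nonneg)
  assume f: "f \<in> V" and "ip f f = 0"
  then have z: "ip f q = 0" for q
    using psd_sform_eq_0[OF G_psd] by simp
  show "f = (\<lambda>x. 0)"
  proof (rule V_eqI[OF f])
    fix w assume w: "w \<in> Y"
    have "(\<Sum>x\<in>Y. f x * cnj (if x = w then 1 else 0)) = (\<Sum>x\<in>Y. if x = w then f w else 0)"
      by (intro sum.cong) auto
    then show "f w = 0"
      using z[of "comb (\<lambda>x. if x = w then 1 else 0)"] fin w by (simp add: ip_comb)
  qed (simp add: V_def)
qed

abbreviation N :: "('x \<Rightarrow> complex) \<Rightarrow> real"
  where "N \<equiv> hnorm ip"

lemma N_sq: "(N p)\<^sup>2 = Re (ip p p)"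
  by (simp add: hnorm_def Re_ip_nonneg)

lemma ip_sym: "ip q p = cnj (ip p q)"
  by (rule psd_sform_cnj[OF G_psd])

lemma N_cong: "(\<And>x. x \<in> Y \<Longrightarrow> p x = q x) \<Longrightarrow> N p = N q"
  unfolding hnorm_def using sform_cong[of Y p q p q G G] by simp

lemma Re_ip_le_half: "2 * Re (ip p q) \<le> (N p)\<^sup>2 + (N q)\<^sup>2"
  using psd_perturb[OF G_psd, of p "-1" q] ip_sym[of p q] by (simp add: N_sq)

lemma ip_diff_sq:
  "Re (ip (\<lambda>x. p x - q x) (\<lambda>x. p x - q x)) = (N p)\<^sup>2 + (N q)\<^sup>2 - 2 * Re (ip p q)"
proof -
  have "ip (\<lambda>x. p x + (-1) * q x) (\<lambda>x. p x + (-1) * q x) = ip p p - ip p q - ip q p + ip q q"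
    by (simp only: sform_add_left sform_add_right sform_scale_left sform_scale_right) simp
  then show ?thesis
    using ip_sym[of p q] by (simp add: N_sq)
qed

definition kern :: "'x \<Rightarrow> 'x \<Rightarrow> complex"
  where "kern w = (\<lambda>u. if u \<in> Y then K u w else 0)"

lemma kern_mem: "kern w \<in> V"
  by (simp add: kern_def V_def)

lemma ip_kern:
  assumes w: "w \<in> Y"
  shows "ip p (kern w) = p w"
proof -
  let ?i = "\<lambda>u. if u = w then 1 else (0::complex)"
  have "comb ?i = kern w"
  proof
    fix u
    have "(\<Sum>x\<in>Y. ?i x * K u x) = (\<Sum>x\<in>Y. if x = w then K u w else 0)"
      by (intro sum.cong) auto
    then show "comb ?i u = kern w u"
      using fin w by (simp add: comb_def kern_def)
  qed
  moreover have "(\<Sum>x\<in>Y. p x * cnj (?i x)) = (\<Sum>x\<in>Y. if x = w then p w else 0)"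
    by (intro sum.cong) auto
  ultimately show ?thesis
    using ip_comb[of p ?i] fin w by simp
qed

lemma N_kern: "w \<in> Y \<Longrightarrow> N (kern w) = sqrt (Re (K w w))"
  using ip_kern[of w "kern w"] by (simp add: hnorm_def kern_def)

lemma K_diag_nonneg: "w \<in> Y \<Longrightarrow> 0 \<le> Re (K w w)"
  using ip_kern[of w "kern w"] Re_ip_nonneg[of "kern w"] by (simp add: kern_def)

lemma eval_bound: "p \<in> V \<Longrightarrow> x \<in> Y \<Longrightarrow> norm (p x) \<le> sqrt (Re (K x x)) * N p"
  using norm_ip_le[OF _ kern_mem, of p x] by (simp add: ip_kern N_kern mult.commute)

section \<open>The row of multipliers decomposing \<open>Q\<close>, and its adjoint\<close>

definition b :: "'x \<Rightarrow> 'x \<Rightarrow> complex"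
  where "b = (SOME t. \<forall>x\<in>Y. \<forall>y\<in>Y. Q x y = (\<Sum>i\<in>Y. t i x * cnj (t i y)))"

lemma Q_decomp: "x \<in> Y \<Longrightarrow> y \<in> Y \<Longrightarrow> Q x y = (\<Sum>i\<in>Y. b i x * cnj (b i y))"
  using someI_ex[OF psd_decomp[OF fin Q_psd]] unfolding b_def[symmetric] by blast

text \<open>The adjoint of multiplication by \<open>b j\<close>. Adjoints of multipliers act
  diagonally on kernel functions, hence the definition through coefficients.\<close>

definition bstar :: "'x \<Rightarrow> ('x \<Rightarrow> complex) \<Rightarrow> 'x \<Rightarrow> complex"
  where "bstar j p = comb (\<lambda>x. cnj (b j x) * coord p x)"

lemma bstar_mem: "bstar j p \<in> V"
  by (simp add: bstar_def comb_mem)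

lemma coord_bstar: "x \<in> Y \<Longrightarrow> coord (bstar j p) x = cnj (b j x) * coord p x"
  by (simp add: bstar_def coord_comb)

lemma ip_bstar: "ip q (bstar j p) = ip (\<lambda>x. b j x * q x) p"
  unfolding bstar_def ip_comb by (simp add: ip_coord mult_ac)

lemma eval_z0:
  assumes "p \<in> V"
  shows "p z0 = (\<Sum>x\<in>Y. coord p x)"
proof -
  have "p z0 = comb (coord p) z0"
    using assms by (simp add: comb_coord)
  also have "\<dots> = (\<Sum>x\<in>Y. coord p x * K z0 x)"
    using z0 by (simp add: comb_def)
  also have "\<dots> = (\<Sum>x\<in>Y. coord p x)"
    using K_z0_left by (intro sum.cong) auto
  finally show ?thesis .
qed

text \<open>Since \<open>Q * K = K - 1\<close>, the row times its adjoint is the identity minus the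
  projection onto the kernel at \<open>z0\<close>, which is the constant 1.\<close>

lemma sum_b_bstar:
  assumes p: "p \<in> V" and x: "x \<in> Y"
  shows "(\<Sum>j\<in>Y. b j x * bstar j p x) = p x - p z0"
proof -
  have "(\<Sum>j\<in>Y. b j x * bstar j p x) = (\<Sum>j\<in>Y. \<Sum>y\<in>Y. (b j x * cnj (b j y)) * (coord p y * K x y))"
    using x by (simp add: bstar_def comb_def sum_distrib_left mult_ac)
  also have "\<dots> = (\<Sum>y\<in>Y. (\<Sum>j\<in>Y. b j x * cnj (b j y)) * (coord p y * K x y))"
    unfolding sum_distrib_right by (rule sum.swap)
  also have "\<dots> = (\<Sum>y\<in>Y. coord p y * (Q x y * K x y))"
    using x by (intro sum.cong) (simp_all add: Q_decomp)
  also have "\<dots> = (\<Sum>y\<in>Y. coord p y * K x y) - (\<Sum>y\<in>Y. coord p y)"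
    using x by (simp add: K_Q right_diff_distrib sum_subtractf)
  also have "(\<Sum>y\<in>Y. coord p y * K x y) = comb (coord p) x"
    using x by (simp add: comb_def)
  finally show ?thesis
    using p by (simp add: comb_coord eval_z0)
qed

lemma sum_N_bstar:
  assumes p: "p \<in> V"
  shows "(\<Sum>j\<in>Y. (N (bstar j p))\<^sup>2) = (N p)\<^sup>2 - (norm (p z0))\<^sup>2"
proof -
  have "(\<Sum>j\<in>Y. ip (bstar j p) (bstar j p)) = (\<Sum>j\<in>Y. \<Sum>x\<in>Y. (b j x * bstar j p x) * cnj (coord p x))"
    by (simp add: ip_coord coord_bstar mult_ac)
  also have "\<dots> = (\<Sum>x\<in>Y. (\<Sum>j\<in>Y. b j x * bstar j p x) * cnj (coord p x))"
    unfolding sum_distrib_right by (rule sum.swap)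
  also have "\<dots> = (\<Sum>x\<in>Y. p x * cnj (coord p x)) - p z0 * cnj (\<Sum>x\<in>Y. coord p x)"
    using p by (simp add: sum_b_bstar algebra_simps sum_subtractf sum_distrib_left)
  also have "\<dots> = ip p p - (p z0 * cnj (p z0))"
    using p by (simp add: ip_coord eval_z0)
  finally have "Re (\<Sum>j\<in>Y. ip (bstar j p) (bstar j p)) = Re (ip p p) - Re (p z0 * cnj (p z0))"
    by simp
  then show ?thesis
    by (simp add: N_sq mult_cnj_self flip: of_real_power)
qed

text \<open>Dual to \<open>sum_N_bstar\<close>, which says that the adjoint of the row is
  contractive. Pairing the sum \<open>w\<close> with itself moves each \<open>b j\<close> to the
  other side; the inequality between arithmetic and geometric means takes the place of
  Cauchy-Schwarz over \<open>j\<close>.\<close>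

lemma row_contraction: "(N (\<lambda>x. \<Sum>j\<in>Y. b j x * u j x))\<^sup>2 \<le> (\<Sum>j\<in>Y. (N (u j))\<^sup>2)"
proof -
  define w where "w = (\<lambda>x. if x \<in> Y then \<Sum>j\<in>Y. b j x * u j x else 0)"
  have w: "w \<in> V"
    by (simp add: w_def V_def)
  have "ip w w = (\<Sum>x\<in>Y. \<Sum>j\<in>Y. b j x * u j x * cnj (coord w x))"
    unfolding ip_coord by (simp add: w_def sum_distrib_right)
  also have "\<dots> = (\<Sum>j\<in>Y. ip (u j) (bstar j w))"
    unfolding ip_bstar unfolding ip_coord by (rule sum.swap)
  finally have "2 * (N w)\<^sup>2 = (\<Sum>j\<in>Y. 2 * Re (ip (u j) (bstar j w)))"
    by (simp add: N_sq sum_distrib_left)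
  also have "\<dots> \<le> (\<Sum>j\<in>Y. (N (u j))\<^sup>2 + (N (bstar j w))\<^sup>2)"
    by (intro sum_mono Re_ip_le_half)
  also have "\<dots> \<le> (\<Sum>j\<in>Y. (N (u j))\<^sup>2) + (N w)\<^sup>2"
    by (simp add: sum.distrib sum_N_bstar[OF w])
  finally have "(N w)\<^sup>2 \<le> (\<Sum>j\<in>Y. (N (u j))\<^sup>2)"
    by simp
  moreover have "N w = N (\<lambda>x. \<Sum>j\<in>Y. b j x * u j x)"
    by (rule N_cong) (simp add: w_def)
  ultimately show ?thesis
    by simp
qed

section \<open>Row sums, domination form and degree of a kernel\<close>

definition rowsum :: "('x \<Rightarrow> 'x \<Rightarrow> complex) \<Rightarrow> 'x \<Rightarrow> complex"
  where "rowsum T x = (\<Sum>y\<in>Y. T x y * G x y)"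

definition dform :: "('x \<Rightarrow> 'x \<Rightarrow> complex) \<Rightarrow> ('x \<Rightarrow> complex) \<Rightarrow> real"
  where "dform T q = Re (\<Sum>x\<in>Y. \<Sum>y\<in>Y. q x * cnj (q y) * (T x y * G x y))"

text \<open>In the Fock space picture \<open>degree\<close> is the quadratic form of the number operator: with
  \<open>K = \<Sum>\<^sub>n Q\<^sup>n\<close> the weight \<open>Q K\<^sup>2\<close> is \<open>\<Sum>\<^sub>n n Q\<^sup>n\<close>.\<close>

definition degree :: "('x \<Rightarrow> 'x \<Rightarrow> complex) \<Rightarrow> real"
  where "degree T = Re (\<Sum>x\<in>Y. \<Sum>y\<in>Y. (\<Sum>u\<in>Y. \<Sum>v\<in>Y. T u v * (G u x * G y v)) * (Q y x * (K y x)\<^sup>2))"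

definition outer :: "('x \<Rightarrow> complex) \<Rightarrow> 'x \<Rightarrow> 'x \<Rightarrow> complex"
  where "outer p = (\<lambda>x y. p x * cnj (p y))"

lemma rowsum_add: "rowsum (\<lambda>x y. S x y + T x y) x = rowsum S x + rowsum T x"
  by (simp add: rowsum_def sum.distrib algebra_simps)

lemma rowsum_scale: "rowsum (\<lambda>x y. c * T x y) x = c * rowsum T x"
  by (simp add: rowsum_def sum_distrib_left mult.assoc)

lemma rowsum_sum: "rowsum (\<lambda>x y. \<Sum>i\<in>I. T i x y) x = (\<Sum>i\<in>I. rowsum (T i) x)"
  unfolding rowsum_def sum_distrib_right by (rule sum.swap)

lemma dform_sform: "dform T q = Re (sform Y (\<lambda>x y. T x y * G x y) q q)"
  by (simp add: dform_def sform_def)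

lemma dform_add: "dform (\<lambda>x y. S x y + T x y) q = dform S q + dform T q"
  by (simp add: dform_def sum.distrib algebra_simps)

lemma dform_scale: "dform (\<lambda>x y. complex_of_real c * T x y) q = c * dform T q"
proof -
  have "dform (\<lambda>x y. complex_of_real c * T x y) q
      = Re (of_real c * (\<Sum>x\<in>Y. \<Sum>y\<in>Y. q x * cnj (q y) * (T x y * G x y)))"
    by (simp add: dform_def sum_distrib_left mult_ac)
  then show ?thesis
    by (simp add: dform_def)
qed

lemma dform_sum: "dform (\<lambda>x y. \<Sum>i\<in>I. T i x y) q = (\<Sum>i\<in>I. dform (T i) q)"
  unfolding dform_sform sum_distrib_right sform_kernel_sum by simp

lemma degree_add: "degree (\<lambda>x y. S x y + T x y) = degree S + degree T"
  by (simp add: degree_def sum.distrib algebra_simps)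

lemma degree_scale: "degree (\<lambda>x y. complex_of_real c * T x y) = c * degree T"
proof -
  have "degree (\<lambda>x y. complex_of_real c * T x y)
      = Re (of_real c * (\<Sum>x\<in>Y. \<Sum>y\<in>Y. (\<Sum>u\<in>Y. \<Sum>v\<in>Y. T u v * (G u x * G y v)) * (Q y x * (K y x)\<^sup>2)))"
    by (simp add: degree_def sum_distrib_left mult_ac)
  then show ?thesis
    by (simp add: degree_def)
qed

lemma degree_0: "degree (\<lambda>x y. 0) = 0"
  by (simp add: degree_def)

lemma degree_sum: "finite I \<Longrightarrow> degree (\<lambda>x y. \<Sum>i\<in>I. T i x y) = (\<Sum>i\<in>I. degree (T i))"
  by (induction I rule: finite_induct) (simp_all add: degree_0 degree_add)

text \<open>Consequently \<open>\<Sum>x\<in>Y. q x * rowsum (outer p) x\<close> is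
  \<open><q p, p>\<close>. Prescribed row sums fix these numbers for every \<open>q\<close>, and
  with \<open>q = 1\<close> the norm.\<close>

lemma rowsum_outer: "x \<in> Y \<Longrightarrow> rowsum (outer p) x = p x * cnj (coord p x)"
  using psd_herm[OF G_psd] by (simp add: rowsum_def outer_def coord_def sum_distrib_left mult.assoc)

lemma dform_outer: "dform (outer p) q = (N (\<lambda>x. q x * p x))\<^sup>2"
  by (simp add: dform_def outer_def N_sq sform_def mult_ac)

lemma degree_outer:
  "degree (outer p) = Re (\<Sum>x\<in>Y. \<Sum>y\<in>Y. coord p x * cnj (coord p y) * (Q y x * (K y x)\<^sup>2))"
proof -
  have "(\<Sum>u\<in>Y. \<Sum>v\<in>Y. outer p u v * (G u x * G y v)) = coord p x * cnj (coord p y)"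
    if "x \<in> Y" "y \<in> Y" for x y
    using that psd_herm[OF G_psd] by (simp add: outer_def coord_def sum_product mult_ac)
  then show ?thesis
    by (simp add: degree_def)
qed

text \<open>For each \<open>j\<close>,
  \<open><q bstar j p, bstar j p> = <q b j bstar j p, p>\<close>, and the functions
  \<open>b j * bstar j p\<close> add up to \<open>p\<close> because \<open>p z0 = 0\<close>.\<close>

lemma rowsum_bstar:
  assumes p: "p \<in> V" "p z0 = 0" and x: "x \<in> Y"
  shows "(\<Sum>j\<in>Y. rowsum (outer (bstar j p)) x) = rowsum (outer p) x"
proof -
  have "(\<Sum>j\<in>Y. rowsum (outer (bstar j p)) x) = (\<Sum>j\<in>Y. b j x * bstar j p x) * cnj (coord p x)"
    unfolding sum_distrib_right using x by (simp add: rowsum_outer coord_bstar mult_ac)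
  then show ?thesis
    using p x by (simp add: sum_b_bstar rowsum_outer)
qed

text \<open>\<open>q * p\<close> is the image under the row of the functions
  \<open>q * bstar j p\<close>, and the row is contractive.\<close>

lemma dform_bstar:
  assumes p: "p \<in> V" "p z0 = 0"
  shows "dform (outer p) q \<le> (\<Sum>j\<in>Y. dform (outer (bstar j p)) q)"
proof -
  have "N (\<lambda>x. q x * p x) = N (\<lambda>x. \<Sum>j\<in>Y. b j x * (q x * bstar j p x))"
  proof (rule N_cong)
    fix x assume "x \<in> Y"
    then have "q x * (\<Sum>j\<in>Y. b j x * bstar j p x) = q x * p x"
      using p by (simp add: sum_b_bstar)
    then show "q x * p x = (\<Sum>j\<in>Y. b j x * (q x * bstar j p x))"
      by (simp add: sum_distrib_left mult_ac)
  qed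
  then show ?thesis
    using row_contraction[of "\<lambda>j x. q x * bstar j p x"] by (simp add: dform_outer)
qed

text \<open>Passing to the \<open>bstar j p\<close> multiplies the weight \<open>Q * K^2\<close> by
  \<open>Q\<close>, and \<open>Q * (Q * K^2) = Q * K^2 - (K - 1)\<close>. The term \<open>K\<close>
  contributes the squared norm of \<open>p\<close>, the term 1 contributes
  \<open>|p z0|^2 = 0\<close>.\<close>

lemma degree_bstar:
  assumes p: "p \<in> V" "p z0 = 0"
  shows "(\<Sum>j\<in>Y. degree (outer (bstar j p))) = degree (outer p) - (N p)\<^sup>2"
proof -
  let ?a = "coord p"
  have "(\<Sum>j\<in>Y. degree (outer (bstar j p)))
      = Re (\<Sum>j\<in>Y. \<Sum>x\<in>Y. \<Sum>y\<in>Y. (b j y * cnj (b j x)) * (?a x * cnj (?a y) * (Q y x * (K y x)\<^sup>2)))"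
    by (simp add: degree_outer coord_bstar mult_ac)
  also have "(\<Sum>j\<in>Y. \<Sum>x\<in>Y. \<Sum>y\<in>Y. (b j y * cnj (b j x)) * (?a x * cnj (?a y) * (Q y x * (K y x)\<^sup>2)))
      = (\<Sum>x\<in>Y. \<Sum>j\<in>Y. \<Sum>y\<in>Y. (b j y * cnj (b j x)) * (?a x * cnj (?a y) * (Q y x * (K y x)\<^sup>2)))"
    by (rule sum.swap)
  also have "\<dots> = (\<Sum>x\<in>Y. \<Sum>y\<in>Y. (\<Sum>j\<in>Y. b j y * cnj (b j x)) * (?a x * cnj (?a y) * (Q y x * (K y x)\<^sup>2)))"
    unfolding sum_distrib_right by (intro sum.cong refl sum.swap)
  also have "\<dots> = (\<Sum>x\<in>Y. \<Sum>y\<in>Y. ?a x * cnj (?a y) * (Q y x * (K y x)\<^sup>2)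
      - (?a x * K y x * cnj (?a y) - ?a x * cnj (?a y)))"
  proof (intro sum.cong refl)
    fix x y assume xy: "x \<in> Y" "y \<in> Y"
    have "Q y x * (Q y x * (K y x)\<^sup>2) = (Q y x * K y x) * (K y x) * Q y x"
      by (simp add: power2_eq_square)
    also have "\<dots> = Q y x * (K y x)\<^sup>2 - (K y x - 1)"
      unfolding K_Q[OF xy(2,1)] using K_Q[OF xy(2,1)] by (simp add: algebra_simps power2_eq_square)
    finally have "Q y x * (Q y x * (K y x)\<^sup>2) = Q y x * (K y x)\<^sup>2 - (K y x - 1)" .
    then have "?a x * cnj (?a y) * (Q y x * (Q y x * (K y x)\<^sup>2))
        = ?a x * cnj (?a y) * (Q y x * (K y x)\<^sup>2 - (K y x - 1))"
      by simp
    then show "(\<Sum>j\<in>Y. b j y * cnj (b j x)) * (?a x * cnj (?a y) * (Q y x * (K y x)\<^sup>2))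
        = ?a x * cnj (?a y) * (Q y x * (K y x)\<^sup>2) - (?a x * K y x * cnj (?a y) - ?a x * cnj (?a y))"
      using xy by (simp add: Q_decomp[symmetric] algebra_simps)
  qed
  also have "\<dots> = (\<Sum>x\<in>Y. \<Sum>y\<in>Y. ?a x * cnj (?a y) * (Q y x * (K y x)\<^sup>2))
      - (\<Sum>x\<in>Y. \<Sum>y\<in>Y. ?a x * K y x * cnj (?a y)) + (\<Sum>x\<in>Y. ?a x) * (\<Sum>y\<in>Y. cnj (?a y))"
    by (simp add: sum_subtractf sum.distrib sum_product algebra_simps)
  also have "(\<Sum>x\<in>Y. \<Sum>y\<in>Y. ?a x * K y x * cnj (?a y)) = (\<Sum>y\<in>Y. comb ?a y * cnj (?a y))"
    by (subst sum.swap) (simp add: comb_def sum_distrib_right)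
  also have "\<dots> = ip p p"
    using p by (simp add: ip_coord comb_coord)
  also have "(\<Sum>x\<in>Y. ?a x) = 0"
    using p by (simp add: eval_z0)
  finally show ?thesis
    by (simp add: degree_outer N_sq)
qed

section \<open>Outer factors by minimization of the degree\<close>

text \<open>All conditions are closed and convex in \<open>T\<close>: closedness gives existence of
  minimizers, convexity their uniqueness. The support condition makes equality of kernels equality
  on \<open>Y\<close>.\<close>

definition admissible :: "('x \<Rightarrow> 'x \<Rightarrow> complex) \<Rightarrow> ('x \<Rightarrow> 'x \<Rightarrow> complex) set"
  where "admissible T0 = {T. (\<forall>x y. x \<notin> Y \<or> y \<notin> Y \<longrightarrow> T x y = 0) \<and> psd Y T \<and>
    (\<forall>x\<in>Y. rowsum T x = rowsum T0 x) \<and> (\<forall>q. dform T0 q \<le> dform T q)}"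

lemma dform_1: "dform T (\<lambda>_. 1) = Re (\<Sum>x\<in>Y. rowsum T x)"
  by (simp add: dform_def rowsum_def)

lemma psd_outer: "psd Y (outer p)"
  unfolding outer_def by (rule psd_rank_one)

lemma outer_supported: "p \<in> V \<Longrightarrow> x \<notin> Y \<or> y \<notin> Y \<Longrightarrow> outer p x y = 0"
  by (auto simp: outer_def V_def)

lemma restrict_mem: "(\<lambda>x. if x \<in> Y then p x else 0) \<in> V"
  by (simp add: V_def)

lemma admissible_decomp:
  assumes T: "T \<in> admissible T0"
  shows "\<exists>t. (\<forall>i. t i \<in> V) \<and> T = (\<lambda>x y. \<Sum>i\<in>Y. outer (t i) x y) \<and>
    (\<Sum>i\<in>Y. (N (t i))\<^sup>2) = dform T0 (\<lambda>_. 1)"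
proof -
  have supp: "\<And>x y. x \<notin> Y \<or> y \<notin> Y \<Longrightarrow> T x y = 0" and psd: "psd Y T"
    using T by (auto simp: admissible_def)
  obtain t0 where t0: "\<forall>x\<in>Y. \<forall>y\<in>Y. T x y = (\<Sum>i\<in>Y. t0 i x * cnj (t0 i y))"
    using psd_decomp[OF fin psd] by blast
  define t where "t = (\<lambda>i x. if x \<in> Y then t0 i x else 0)"
  have t: "t i \<in> V" for i
    unfolding t_def by (rule restrict_mem)
  have Tt: "T = (\<lambda>x y. \<Sum>i\<in>Y. outer (t i) x y)"
  proof (intro ext)
    fix x y
    show "T x y = (\<Sum>i\<in>Y. outer (t i) x y)"
      using t0 supp[of x y] outer_supported[OF t] by (cases "x \<in> Y \<and> y \<in> Y") (auto simp: t_def outer_def)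
  qed
  have "dform T0 (\<lambda>_. 1) = dform T (\<lambda>_. 1)"
    using T by (simp add: dform_1 admissible_def)
  also have "\<dots> = (\<Sum>i\<in>Y. (N (t i))\<^sup>2)"
    unfolding Tt by (simp add: dform_sum dform_outer)
  finally show ?thesis
    using t Tt by (intro exI[of _ t]) auto
qed

text \<open>The row sums fix the total squared norm of the terms \<open>t i\<close>, and point
  evaluations are bounded on the space.\<close>

lemma admissible_bound:
  assumes T: "T \<in> admissible T0"
  shows "norm (T x y) \<le> (\<Sum>w\<in>Y. Re (K w w)) * dform T0 (\<lambda>_. 1)"
proof -
  let ?C = "\<Sum>w\<in>Y. Re (K w w)"
  obtain t where t: "\<And>i. t i \<in> V" and Tt: "T = (\<lambda>x y. \<Sum>i\<in>Y. outer (t i) x y)"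
    and d: "(\<Sum>i\<in>Y. (N (t i))\<^sup>2) = dform T0 (\<lambda>_. 1)"
    using admissible_decomp[OF T] by blast
  have C: "0 \<le> ?C"
    by (intro sum_nonneg K_diag_nonneg)
  have e: "norm (t i w) \<le> sqrt ?C * N (t i)" for i w
  proof (cases "w \<in> Y")
    case True
    have "Re (K w w) \<le> ?C"
      using member_le_sum[OF True, of "\<lambda>w. Re (K w w)"] K_diag_nonneg fin by simp
    then have "sqrt (Re (K w w)) * N (t i) \<le> sqrt ?C * N (t i)"
      using hnorm_nonneg[OF t] by (intro mult_right_mono) auto
    then show ?thesis
      using eval_bound[OF t True, of i] by linarith
  next
    case False
    then have "t i w = 0"
      using t[of i] by (simp add: V_def)
    then show ?thesis
      using C hnorm_nonneg[OF t] by simp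
  qed
  have "norm (T x y) \<le> (\<Sum>i\<in>Y. norm (t i x) * norm (t i y))"
    unfolding Tt by (rule sum_norm_le) (simp add: outer_def norm_mult)
  also have "\<dots> \<le> (\<Sum>i\<in>Y. (sqrt ?C * N (t i)) * (sqrt ?C * N (t i)))"
    using C hnorm_nonneg[OF t] by (intro sum_mono mult_mono e) auto
  also have "\<dots> = (\<Sum>i\<in>Y. (sqrt ?C * sqrt ?C) * (N (t i))\<^sup>2)"
    by (simp add: power2_eq_square mult_ac)
  also have "sqrt ?C * sqrt ?C = ?C"
    using C by simp
  finally show ?thesis
    by (simp add: d flip: sum_distrib_left)
qed

section \<open>Compactness of the set of admissible kernels\<close>

lemma continuous_on_rowsum:
  assumes "continuous_on S g"
  shows "continuous_on S (\<lambda>t. rowsum (g t) x)"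
  unfolding rowsum_def by (intro continuous_on_sum continuous_on_mult continuous_on_const continuous_on_apply2[OF assms])

lemma continuous_on_dform:
  assumes "continuous_on S g"
  shows "continuous_on S (\<lambda>t. dform (g t) q)"
  unfolding dform_def
  by (intro continuous_on_Re continuous_on_sum continuous_on_mult continuous_on_const continuous_on_apply2[OF assms])

lemma continuous_on_degree:
  assumes "continuous_on S g"
  shows "continuous_on S (\<lambda>t. degree (g t))"
  unfolding degree_def
  by (intro continuous_on_Re continuous_on_sum continuous_on_mult continuous_on_const continuous_on_apply2[OF assms])

lemma continuous_on_sform:
  assumes "continuous_on S g"
  shows "continuous_on S (\<lambda>t. sform Y (g t) c e)"
  unfolding sform_def
  by (intro continuous_on_sum continuous_on_mult continuous_on_const continuous_on_apply2[OF assms])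

lemma closed_psd:
  assumes "continuous_on UNIV g"
  shows "closed {t. psd Y (g t)}"
  unfolding psd_def
  by (intro closed_Collect_conj closed_Collect_ball closed_Collect_all closed_Collect_eq closed_Collect_le
      continuous_on_cnj continuous_on_Re continuous_on_const continuous_on_apply2[OF assms]
      continuous_on_sform[OF assms])

text \<open>The reference kernel varies as well: a constant one gives closedness of
  \<open>admissible T0\<close>, a moving one is what the graph of minimizers over the parameter
  \<open>s\<close> requires.\<close>

lemma closed_admissible:
  assumes g: "continuous_on UNIV g" and h: "continuous_on UNIV h"
  shows "closed {t. g t \<in> admissible (h t)}"
proof -
  have supp: "closed {t. \<forall>x y. x \<notin> Y \<or> y \<notin> Y \<longrightarrow> g t x y = 0}"
    by (intro closed_Collect_all closed_Collect_imp closed_Collect_eq continuous_on_const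
        continuous_on_apply2[OF g]) simp
  show ?thesis
    unfolding admissible_def mem_Collect_eq
    by (rule closed_Collect_conj[OF supp]) (intro closed_Collect_conj closed_psd[OF g] closed_Collect_ball closed_Collect_all closed_Collect_eq
        closed_Collect_le continuous_on_rowsum[OF g] continuous_on_rowsum[OF h] continuous_on_dform[OF g]
        continuous_on_dform[OF h])
qed

lemma compact_bounded_kernels: "compact {T :: 'x \<Rightarrow> 'x \<Rightarrow> complex. \<forall>x y. norm (T x y) \<le> C}"
proof -
  have "compact {g :: 'x \<Rightarrow> complex. \<forall>y. g y \<in> cball 0 C}"
    by (rule compact_fun_product) simp
  then have "compact {T :: 'x \<Rightarrow> 'x \<Rightarrow> complex. \<forall>x. T x \<in> {g. \<forall>y. g y \<in> cball 0 C}}"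
    by (rule compact_fun_product)
  then show ?thesis
    by simp
qed

lemma compact_admissible: "compact (admissible T0)"
proof -
  let ?B = "{T. \<forall>x y. norm (T x y) \<le> (\<Sum>w\<in>Y. Re (K w w)) * dform T0 (\<lambda>_. 1)}"
  have "admissible T0 = ?B \<inter> {T. T \<in> admissible T0}"
    using admissible_bound by blast
  moreover have "compact (?B \<inter> {T. T \<in> admissible T0})"
    by (intro compact_Int_closed compact_bounded_kernels closed_admissible continuous_on_id continuous_on_const)
  ultimately show ?thesis
    by simp
qed

text \<open>Replacing a summand \<open>r r*\<close> with \<open>r z0 = 0\<close> by the sum of the \<open>(bstar j r) (bstar j r)*\<close> keeps the kernel
  admissible and lowers its degree by \<open>\<parallel>r\<parallel>\<^sup>2\<close>.\<close>

lemma minimizer_rank_one: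
  assumes T: "T \<in> admissible T0" and min: "\<And>S. S \<in> admissible T0 \<Longrightarrow> degree T \<le> degree S"
  defines "k \<equiv> \<lambda>x. T x z0 / of_real (sqrt (Re (T z0 z0)))"
  shows "k \<in> V" "T = outer k"
proof -
  have supp: "\<And>x y. x \<notin> Y \<or> y \<notin> Y \<Longrightarrow> T x y = 0" and psd: "psd Y T"
    using T by (auto simp: admissible_def)
  show k: "k \<in> V"
    using supp by (simp add: k_def V_def)
  obtain r0 where r0: "\<And>i. i \<in> Y \<Longrightarrow> r0 i z0 = 0"
    and Tr0: "\<And>x y. x \<in> Y \<Longrightarrow> y \<in> Y \<Longrightarrow> T x y = k x * cnj (k y) + (\<Sum>i\<in>Y. r0 i x * cnj (r0 i y))"
    using psd_decomp_at[OF fin z0 psd] unfolding k_def by blast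
  define r where "r = (\<lambda>i x. if x \<in> Y then r0 i x else 0)"
  have r: "r i \<in> V" and rz: "i \<in> Y \<Longrightarrow> r i z0 = 0" for i
    unfolding r_def by (rule restrict_mem) (simp add: r0)
  have Tr: "T = (\<lambda>x y. outer k x y + (\<Sum>i\<in>Y. outer (r i) x y))"
  proof (intro ext)
    fix x y
    show "T x y = outer k x y + (\<Sum>i\<in>Y. outer (r i) x y)"
    proof (cases "x \<in> Y \<and> y \<in> Y")
      case True
      then show ?thesis
        using Tr0 by (simp add: outer_def r_def)
    next
      case False
      then show ?thesis
        using supp outer_supported[OF k] outer_supported[OF r] by simp
    qed
  qed
  define S where "S = (\<lambda>x y. outer k x y + (\<Sum>i\<in>Y. \<Sum>j\<in>Y. outer (bstar j (r i)) x y))"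
  have "S \<in> admissible T0"
  proof -
    have "psd Y S"
      unfolding S_def by (intro psd_add psd_sum psd_outer)
    moreover have "S x y = 0" if "x \<notin> Y \<or> y \<notin> Y" for x y
      unfolding S_def using that outer_supported[OF k] outer_supported[OF bstar_mem] by simp
    moreover have "rowsum S x = rowsum T x" if x: "x \<in> Y" for x
      unfolding S_def Tr rowsum_add rowsum_sum using rowsum_bstar[OF r rz x] by simp
    moreover have "dform T q \<le> dform S q" for q
      unfolding S_def Tr dform_add dform_sum using dform_bstar[OF r rz] by (intro add_left_mono sum_mono) auto
    ultimately show ?thesis
      using T unfolding admissible_def by (auto intro: order_trans)
  qed
  then have "degree T \<le> degree S"
    by (rule min)
  also have "degree S = degree (outer k) + (\<Sum>i\<in>Y. degree (outer (r i)) - (N (r i))\<^sup>2)"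
    unfolding S_def degree_add degree_sum[OF fin] using degree_bstar[OF r rz] by simp
  also have "degree T = degree (outer k) + (\<Sum>i\<in>Y. degree (outer (r i)))"
    unfolding Tr degree_add degree_sum[OF fin] ..
  finally have "(\<Sum>i\<in>Y. (N (r i))\<^sup>2) \<le> 0"
    by (simp add: sum_subtractf)
  then have "(\<Sum>i\<in>Y. (N (r i))\<^sup>2) = 0"
    by (intro antisym sum_nonneg) simp_all
  then have "\<forall>i\<in>Y. (N (r i))\<^sup>2 = 0"
    using fin by (simp add: sum_nonneg_eq_0_iff)
  then have "\<forall>i\<in>Y. r i = (\<lambda>x. 0)"
    using hnorm_eq_0[OF r] by simp
  then have "(\<Sum>i\<in>Y. outer (r i) x y) = 0" for x y
    by (simp add: outer_def)
  then show "T = outer k"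
    using Tr by simp
qed

lemma minimizer_eq_0_if_z0:
  assumes "T \<in> admissible T0" "\<And>S. S \<in> admissible T0 \<Longrightarrow> degree T \<le> degree S"
    and "T z0 z0 = 0"
  shows "T = (\<lambda>x y. 0)"
  by (subst minimizer_rank_one(2)[OF assms(1,2)]) (simp_all add: assms(3) outer_def)

lemma ex_minimizer:
  assumes "admissible T0 \<noteq> {}"
  shows "\<exists>T\<in>admissible T0. \<forall>S\<in>admissible T0. degree T \<le> degree S"
  using continuous_attains_inf[OF compact_admissible assms continuous_on_degree[OF continuous_on_id]] .

lemma self_admissible:
  "psd Y T \<Longrightarrow> (\<And>x y. x \<notin> Y \<or> y \<notin> Y \<Longrightarrow> T x y = 0) \<Longrightarrow> T \<in> admissible T"
  by (simp add: admissible_def)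

lemma norm_outer_eq: "(\<And>x. x \<in> Y \<Longrightarrow> rowsum (outer k) x = rowsum T x) \<Longrightarrow> (N k)\<^sup>2 = dform T (\<lambda>_. 1)"
  using dform_outer[of k "\<lambda>_. 1"] by (simp add: dform_1)

text \<open>\<open>k\<close> is the normalized column of the minimizer at \<open>z0\<close>. If
  \<open>k z0 = 0\<close>, then \<open>T z0 z0 = 0\<close>, and the division by zero in
  \<open>k\<close> gives \<open>k = 0\<close>.\<close>

lemma ex_dominating:
  assumes "psd Y T0" "\<And>x y. x \<notin> Y \<or> y \<notin> Y \<Longrightarrow> T0 x y = 0"
  shows "\<exists>k\<in>V. outer k \<in> admissible T0 \<and> (k z0 = 0 \<longrightarrow> k = (\<lambda>x. 0))"
proof -
  obtain T where T: "T \<in> admissible T0" and min: "\<And>S. S \<in> admissible T0 \<Longrightarrow> degree T \<le> degree S"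
    using ex_minimizer self_admissible[OF assms] by blast
  define k where "k = (\<lambda>x. T x z0 / of_real (sqrt (Re (T z0 z0))))"
  note k = minimizer_rank_one[OF T min, folded k_def]
  have "k z0 = 0 \<longrightarrow> k = (\<lambda>x. 0)"
  proof
    assume "k z0 = 0"
    then have "T z0 z0 = 0"
      using k(2) by (simp add: outer_def)
    then show "k = (\<lambda>x. 0)"
      by (simp add: k_def)
  qed
  then show ?thesis
    using k T by (intro bexI[of _ k]) auto
qed

text \<open>For a single function the minimizer is a substitute for the outer factor:
  \<open>e / k\<close> is a contractive multiplier, no norm is lost, and a nonzero \<open>e\<close>
  has a \<open>k\<close> that does not vanish at \<open>z0\<close>.\<close>

lemma ex_outer_factor:
  assumes e: "e \<in> V"
  shows "\<exists>k\<in>V. N k = N e \<and> (\<forall>q. N (\<lambda>x. q x * e x) \<le> N (\<lambda>x. q x * k x)) \<and> (k z0 = 0 \<longrightarrow> e = (\<lambda>x. 0))"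
proof -
  obtain k where k: "k \<in> V" and ad: "outer k \<in> admissible (outer e)" and kz: "k z0 = 0 \<longrightarrow> k = (\<lambda>x. 0)"
    using ex_dominating[OF psd_outer outer_supported[OF e]] by blast
  have "(N k)\<^sup>2 = (N e)\<^sup>2"
    using norm_outer_eq[of k "outer e"] ad by (simp add: admissible_def dform_outer)
  then have Nk: "N k = N e"
    using hnorm_nonneg[OF k] hnorm_nonneg[OF e] by simp
  have "N (\<lambda>x. q x * e x) \<le> N (\<lambda>x. q x * k x)" for q
    using ad hnorm_nonneg[OF mult_mem[OF k]] by (auto simp: admissible_def dform_outer intro: power2_le_imp_le)
  moreover have "k z0 = 0 \<longrightarrow> e = (\<lambda>x. 0)"
    using kz Nk hnorm_eq_0[OF k] hnorm_eq_0[OF e] by auto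
  ultimately show ?thesis
    using k Nk by blast
qed

section \<open>The bilinear form of an outer factor\<close>

text \<open>The equality case of Cauchy-Schwarz.\<close>

lemma eq_if_Re_ip_ge:
  assumes u: "u \<in> V" "v \<in> V" and le: "N u \<le> a" "N v \<le> a" and ge: "a\<^sup>2 \<le> Re (ip u v)"
  shows "u = v"
proof -
  have "(N u)\<^sup>2 \<le> a\<^sup>2" "(N v)\<^sup>2 \<le> a\<^sup>2"
    using le hnorm_nonneg[OF u(1)] hnorm_nonneg[OF u(2)] by (auto intro: power_mono)
  then have "(N (\<lambda>x. u x - v x))\<^sup>2 \<le> 0"
    using ge ip_diff_sq[of u v] by (simp add: N_sq)
  then have "(\<lambda>x. u x - v x) = (\<lambda>x. 0)"
    using hnorm_eq_0[OF diff_mem[OF u]] by simp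
  then show ?thesis
    by (simp add: fun_eq_iff)
qed

text \<open>\<open>bil f k p q\<close> is \<open>\<langle>p q / k, f\<rangle>\<close>.\<close>

definition bil :: "('x \<Rightarrow> complex) \<Rightarrow> ('x \<Rightarrow> complex) \<Rightarrow> ('x \<Rightarrow> complex) \<Rightarrow> ('x \<Rightarrow> complex) \<Rightarrow> complex"
  where "bil f k p q = (\<Sum>x\<in>Y. p x * q x * cnj (coord f x) / k x)"

text \<open>The conjugate linear operator that represents \<open>bil\<close>, see
  \<open>ip_conj_op\<close>. Since \<open>bil\<close> is symmetric, its square fixes every vector on
  which a form of norm 1 attains its norm.\<close>

definition conj_op :: "('x \<Rightarrow> complex) \<Rightarrow> ('x \<Rightarrow> complex) \<Rightarrow> ('x \<Rightarrow> complex) \<Rightarrow> 'x \<Rightarrow> complex"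
  where "conj_op f k q = comb (\<lambda>x. cnj (q x * cnj (coord f x) / k x))"

lemma bil_sym: "bil f k p q = bil f k q p"
  by (simp add: bil_def mult_ac)

lemma ip_conj_op: "ip p (conj_op f k q) = bil f k p q"
  unfolding conj_op_def ip_comb by (simp add: bil_def mult.assoc)

lemma conj_op_mem: "conj_op f k q \<in> V"
  by (simp add: conj_op_def comb_mem)

lemma comb_add: "comb (\<lambda>x. a x + c x) = (\<lambda>u. comb a u + comb c u)"
  by (auto simp: comb_def fun_eq_iff sum.distrib algebra_simps)

lemma comb_scale: "comb (\<lambda>x. m * a x) = (\<lambda>u. m * comb a u)"
  by (auto simp: comb_def fun_eq_iff sum_distrib_left mult.assoc)

lemma conj_op_add: "conj_op f k (\<lambda>x. p x + q x) = (\<lambda>x. conj_op f k p x + conj_op f k q x)"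
  unfolding conj_op_def comb_add[symmetric] by (simp add: add_divide_distrib algebra_simps)

lemma conj_op_scale: "conj_op f k (\<lambda>x. m * q x) = (\<lambda>x. cnj m * conj_op f k q x)"
  unfolding conj_op_def comb_scale[symmetric] by (simp add: mult.assoc)

lemma coord_kern:
  assumes w: "w \<in> Y" and x: "x \<in> Y"
  shows "coord (kern w) x = (if x = w then 1 else 0)"
proof -
  have "coord (kern w) x = (\<Sum>u\<in>Y. cnj (G x u * K w u))"
    using x w by (auto simp: coord_def kern_def K_herm psd_herm[OF G_psd] mult.commute intro!: sum.cong)
  also have "\<dots> = cnj (\<Sum>u\<in>Y. G x u * K w u)"
    by simp
  also have "\<dots> = (if x = w then 1 else 0)"
    unfolding G_inv[OF x w] by simp
  finally show ?thesis .
qed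

text \<open>With \<open>p = e / k\<close>, the number \<open><e, k>\<close> is computed in two ways.
  The fixed point equation gives \<open><f, e>\<close>; the row sums of \<open>k\<close> give
  \<open><f, e> + s * p z0\<close>.\<close>

lemma fixed_vanishes_at_z0:
  assumes nz: "\<And>x. x \<in> Y \<Longrightarrow> k x \<noteq> 0" and s: "s \<noteq> 0"
    and row: "\<And>x. x \<in> Y \<Longrightarrow> rowsum (outer k) x = rowsum (outer f) x + of_real s * rowsum (outer (kern z0)) x"
    and e: "conj_op f k e = e"
  shows "e z0 = 0"
proof -
  define p where "p = (\<lambda>x. e x / k x)"
  have ep: "e x = p x * k x" if "x \<in> Y" for x
    using nz[OF that] by (simp add: p_def)
  have ip_e: "ip u e = bil f k u e" for u
    using ip_conj_op[of u f k e] e by simp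
  have 1: "ip k e = ip e f"
    unfolding ip_e[of k] unfolding bil_def ip_coord using nz by (intro sum.cong) auto
  have 2: "ip f e = (\<Sum>x\<in>Y. p x * rowsum (outer f) x)"
    unfolding ip_e[of f] bil_def by (intro sum.cong refl) (simp add: rowsum_outer p_def)
  have "ip e k = (\<Sum>x\<in>Y. p x * rowsum (outer k) x)"
    unfolding ip_coord by (intro sum.cong refl) (simp add: rowsum_outer ep)
  also have "\<dots> = (\<Sum>x\<in>Y. p x * rowsum (outer f) x) + of_real s * (\<Sum>x\<in>Y. p x * rowsum (outer (kern z0)) x)"
    by (simp add: row algebra_simps sum.distrib sum_distrib_left)
  also have "(\<Sum>x\<in>Y. p x * rowsum (outer (kern z0)) x) = (\<Sum>x\<in>Y. if x = z0 then p z0 else 0)"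
  proof (intro sum.cong refl)
    fix x assume x: "x \<in> Y"
    then have "kern z0 x = 1"
      by (simp add: kern_def K_z0)
    then show "p x * rowsum (outer (kern z0)) x = (if x = z0 then p z0 else 0)"
      using x z0 by (simp add: rowsum_outer coord_kern)
  qed
  also have "\<dots> = p z0"
    using fin z0 by simp
  finally have "ip e k = ip f e + of_real s * p z0"
    by (simp add: 2)
  moreover have "ip e k = ip f e"
    using ip_sym[of e k] ip_sym[of e f] 1 by (metis complex_cnj_cnj ip_sym)
  ultimately have "p z0 = 0"
    using s by simp
  then show ?thesis
    using ep z0 by simp
qed

text \<open>Vectors on which the form attains its norm would be spanned by fixed points of the conjugation,
  which vanish at \<open>z0\<close>; but such a space contains the outer factor of each of its elements.\<close>

lemma norm_one_not_attained:
  assumes k: "k \<in> V" and nz: "\<And>x. x \<in> Y \<Longrightarrow> k x \<noteq> 0" and s: "s \<noteq> 0"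
    and row: "\<And>x. x \<in> Y \<Longrightarrow> rowsum (outer k) x = rowsum (outer f) x + of_real s * rowsum (outer (kern z0)) x"
    and le: "\<And>p q. p \<in> V \<Longrightarrow> q \<in> V \<Longrightarrow> norm (bil f k p q) \<le> N p * N q"
    and p: "p \<in> V" "N p \<le> 1" and q: "q \<in> V" "N q \<le> 1"
  shows "norm (bil f k p q) < 1"
proof (rule ccontr)
  assume "\<not> norm (bil f k p q) < 1"
  then have ge: "1 \<le> norm (ip p (conj_op f k q))"
    by (simp add: ip_conj_op)
  let ?C = "conj_op f k"
  have NC: "N (?C u) \<le> N u" if u: "u \<in> V" for u
  proof -
    have "(N (?C u))\<^sup>2 = Re (bil f k (?C u) u)"
      by (simp add: N_sq flip: ip_conj_op)
    also have "\<dots> \<le> N (?C u) * N u"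
      using complex_Re_le_cmod le[OF conj_op_mem u] by (rule order_trans)
    finally show ?thesis
      using hnorm_nonneg[OF conj_op_mem, of f k u] hnorm_nonneg[OF u]
      by (cases "N (?C u) = 0") (auto simp: power2_eq_square)
  qed
  \<comment> \<open>Both \<open>u + ?C u\<close> and, by conjugate linearity,
    \<open>\<i> * (u - ?C u)\<close> are fixed by \<open>?C\<close>. Their vanishing at
    \<open>z0\<close> gives that of \<open>u\<close>.\<close>
  have vanish: "u z0 = 0" if u: "u \<in> V" and CC: "?C (?C u) = u" for u
  proof -
    have fix1: "w z0 + ?C w z0 = 0" if "?C (?C w) = w" for w
    proof (rule fixed_vanishes_at_z0[OF nz s row])
      show "?C (\<lambda>x. w x + ?C w x) = (\<lambda>x. w x + ?C w x)"
        by (simp add: conj_op_add that add.commute)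
    qed
    have "u z0 + ?C u z0 = 0"
      by (rule fix1[OF CC])
    moreover have iu: "?C (\<lambda>x. \<i> * u x) = (\<lambda>x. cnj \<i> * ?C u x)"
      using conj_op_scale[of f k "\<i>" u] .
    have "?C (?C (\<lambda>x. \<i> * u x)) = (\<lambda>x. \<i> * u x)"
      unfolding iu conj_op_scale[of f k "cnj \<i>" "?C u"] CC by simp
    then have "\<i> * u z0 + ?C (\<lambda>x. \<i> * u x) z0 = 0"
      using fix1[of "\<lambda>x. \<i> * u x"] by blast
    then have "\<i> * (u z0 - ?C u z0) = 0"
      unfolding iu by (simp add: algebra_simps)
    ultimately show ?thesis
      by simp
  qed
  have "1 \<le> N p * N (?C q)"
    using ge norm_ip_le[OF p(1) conj_op_mem] by (rule order_trans)
  also have "\<dots> \<le> 1 * N (?C q)"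
    using p hnorm_nonneg[OF conj_op_mem] by (intro mult_right_mono) auto
  finally have "1 \<le> N (?C q)"
    by simp
  then have Nq: "N q = 1" "N (?C q) = 1"
    using NC[OF q(1)] q(2) by auto
  have CCq: "?C (?C q) = q"
  proof (rule sym, rule eq_if_Re_ip_ge[of _ _ 1])
    have "ip q (?C (?C q)) = ip (?C q) (?C q)"
      by (simp add: ip_conj_op bil_sym)
    then show "1\<^sup>2 \<le> Re (ip q (?C (?C q)))"
      using Nq by (simp flip: N_sq)
  qed (use q NC[OF conj_op_mem, of f k q] Nq conj_op_mem in auto)
  have ex_e: "\<exists>e\<in>V. e \<noteq> (\<lambda>x. 0) \<and> ?C e = e"
  proof (cases "(\<lambda>x. q x + ?C q x) = (\<lambda>x. 0)")
    case False
    then show ?thesis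
      by (intro bexI[of _ "\<lambda>x. q x + ?C q x"]) (auto simp: conj_op_add CCq add.commute add_mem q conj_op_mem)
  next
    case True
    then have m: "?C q = (\<lambda>x. - q x)"
      by (simp add: fun_eq_iff add_eq_0_iff)
    have "?C (\<lambda>x. \<i> * q x) = (\<lambda>x. \<i> * q x)"
      by (simp add: conj_op_scale m)
    moreover have "(\<lambda>x. \<i> * q x) \<noteq> (\<lambda>x. 0)"
    proof
      assume "(\<lambda>x. \<i> * q x) = (\<lambda>x. 0)"
      then have "q = (\<lambda>x. 0)"
        by (simp add: fun_eq_iff)
      then show False
        using Nq hnorm_eq_0[OF q(1)] by simp
    qed
    ultimately show ?thesis
      using scale_mem[OF q(1)] by blast
  qed
  then obtain e where e: "e \<in> V" "e \<noteq> (\<lambda>x. 0)" "?C e = e"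
    by blast
  obtain w where w: "w \<in> V" "N w = N e" and dom: "\<And>m. N (\<lambda>x. m x * e x) \<le> N (\<lambda>x. m x * w x)"
    and w0: "w z0 = 0 \<longrightarrow> e = (\<lambda>x. 0)"
    using ex_outer_factor[OF e(1)] by blast
  have ew: "e x = 0" if x: "x \<in> Y" "w x = 0" for x
  proof -
    let ?i = "\<lambda>u. if u = x then 1 else (0::complex)"
    have "N (\<lambda>u. ?i u * w u) = N (\<lambda>u. 0)"
      using x by (intro N_cong) simp
    then have "N (\<lambda>u. ?i u * e u) \<le> 0"
      using dom[of ?i] hnorm_eq_0[OF zero_mem] by simp
    then have "N (\<lambda>u. ?i u * e u) = 0"
      using hnorm_nonneg[OF mult_mem[OF e(1)], of ?i] by simp
    then have "(\<lambda>u. ?i u * e u) = (\<lambda>u. 0)"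
      using hnorm_eq_0[OF mult_mem[OF e(1)], of ?i] by simp
    from fun_cong[OF this, of x] show "e x = 0"
      by simp
  qed
  \<comment> \<open>Since \<open>w * g = e * e\<close>, also at zeros of \<open>w\<close>, the form
    takes the same value at \<open>(w, g)\<close> as at \<open>(e, e)\<close>. Its norm is thus
    attained at \<open>(w, g)\<close>, the operator interchanges \<open>w\<close> and
    \<open>g\<close>, and \<open>vanish\<close> applies to the outer factor \<open>w\<close>
    itself.\<close>
  define g where "g = (\<lambda>x. e x / w x * e x)"
  have g: "g \<in> V"
    unfolding g_def by (rule mult_mem[OF e(1)])
  have "N g \<le> N (\<lambda>x. e x / w x * w x)"
    unfolding g_def by (rule dom)
  also have "\<dots> = N e"
    using ew by (intro N_cong) auto
  finally have Ng: "N g \<le> N e" .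
  have "bil f k w g = bil f k e e"
    unfolding bil_def g_def using ew by (intro sum.cong refl) auto
  also have "\<dots> = ip e e"
    using e(3) by (simp flip: ip_conj_op)
  finally have Bwg: "Re (bil f k w g) = (N e)\<^sup>2"
    by (simp add: N_sq)
  have Cg: "?C g = w"
    using Bwg NC[OF g] Ng w by (intro eq_if_Re_ip_ge[of w _ "N e", symmetric] conj_op_mem) (auto simp: ip_conj_op)
  have Cw: "?C w = g"
    using Bwg NC[OF w(1)] Ng w g
    by (intro eq_if_Re_ip_ge[of g _ "N e", symmetric] conj_op_mem) (auto simp: ip_conj_op bil_sym[of f k g w])
  have "w z0 = 0"
    using vanish[OF w(1)] Cg Cw by simp
  then show False
    using w0 e(2) by simp
qed

section \<open>Uniqueness and continuity of the minimizers\<close>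

lemma kern_z0: "kern z0 = (\<lambda>x. if x \<in> Y then 1 else 0)"
  by (auto simp: kern_def K_z0)

lemma N_kern_z0: "N (kern z0) = 1"
  using z0 by (simp add: N_kern K_z0)

text \<open>The constant function is the vacuum vector: its only coefficient sits at
  \<open>z0\<close>, where \<open>Q\<close> vanishes.\<close>

lemma degree_kern_z0: "degree (outer (kern z0)) = 0"
proof -
  have "Q z0 z0 = 0"
    using K_Q[OF z0 z0] K_z0[OF z0] by simp
  then have "coord (kern z0) x * cnj (coord (kern z0) y) * (Q y x * (K y x)\<^sup>2) = 0" if "x \<in> Y" "y \<in> Y" for x y
    using that z0 by (simp add: coord_kern)
  then have "(\<Sum>x\<in>Y. \<Sum>y\<in>Y. coord (kern z0) x * cnj (coord (kern z0) y) * (Q y x * (K y x)\<^sup>2)) = 0"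
    by (intro sum.neutral ballI) auto
  then show ?thesis
    unfolding degree_outer by simp
qed

definition target :: "('x \<Rightarrow> complex) \<Rightarrow> real \<Rightarrow> 'x \<Rightarrow> 'x \<Rightarrow> complex"
  where "target f s = (\<lambda>x y. outer f x y + of_real s * outer (kern z0) x y)"

lemma psd_target: "0 \<le> s \<Longrightarrow> psd Y (target f s)"
  unfolding target_def by (intro psd_add psd_outer psd_scale)

lemma target_supported: "f \<in> V \<Longrightarrow> x \<notin> Y \<or> y \<notin> Y \<Longrightarrow> target f s x y = 0"
  unfolding target_def using outer_supported[of f x y] outer_supported[OF kern_mem, of x y z0] by simp

lemma rowsum_target: "rowsum (target f s) x = rowsum (outer f) x + of_real s * rowsum (outer (kern z0)) x"
  unfolding target_def rowsum_add rowsum_scale ..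

lemma dform_target: "dform (target f s) q = dform (outer f) q + s * dform (outer (kern z0)) q"
  unfolding target_def dform_add dform_scale ..

lemma dform_target_1: "dform (target f s) (\<lambda>_. 1) = (N f)\<^sup>2 + s"
  by (simp add: dform_target dform_outer N_kern_z0)

lemma continuous_on_target:
  assumes "continuous_on S g"
  shows "continuous_on S (\<lambda>t. target f (g t))"
  unfolding target_def
  by (intro continuous_on_coordinatewise_then_product continuous_on_add continuous_on_mult continuous_on_const
      continuous_on_of_real assms)

section \<open>Minimizers and their rank one factors\<close>

definition minimizers :: "('x \<Rightarrow> 'x \<Rightarrow> complex) \<Rightarrow> ('x \<Rightarrow> 'x \<Rightarrow> complex) set"
  where "minimizers T0 = {T \<in> admissible T0. \<forall>S\<in>admissible T0. degree T \<le> degree S}"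

text \<open>Rank one determines the factor up to a phase. Here the value at \<open>z0\<close> is
  made nonnegative, which turns the factor into a continuous function of the kernel wherever
  \<open>T z0 z0\<close> is positive.\<close>

definition rfactor :: "('x \<Rightarrow> 'x \<Rightarrow> complex) \<Rightarrow> 'x \<Rightarrow> complex"
  where "rfactor T = (\<lambda>x. T x z0 / of_real (sqrt (Re (T z0 z0))))"

lemma rfactor_mem: "T \<in> minimizers T0 \<Longrightarrow> rfactor T \<in> V"
  unfolding minimizers_def rfactor_def using minimizer_rank_one(1) by blast

lemma outer_rfactor: "T \<in> minimizers T0 \<Longrightarrow> outer (rfactor T) = T"
  unfolding minimizers_def rfactor_def using minimizer_rank_one(2)[of T T0] by simp

lemma minimizer_dform_1: "T \<in> minimizers T0 \<Longrightarrow> dform T (\<lambda>_. 1) = dform T0 (\<lambda>_. 1)"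
  by (simp add: minimizers_def admissible_def dform_1)

lemma minimizer_z0_pos:
  assumes T: "T \<in> minimizers T0" and pos: "dform T0 (\<lambda>_. 1) \<noteq> 0"
  shows "0 < Re (T z0 z0)"
proof -
  have psd: "psd Y T"
    using T by (simp add: minimizers_def admissible_def)
  have "T z0 z0 \<noteq> 0"
  proof
    assume "T z0 z0 = 0"
    then have "T = (\<lambda>x y. 0)"
      using T minimizer_eq_0_if_z0 by (auto simp: minimizers_def)
    then have "dform T (\<lambda>_. 1) = 0"
      by (simp add: dform_def)
    then show False
      using pos minimizer_dform_1[OF T] by simp
  qed
  then have "Re (T z0 z0) \<noteq> 0"
    using psd_diag(1)[OF fin psd z0] by (metis of_real_0)
  then show ?thesis
    using psd_diag(2)[OF fin psd z0] by simp
qed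

text \<open>The mean of two minimizers is again a minimizer, hence of rank one.\<close>

lemma minimizers_unique:
  assumes T: "T \<in> minimizers T0" and S: "S \<in> minimizers T0" and pos: "dform T0 (\<lambda>_. 1) \<noteq> 0"
  shows "S = T"
proof -
  define M where "M = (\<lambda>x y. complex_of_real (1/2) * T x y + complex_of_real (1/2) * S x y)"
  have ad: "T \<in> admissible T0" "S \<in> admissible T0"
    using T S by (auto simp: minimizers_def)
  have "M \<in> admissible T0"
  proof -
    have "psd Y M"
      unfolding M_def using ad by (intro psd_add psd_scale) (auto simp: admissible_def)
    moreover have "dform T0 q \<le> dform M q" for q
    proof -
      have "dform T0 q \<le> dform T q" "dform T0 q \<le> dform S q"
        using ad by (auto simp: admissible_def)
      then show ?thesis
        unfolding M_def dform_add dform_scale by simp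
    qed
    moreover have "rowsum M x = rowsum T0 x" if "x \<in> Y" for x
    proof -
      have "rowsum T x = rowsum T0 x" "rowsum S x = rowsum T0 x"
        using ad that by (auto simp: admissible_def)
      then show ?thesis
        unfolding M_def rowsum_add rowsum_scale by simp
    qed
    moreover have "M x y = 0" if "x \<notin> Y \<or> y \<notin> Y" for x y
      using ad that by (auto simp: M_def admissible_def)
    ultimately show ?thesis
      by (simp add: admissible_def)
  qed
  moreover have "degree M = degree T"
  proof -
    have "degree T = degree S"
      using T S by (auto simp: minimizers_def intro: antisym)
    then show ?thesis
      unfolding M_def degree_add degree_scale by simp
  qed
  ultimately have M: "M \<in> minimizers T0"
    using T by (simp add: minimizers_def)
  define a c where "a = rfactor T z0" and "c = rfactor S z0"
  have cross: "rfactor T x * c = rfactor S x * a" for x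
  proof -
    let ?p = "rfactor T x" and ?q = "rfactor S x" and ?m = "rfactor M"
    \<comment> \<open>The 2 by 2 minors of the rank one kernel \<open>M\<close> vanish. For a sum of
      two rank one kernels, the minor at \<open>x\<close> and \<open>z0\<close> is the squared
      modulus of \<open>?p * c - ?q * a\<close>.\<close>
    have "M x y = ?m x * cnj (?m y)" for x y
      using fun_cong[OF fun_cong[OF outer_rfactor[OF M]], of x y] by (simp add: outer_def)
    then have "(2 * M x x) * (2 * M z0 z0) = (2 * M x z0) * (2 * M z0 x)"
      by simp
    moreover have "2 * M x y = rfactor T x * cnj (rfactor T y) + rfactor S x * cnj (rfactor S y)" for x y
      using fun_cong[OF fun_cong[OF outer_rfactor[OF T]], of x y] fun_cong[OF fun_cong[OF outer_rfactor[OF S]], of x y]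
      by (simp add: outer_def M_def)
    ultimately have "(?p * cnj ?p + ?q * cnj ?q) * (a * cnj a + c * cnj c)
        = (?p * cnj a + ?q * cnj c) * (a * cnj ?p + c * cnj ?q)"
      by (simp add: a_def c_def)
    then have "(?p * c - ?q * a) * cnj (?p * c - ?q * a) = 0"
      by (simp add: algebra_simps)
    then have "?p * c - ?q * a = 0"
      by (simp only: mult_eq_0_iff complex_cnj_zero_iff disj_absorb)
    then show ?thesis
      by simp
  qed
  have a0: "a \<noteq> 0"
    using minimizer_z0_pos[OF T pos] by (auto simp: a_def rfactor_def)
  have Seq: "S = (\<lambda>x y. of_real ((norm (c / a))\<^sup>2) * T x y)"
  proof (intro ext)
    fix x y
    have "rfactor S x = c / a * rfactor T x" for x
      using cross[of x] a0 by (simp add: field_simps)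
    then have "outer (rfactor S) x y = (c / a * cnj (c / a)) * outer (rfactor T) x y"
      by (simp add: outer_def)
    also have "c / a * cnj (c / a) = of_real ((norm (c / a))\<^sup>2)"
      by (simp only: mult_cnj_self of_real_power)
    finally show "S x y = of_real ((norm (c / a))\<^sup>2) * T x y"
      by (simp add: outer_rfactor[OF S] outer_rfactor[OF T])
  qed
  have "dform S (\<lambda>_. 1) = (norm (c / a))\<^sup>2 * dform T (\<lambda>_. 1)"
    by (subst Seq) (rule dform_scale)
  then have "(norm (c / a))\<^sup>2 = 1"
    using pos minimizer_dform_1[OF T] minimizer_dform_1[OF S] by simp
  then show ?thesis
    by (subst Seq) simp
qed

lemma ex_target_minimizer: "f \<in> V \<Longrightarrow> 0 \<le> s \<Longrightarrow> \<exists>T. T \<in> minimizers (target f s)"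
  using ex_minimizer[of "target f s"] self_admissible[OF psd_target target_supported, of s f]
  unfolding minimizers_def by blast

text \<open>Domination is tested on the point mass at \<open>x\<close>. The bound excludes zeros of
  the factor for positive \<open>s\<close> and makes the form small for large
  \<open>s\<close>.\<close>

lemma target_rfactor_bound:
  assumes T: "T \<in> minimizers (target f s)" and x: "x \<in> Y"
  shows "s \<le> (norm (rfactor T x))\<^sup>2"
proof -
  let ?i = "\<lambda>u. if u = x then 1 else (0::complex)"
  have im: "?i \<in> V"
    using x by (simp add: V_def)
  have pos: "0 < (N ?i)\<^sup>2"
  proof -
    have "?i \<noteq> (\<lambda>u. 0)"
      by (auto simp: fun_eq_iff)
    then show ?thesis
      using hnorm_eq_0[OF im] by simp
  qed
  have "dform (target f s) ?i \<le> dform (outer (rfactor T)) ?i"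
    using T unfolding outer_rfactor[OF T] by (simp add: minimizers_def admissible_def)
  also have "\<dots> = (norm (rfactor T x))\<^sup>2 * (N ?i)\<^sup>2"
  proof -
    have "(\<lambda>u. ?i u * rfactor T u) = (\<lambda>u. rfactor T x * ?i u)"
      by auto
    then show ?thesis
      using hnorm_scale[OF im, of "rfactor T x"] by (simp add: dform_outer power_mult_distrib)
  qed
  also have "dform (target f s) ?i = (N (\<lambda>u. ?i u * f u))\<^sup>2 + s * (N ?i)\<^sup>2"
  proof -
    have "N (\<lambda>u. ?i u * kern z0 u) = N ?i"
      using x by (intro N_cong) (simp add: kern_z0)
    then show ?thesis
      by (simp add: dform_target dform_outer)
  qed
  finally have "s * (N ?i)\<^sup>2 \<le> (norm (rfactor T x))\<^sup>2 * (N ?i)\<^sup>2"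
    using zero_le_power2[of "N (\<lambda>u. ?i u * f u)"] by linarith
  then show ?thesis
    using pos by simp
qed

definition graph :: "('x \<Rightarrow> complex) \<Rightarrow> real set \<Rightarrow> (real \<times> ('x \<Rightarrow> 'x \<Rightarrow> complex)) set"
  where "graph f I = {t. fst t \<in> I \<and> snd t \<in> minimizers (target f (fst t))}"

text \<open>A kernel admissible at \<open>s'\<close> is moved to \<open>s\<close> by a convex combination with \<open>f f*\<close> and by adding a
  multiple of the constant function, whose degree is \<open>0\<close>. This turns minimality into a closed condition.\<close>

lemma graph_eq:
  assumes I: "I \<subseteq> {0<..}" and f: "f \<in> V"
  shows "graph f I = {t. fst t \<in> I \<and> snd t \<in> admissible (target f (fst t)) \<and>
    (\<forall>s'\<in>I. \<forall>T'\<in>admissible (target f s').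
      degree (snd t) \<le> min 1 (fst t / s') * degree T' + (1 - min 1 (fst t / s')) * degree (outer f))}"
    (is "_ = ?R")
proof (intro equalityI subsetI)
  fix t assume t: "t \<in> graph f I"
  obtain s T where st: "t = (s, T)"
    by (cases t)
  have s: "s \<in> I" "0 < s" and T: "T \<in> admissible (target f s)"
    and min: "\<And>S. S \<in> admissible (target f s) \<Longrightarrow> degree T \<le> degree S"
    using t I by (auto simp: st graph_def minimizers_def)
  have "degree T \<le> min 1 (s / s') * degree T' + (1 - min 1 (s / s')) * degree (outer f)"
    if s': "s' \<in> I" and T': "T' \<in> admissible (target f s')" for s' T'
  proof -
    \<comment> \<open>\<open>c\<close> is the largest weight at most 1 with
      \<open>c * s' \<le> s\<close>; \<open>d\<close> is the missing multiple of the
      constant.\<close>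
    define c d where "c = min 1 (s / s')" and "d = s - c * s'"
    have c: "0 \<le> c" "c \<le> 1" "0 \<le> d"
      using s I s' by (auto simp: c_def d_def min_def divide_simps)
    define S where "S = (\<lambda>x y. of_real c * T' x y + (of_real (1 - c) * outer f x y + of_real d * outer (kern z0) x y))"
    have "S \<in> admissible (target f s)"
    proof -
      have "psd Y S"
        unfolding S_def using T' c by (intro psd_add psd_scale psd_outer) (auto simp: admissible_def)
      moreover have "dform (target f s) q \<le> dform S q" for q
      proof -
        have "c * (dform (outer f) q + s' * dform (outer (kern z0)) q) \<le> c * dform T' q"
          using T' c by (intro mult_left_mono) (auto simp: admissible_def simp flip: dform_target)
        then show ?thesis
          unfolding S_def dform_add dform_scale dform_target by (simp add: d_def algebra_simps)
      qed
      moreover have "rowsum S x = rowsum (target f s) x" if "x \<in> Y" for x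
      proof -
        have "rowsum T' x = rowsum (outer f) x + of_real s' * rowsum (outer (kern z0)) x"
          using T' that by (auto simp: admissible_def rowsum_target)
        then show ?thesis
          unfolding S_def rowsum_add rowsum_scale rowsum_target by (simp add: d_def algebra_simps)
      qed
      moreover have "S x y = 0" if xy: "x \<notin> Y \<or> y \<notin> Y" for x y
        using T' xy outer_supported[OF f xy] outer_supported[OF kern_mem xy]
        by (auto simp: S_def admissible_def)
      ultimately show ?thesis
        by (simp add: admissible_def)
    qed
    then have "degree T \<le> degree S"
      by (rule min)
    also have "degree S = c * degree T' + (1 - c) * degree (outer f)"
      unfolding S_def degree_add degree_scale degree_kern_z0 by simp
    finally show ?thesis
      by (simp add: c_def)
  qed
  then show "t \<in> ?R"
    using s T by (auto simp: st)
next
  fix t assume t: "t \<in> ?R"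
  then have "0 < fst t"
    using I by auto
  then have "min 1 (fst t / fst t) = 1"
    by simp
  then show "t \<in> graph f I"
    using t by (fastforce simp: graph_def minimizers_def)
qed

text \<open>In \<open>graph_eq\<close> the competitors \<open>s'\<close> and \<open>T'\<close> do
  not depend on the point \<open>t\<close> of the graph, so minimality becomes an intersection of
  closed conditions on \<open>t\<close>.\<close>

lemma compact_graph:
  assumes f: "f \<in> V" and I: "I = {l..u}" "0 < l"
  shows "compact (graph f I)"
proof -
  have sub: "I \<subseteq> {0<..}"
    using I by auto
  define C where "C = (\<Sum>w\<in>Y. Re (K w w)) * ((N f)\<^sup>2 + u)"
  have bound: "graph f I \<subseteq> I \<times> {T. \<forall>x y. norm (T x y) \<le> C}"
  proof
    fix t assume "t \<in> graph f I"
    then have s: "fst t \<in> I" and T: "snd t \<in> admissible (target f (fst t))"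
      by (auto simp: graph_def minimizers_def)
    have "norm (snd t x y) \<le> C" for x y
    proof -
      have "norm (snd t x y) \<le> (\<Sum>w\<in>Y. Re (K w w)) * ((N f)\<^sup>2 + fst t)"
        using admissible_bound[OF T] by (simp add: dform_target_1)
      also have "\<dots> \<le> C"
        unfolding C_def using s I by (intro mult_left_mono sum_nonneg K_diag_nonneg) auto
      finally show ?thesis .
    qed
    then show "t \<in> I \<times> {T. \<forall>x y. norm (T x y) \<le> C}"
      using s by (cases t) auto
  qed
  have "compact (I \<times> {T :: 'x \<Rightarrow> 'x \<Rightarrow> complex. \<forall>x y. norm (T x y) \<le> C})"
    unfolding I by (intro compact_Times compact_bounded_kernels) simp
  moreover have "closed (graph f I)"
  proof -
    have fst: "continuous_on UNIV (fst :: real \<times> ('x \<Rightarrow> 'x \<Rightarrow> complex) \<Rightarrow> real)"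
      and snd: "continuous_on UNIV (snd :: real \<times> ('x \<Rightarrow> 'x \<Rightarrow> complex) \<Rightarrow> _)"
      by (rule continuous_on_fst[OF continuous_on_id], rule continuous_on_snd[OF continuous_on_id])
    have "closed {t :: real \<times> ('x \<Rightarrow> 'x \<Rightarrow> complex). fst t \<in> I}"
      unfolding I atLeastAtMost_iff
      by (intro closed_Collect_conj closed_Collect_le fst continuous_on_const)
    moreover have "closed {t :: real \<times> ('x \<Rightarrow> 'x \<Rightarrow> complex). degree (snd t) \<le>
        min 1 (fst t / s') * degree T' + (1 - min 1 (fst t / s')) * degree (outer f)}" if "s' \<in> I" for s' T'
      using that sub
      by (intro closed_Collect_le continuous_on_degree snd continuous_on_add continuous_on_mult continuous_on_min
          continuous_on_diff continuous_on_divide fst continuous_on_const) auto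
    ultimately show ?thesis
      unfolding graph_eq[OF sub f]
      by (intro closed_Collect_conj closed_Collect_ball closed_admissible snd continuous_on_target fst)
  qed
  ultimately have "compact ((I \<times> {T. \<forall>x y. norm (T x y) \<le> C}) \<inter> graph f I)"
    by (intro compact_Int_closed)
  moreover have "(I \<times> {T. \<forall>x y. norm (T x y) \<le> C}) \<inter> graph f I = graph f I"
    using bound by blast
  ultimately show ?thesis
    by simp
qed

lemma compact_unit_ball: "compact {p \<in> V. N p \<le> 1}"
proof -
  let ?C = "\<Sum>w\<in>Y. sqrt (Re (K w w))"
  have "{p \<in> V. N p \<le> 1} = {p. \<forall>x. p x \<in> cball 0 ?C} \<inter> {p. (\<forall>x. x \<notin> Y \<longrightarrow> p x = 0) \<and> Re (ip p p) \<le> 1}"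
  proof -
    have "norm (p x) \<le> ?C" if p: "p \<in> V" "N p \<le> 1" for p x
    proof (cases "x \<in> Y")
      case True
      have "norm (p x) \<le> sqrt (Re (K x x)) * 1"
        using eval_bound[OF p(1) True] p(2) K_diag_nonneg[OF True]
        by (meson mult_left_mono order_trans real_sqrt_ge_zero)
      also have "\<dots> \<le> ?C"
        using member_le_sum[OF True, of "\<lambda>w. sqrt (Re (K w w))"] K_diag_nonneg fin by simp
      finally show ?thesis .
    next
      case False
      then show ?thesis
        using p K_diag_nonneg by (simp add: V_def sum_nonneg)
    qed
    then show ?thesis
      by (auto simp: V_def hnorm_def)
  qed
  moreover have "closed {p. (\<forall>x. x \<notin> Y \<longrightarrow> p x = (0::complex)) \<and> Re (ip p p) \<le> 1}"
  proof -
    have "closed {p. x \<notin> Y \<longrightarrow> p x = (0::complex)}" for x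
      by (intro closed_Collect_imp closed_Collect_eq continuous_on_product_coordinates continuous_on_const) simp
    moreover have "closed {p :: 'x \<Rightarrow> complex. Re (ip p p) \<le> 1}"
      unfolding sform_def
      by (intro closed_Collect_le continuous_on_Re continuous_on_sum continuous_on_mult continuous_on_cnj
          continuous_on_product_coordinates continuous_on_const)
    ultimately show ?thesis
      by (intro closed_Collect_conj closed_Collect_all)
  qed
  moreover have "compact {p :: 'x \<Rightarrow> complex. \<forall>x. p x \<in> cball 0 ?C}"
    by (rule compact_fun_product) simp
  ultimately show ?thesis
    by (simp only: compact_Int_closed)
qed

section \<open>Factorization in a finite Pick space\<close>

lemma bil_scale: "bil f k (\<lambda>x. a * p x) q = a * bil f k p q"
  by (simp add: bil_def sum_distrib_left mult_ac)

lemma bil_le_if_unit: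
  assumes unit: "\<And>p q. p \<in> V \<Longrightarrow> q \<in> V \<Longrightarrow> N p \<le> 1 \<Longrightarrow> N q \<le> 1 \<Longrightarrow> norm (bil f k p q) \<le> 1"
    and p: "p \<in> V" and q: "q \<in> V"
  shows "norm (bil f k p q) \<le> N p * N q"
proof (cases "N p = 0 \<or> N q = 0")
  case True
  then have "p = (\<lambda>x. 0) \<or> q = (\<lambda>x. 0)"
    using hnorm_eq_0 p q by auto
  then show ?thesis
    using hnorm_nonneg p q by (auto simp: bil_def)
next
  case False
  let ?a = "complex_of_real (1 / N p)" and ?c = "complex_of_real (1 / N q)"
  have pos: "0 < N p" "0 < N q"
    using False hnorm_nonneg p q by (auto simp: less_le)
  have "N (\<lambda>x. ?a * p x) \<le> 1" "N (\<lambda>x. ?c * q x) \<le> 1"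
    using pos p q by (simp_all only: hnorm_scale norm_of_real) simp_all
  then have "norm (bil f k (\<lambda>x. ?a * p x) (\<lambda>x. ?c * q x)) \<le> 1"
    using unit scale_mem p q by blast
  also have "bil f k (\<lambda>x. ?a * p x) (\<lambda>x. ?c * q x) = ?a * ?c * bil f k p q"
    unfolding bil_scale bil_sym[of f k p "\<lambda>x. ?c * q x"] bil_sym[of f k p q] by (simp only: mult.assoc)
  finally show ?thesis
    using pos by (simp add: norm_mult norm_divide field_simps)
qed

lemma continuous_on_bil_rfactor:
  assumes g: "continuous_on S g" and p: "continuous_on S p" and q: "continuous_on S q"
    and pos: "\<And>t. t \<in> S \<Longrightarrow> 0 < Re (g t z0 z0)"
    and nz: "\<And>t x. t \<in> S \<Longrightarrow> x \<in> Y \<Longrightarrow> rfactor (g t) x \<noteq> 0"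
  shows "continuous_on S (\<lambda>t. norm (bil f (rfactor (g t)) (p t) (q t)))"
proof -
  have g': "continuous_on S (\<lambda>t. g t x z0)" for x
    by (rule continuous_on_apply2[OF g])
  have r: "continuous_on S (\<lambda>t. rfactor (g t) x)" for x
    unfolding rfactor_def using pos
    by (intro continuous_on_divide g' continuous_on_of_real continuous_on_real_sqrt continuous_on_Re) force
  have "continuous_on S (\<lambda>t. p t x)" "continuous_on S (\<lambda>t. q t x)" for x
    using continuous_on_compose2[OF continuous_on_product_coordinates p]
      continuous_on_compose2[OF continuous_on_product_coordinates q] by auto
  then show ?thesis
    unfolding bil_def using nz
    by (intro continuous_on_norm continuous_on_sum continuous_on_divide continuous_on_mult r continuous_on_const) auto
qed

lemma bil_contraction:
  assumes f: "f \<in> V" and eps: "0 < \<epsilon>"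
  shows "\<exists>k\<in>V. (\<forall>x\<in>Y. k x \<noteq> 0) \<and> (N k)\<^sup>2 = (N f)\<^sup>2 + \<epsilon> \<and>
    (\<forall>p\<in>V. \<forall>q\<in>V. norm (bil f k p q) \<le> N p * N q)"
proof -
  \<comment> \<open>\<open>M\<close> bounds the numerators of the form on unit vectors. At parameter
    \<open>L\<close> the denominators are at least \<open>sqrt L \<ge> M\<close>, so the norm is at
    most 1.\<close>
  define M where "M = (\<Sum>x\<in>Y. Re (K x x) * norm (coord f x))"
  define L where "L = \<epsilon> + M\<^sup>2 + 1"
  define I where "I = {\<epsilon>..L}"
  define R where "R = graph f I"
  define U where "U = {p \<in> V. N p \<le> 1}"
  define F where "F = (\<lambda>T p q. norm (bil f (rfactor T) p q))"
  have U0: "(\<lambda>x. 0) \<in> U"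
    using zero_mem hnorm_eq_0[OF zero_mem] by (simp add: U_def)
  have Ipos: "0 < s" if "s \<in> I" for s
    using that eps by (simp add: I_def)
  have compR: "compact R"
    unfolding R_def by (rule compact_graph[OF f I_def eps])
  have compU: "compact U"
    unfolding U_def by (rule compact_unit_ball)
  have R: "T \<in> minimizers (target f s)" "s \<in> I" if "(s, T) \<in> R" for s T
    using that by (auto simp: R_def graph_def)
  have R_ex: "\<exists>T. (s, T) \<in> R" if "s \<in> I" for s
    using ex_target_minimizer[OF f, of s] Ipos[OF that] that by (auto simp: R_def graph_def)
  have dpos: "dform (target f s) (\<lambda>_. 1) \<noteq> 0" if "s \<in> I" for s
    using add_nonneg_pos[OF zero_le_power2[of "N f"] Ipos[OF that]] by (simp add: dform_target_1)
  have pos: "0 < Re (T z0 z0)" if "(s, T) \<in> R" for s T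
    using minimizer_z0_pos[OF R(1)[OF that] dpos[OF R(2)[OF that]]] .
  have nz: "rfactor T x \<noteq> 0" if "(s, T) \<in> R" "x \<in> Y" for s T x
    using target_rfactor_bound[OF R(1)[OF that(1)] that(2)] Ipos[OF R(2)[OF that(1)]] by auto
  have not1: "F T p q < 1"
    if "(s, T) \<in> R" and le: "\<forall>p\<in>U. \<forall>q\<in>U. F T p q \<le> 1" and "p \<in> U" "q \<in> U" for s T p q
    unfolding F_def
  proof (rule norm_one_not_attained)
    show "rfactor T \<in> V"
      using rfactor_mem R(1) that(1) by blast
    show "s \<noteq> 0"
      using Ipos R(2) that(1) by blast
    have "outer (rfactor T) \<in> admissible (target f s)"
      using outer_rfactor[OF R(1)[OF that(1)]] R(1)[OF that(1)] by (simp add: minimizers_def)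
    then show "rowsum (outer (rfactor T)) x = rowsum (outer f) x + of_real s * rowsum (outer (kern z0)) x"
      if "x \<in> Y" for x
      using that by (simp add: admissible_def rowsum_target)
    show "norm (bil f (rfactor T) p q) \<le> N p * N q" if "p \<in> V" "q \<in> V" for p q
      using le that by (intro bil_le_if_unit) (auto simp: F_def U_def)
  qed (use that nz in \<open>auto simp: U_def\<close>)
  define A where "A = fst ` {t \<in> R. \<forall>p\<in>U. \<forall>q\<in>U. F (snd t) p q \<le> 1}"
  \<comment> \<open>Carrying \<open>p\<close> and \<open>q\<close> along makes this a projection of
    a compact set; the weak inequality keeps that set closed.\<close>
  define B where "B = fst ` {t \<in> R \<times> U \<times> U. 1 \<le> F (snd (fst t)) (fst (snd t)) (snd (snd t))}"
  have "compact A"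
  proof -
    have "closedin (top_of_set R) (\<Inter>(p,q)\<in>U \<times> U. R \<inter> (\<lambda>t. F (snd t) p q) -` {..1})"
    proof (rule closedin_INT)
      fix t assume "t \<in> U \<times> U"
      have "continuous_on R (\<lambda>t. F (snd t) p q)" for p q
        unfolding F_def using pos nz
        by (intro continuous_on_bil_rfactor continuous_on_snd continuous_on_id continuous_on_const) auto
      then show "closedin (top_of_set R) (case t of (p, q) \<Rightarrow> R \<inter> (\<lambda>t. F (snd t) p q) -` {..1})"
        by (cases t) (auto intro!: continuous_closedin_preimage)
    qed (use U0 in auto)
    moreover have "(\<Inter>(p,q)\<in>U \<times> U. R \<inter> (\<lambda>t. F (snd t) p q) -` {..1})
        = {t \<in> R. \<forall>p\<in>U. \<forall>q\<in>U. F (snd t) p q \<le> 1}"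
      using U0 by auto
    ultimately have "compact {t \<in> R. \<forall>p\<in>U. \<forall>q\<in>U. F (snd t) p q \<le> 1}"
      using closedin_compact[OF compR] by simp
    then show ?thesis
      unfolding A_def by (intro compact_continuous_image continuous_on_fst continuous_on_id)
  qed
  moreover have "compact (fst ` B)"
  proof -
    let ?S = "R \<times> U \<times> U"
    have "continuous_on ?S (\<lambda>t. F (snd (fst t)) (fst (snd t)) (snd (snd t)))"
      unfolding F_def using pos nz
      by (intro continuous_on_bil_rfactor continuous_on_snd continuous_on_fst continuous_on_id) auto
    then have "closedin (top_of_set ?S) (?S \<inter> (\<lambda>t. F (snd (fst t)) (fst (snd t)) (snd (snd t))) -` {1..})"
      by (rule continuous_closedin_preimage) simp
    moreover have "compact ?S"
      by (intro compact_Times compR compU)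
    ultimately have "compact (?S \<inter> (\<lambda>t. F (snd (fst t)) (fst (snd t)) (snd (snd t))) -` {1..})"
      by (rule closedin_compact[rotated])
    moreover have "?S \<inter> (\<lambda>t. F (snd (fst t)) (fst (snd t)) (snd (snd t))) -` {1..}
        = {t \<in> ?S. 1 \<le> F (snd (fst t)) (fst (snd t)) (snd (snd t))}"
      by auto
    ultimately show ?thesis
      unfolding B_def by (simp only:) (intro compact_continuous_image continuous_on_fst continuous_on_id)
  qed
  moreover have "I \<subseteq> A \<union> fst ` B"
  proof
    fix s assume "s \<in> I"
    then obtain T where T: "(s, T) \<in> R"
      using R_ex by blast
    show "s \<in> A \<union> fst ` B"
    proof (cases "\<forall>p\<in>U. \<forall>q\<in>U. F T p q \<le> 1")
      case True
      then show ?thesis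
        using T unfolding A_def by force
    next
      case False
      then obtain p q where "p \<in> U" "q \<in> U" "1 \<le> F T p q"
        by force
      then have "((s, T), p, q) \<in> {t \<in> R \<times> U \<times> U. 1 \<le> F (snd (fst t)) (fst (snd t)) (snd (snd t))}"
        using T by simp
      then show ?thesis
        unfolding B_def by force
    qed
  qed
  moreover have "A \<inter> fst ` B \<inter> I = {}"
  proof -
    have False if sA: "s \<in> A" and sB: "s \<in> fst ` B" for s
    proof -
      obtain t where t: "s = fst t" "t \<in> R" "\<forall>p\<in>U. \<forall>q\<in>U. F (snd t) p q \<le> 1"
        using sA unfolding A_def by blast
      define T where "T = snd t"
      have T: "(s, T) \<in> R" "\<forall>p\<in>U. \<forall>q\<in>U. F T p q \<le> 1"
        using t by (simp_all add: T_def)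
      obtain T' p q where T': "(s, T') \<in> R" "p \<in> U" "q \<in> U" "1 \<le> F T' p q"
        using sB unfolding B_def by auto
      have "T' = T"
        using minimizers_unique[OF R(1)[OF T(1)] R(1)[OF T'(1)] dpos[OF R(2)[OF T(1)]]] .
      then show False
        using not1[OF T, of p q] T' by simp
    qed
    then show ?thesis
      by blast
  qed
  moreover have "connected I"
    by (simp add: I_def)
  ultimately have "A \<inter> I = {} \<or> fst ` B \<inter> I = {}"
    unfolding connected_closed using compact_imp_closed by blast
  moreover have "L \<in> I"
    using eps by (simp add: I_def L_def)
  moreover have "L \<in> A"
  proof -
    obtain T where T: "(L, T) \<in> R"
      using R_ex \<open>L \<in> I\<close> by blast
    have M0: "0 \<le> M"
      unfolding M_def by (intro sum_nonneg mult_nonneg_nonneg K_diag_nonneg) auto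
    have L: "0 < L" "M \<le> sqrt L"
    proof -
      show "0 < L"
        unfolding L_def using eps zero_le_power2[of M] by linarith
      show "M \<le> sqrt L"
        using eps by (intro real_le_rsqrt) (simp add: L_def)
    qed
    have "F T p q \<le> 1" if p: "p \<in> U" and q: "q \<in> U" for p q
    proof -
      have "F T p q \<le> (\<Sum>x\<in>Y. norm (p x * q x * cnj (coord f x) / rfactor T x))"
        unfolding F_def bil_def by (rule norm_sum)
      also have "\<dots> \<le> (\<Sum>x\<in>Y. Re (K x x) * norm (coord f x) / sqrt L)"
      proof (rule sum_mono)
        fix x assume x: "x \<in> Y"
        have e: "norm (u x) \<le> sqrt (Re (K x x))" if "u \<in> U" for u
        proof -
          have "norm (u x) \<le> sqrt (Re (K x x)) * N u"
            using that eval_bound[OF _ x, of u] by (simp add: U_def)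
          also have "\<dots> \<le> sqrt (Re (K x x)) * 1"
            using that K_diag_nonneg[OF x] by (intro mult_left_mono) (auto simp: U_def)
          finally show ?thesis
            by simp
        qed
        have "norm (p x) * norm (q x) \<le> sqrt (Re (K x x)) * sqrt (Re (K x x))"
          using e[OF p] e[OF q] K_diag_nonneg[OF x] by (intro mult_mono) auto
        then have pq: "norm (p x) * norm (q x) \<le> Re (K x x)"
          using K_diag_nonneg[OF x] by simp
        have "sqrt L \<le> sqrt ((norm (rfactor T x))\<^sup>2)"
          using target_rfactor_bound[OF R(1)[OF T] x] by (rule real_sqrt_le_mono)
        then have "sqrt L \<le> norm (rfactor T x)"
          by simp
        then show "norm (p x * q x * cnj (coord f x) / rfactor T x) \<le> Re (K x x) * norm (coord f x) / sqrt L"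
          unfolding norm_divide norm_mult complex_mod_cnj using pq L K_diag_nonneg[OF x]
          by (intro frac_le mult_right_mono mult_nonneg_nonneg) auto
      qed
      also have "\<dots> = M / sqrt L"
        by (simp add: M_def sum_divide_distrib)
      also have "\<dots> \<le> 1"
        using L by simp
      finally show ?thesis .
    qed
    then show ?thesis
      using T unfolding A_def by force
  qed
  ultimately have "fst ` B \<inter> I = {}"
    by blast
  moreover have "\<epsilon> \<in> I"
    by (simp add: I_def L_def)
  ultimately have "\<epsilon> \<in> A"
    using \<open>I \<subseteq> A \<union> fst ` B\<close> by blast
  then obtain t where t: "\<epsilon> = fst t" "t \<in> R" "\<forall>p\<in>U. \<forall>q\<in>U. F (snd t) p q \<le> 1"
    unfolding A_def by blast
  define T where "T = snd t"
  have T: "(\<epsilon>, T) \<in> R" "\<forall>p\<in>U. \<forall>q\<in>U. F T p q \<le> 1"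
    using t by (simp_all add: T_def)
  show ?thesis
  proof (intro bexI conjI ballI)
    show "rfactor T \<in> V"
      using rfactor_mem R(1)[OF T(1)] by blast
    show "rfactor T x \<noteq> 0" if "x \<in> Y" for x
      using nz[OF T(1) that] .
    have "(N (rfactor T))\<^sup>2 = dform T (\<lambda>_. 1)"
      using dform_outer[of "rfactor T" "\<lambda>_. 1"] by (simp add: outer_rfactor[OF R(1)[OF T(1)]])
    then show "(N (rfactor T))\<^sup>2 = (N f)\<^sup>2 + \<epsilon>"
      by (simp add: minimizer_dform_1[OF R(1)[OF T(1)]] dform_target_1)
    show "norm (bil f (rfactor T) p q) \<le> N p * N q" if "p \<in> V" "q \<in> V" for p q
      using T(2) that by (intro bil_le_if_unit) (auto simp: F_def U_def)
  qed
qed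

lemma finite_factorization:
  fixes f g :: "nat \<Rightarrow> 'x \<Rightarrow> complex"
  assumes f: "\<And>i. f i \<in> V" and g: "\<And>i. g i \<in> V" and eps: "0 < \<epsilon>"
  shows "\<exists>p\<in>V. \<exists>l\<in>V. (\<forall>x\<in>Y. p x * l x = (\<Sum>i<n. f i x * g i x)) \<and>
    (N p)\<^sup>2 \<le> (\<Sum>i<n. (N (f i))\<^sup>2) + \<epsilon> \<and> (N l)\<^sup>2 = (\<Sum>i<n. (N (g i))\<^sup>2) + \<epsilon>"
proof -
  define T0 where "T0 = (\<lambda>x y. (\<Sum>i<n. outer (g i) x y) + of_real \<epsilon> * outer (kern z0) x y)"
  have "psd Y T0"
    unfolding T0_def using eps by (intro psd_add psd_sum psd_outer psd_scale) auto
  moreover have "T0 x y = 0" if xy: "x \<notin> Y \<or> y \<notin> Y" for x y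
    unfolding T0_def using outer_supported[OF g xy] outer_supported[OF kern_mem xy] by simp
  ultimately obtain l where l: "l \<in> V" and ad: "outer l \<in> admissible T0"
    using ex_dominating by blast
  have dT0: "dform T0 q = (\<Sum>i<n. (N (\<lambda>x. q x * g i x))\<^sup>2) + \<epsilon> * (N (\<lambda>x. q x * kern z0 x))\<^sup>2" for q
    unfolding T0_def dform_add dform_sum dform_scale dform_outer ..
  have dom: "dform T0 q \<le> (N (\<lambda>x. q x * l x))\<^sup>2" for q
    using ad by (simp add: admissible_def flip: dform_outer)
  have lnz: "l x \<noteq> 0" if x: "x \<in> Y" for x
  proof
    assume "l x = 0"
    let ?i = "\<lambda>u. if u = x then 1 else (0::complex)"
    have im: "?i \<in> V"
      using x by (simp add: V_def)
    have "N (\<lambda>u. ?i u * l u) = N (\<lambda>u. 0)"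
      using \<open>l x = 0\<close> by (intro N_cong) simp
    then have "dform T0 ?i \<le> 0"
      using dom[of ?i] hnorm_eq_0[OF zero_mem] by simp
    moreover have "N (\<lambda>u. ?i u * kern z0 u) = N ?i"
      using x by (intro N_cong) (simp add: kern_z0)
    ultimately have "(\<Sum>i<n. (N (\<lambda>u. ?i u * g i u))\<^sup>2) + \<epsilon> * (N ?i)\<^sup>2 \<le> 0"
      by (simp add: dT0)
    moreover have "0 \<le> (\<Sum>i<n. (N (\<lambda>u. ?i u * g i u))\<^sup>2)"
      by (intro sum_nonneg) simp
    ultimately have "\<epsilon> * (N ?i)\<^sup>2 \<le> 0"
      by linarith
    then have "N ?i = 0"
      using eps by (simp add: mult_le_0_iff)
    then have "?i = (\<lambda>u. 0)"
      using hnorm_eq_0[OF im] by simp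
    from fun_cong[OF this, of x] show False
      by simp
  qed
  have Nl: "(N l)\<^sup>2 = (\<Sum>i<n. (N (g i))\<^sup>2) + \<epsilon>"
    using norm_outer_eq[of l T0] ad by (simp add: admissible_def dT0 N_kern_z0)
  define p where "p = (\<lambda>x. if x \<in> Y then (\<Sum>i<n. f i x * g i x) / l x else 0)"
  have p: "p \<in> V"
    by (simp add: p_def V_def)
  obtain k where k: "k \<in> V" and knz: "\<And>x. x \<in> Y \<Longrightarrow> k x \<noteq> 0" and Nk: "(N k)\<^sup>2 = (N p)\<^sup>2 + \<epsilon>"
    and contr: "\<And>u v. u \<in> V \<Longrightarrow> v \<in> V \<Longrightarrow> norm (bil p k u v) \<le> N u * N v"
    using bil_contraction[OF p eps] by blast
  \<comment> \<open>The column of quotients \<open>g i / l\<close> applied to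
    \<open>k\<close>.\<close>
  define w where "w = (\<lambda>i x. k x / l x * g i x)"
  have w: "w i \<in> V" for i
    unfolding w_def by (rule mult_mem[OF g])
  have "(\<Sum>i<n. (N (w i))\<^sup>2) \<le> dform T0 (\<lambda>x. k x / l x)"
    using eps by (simp add: dT0 w_def)
  also have "\<dots> \<le> (N (\<lambda>x. k x / l x * l x))\<^sup>2"
    by (rule dom)
  also have "N (\<lambda>x. k x / l x * l x) = N k"
    using lnz by (intro N_cong) auto
  finally have Nw: "(\<Sum>i<n. (N (w i))\<^sup>2) \<le> (N p)\<^sup>2 + \<epsilon>"
    by (simp add: Nk)
  have "ip p p = (\<Sum>x\<in>Y. \<Sum>i<n. f i x * w i x * cnj (coord p x) / k x)"
    unfolding ip_coord
  proof (intro sum.cong refl)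
    fix x assume x: "x \<in> Y"
    have "f i x * w i x * cnj (coord p x) / k x = (f i x * g i x) * (cnj (coord p x) / l x)" for i
      using knz[OF x] by (simp add: w_def)
    then have "(\<Sum>i<n. f i x * w i x * cnj (coord p x) / k x) = (\<Sum>i<n. f i x * g i x) * (cnj (coord p x) / l x)"
      by (simp only: sum_distrib_right)
    then show "p x * cnj (coord p x) = (\<Sum>i<n. f i x * w i x * cnj (coord p x) / k x)"
      using x by (simp add: p_def)
  qed
  also have "\<dots> = (\<Sum>i<n. bil p k (f i) (w i))"
    unfolding bil_def by (rule sum.swap)
  finally have "(N p)\<^sup>2 = Re (\<Sum>i<n. bil p k (f i) (w i))"
    by (simp add: N_sq)
  also have "\<dots> \<le> (\<Sum>i<n. norm (bil p k (f i) (w i)))"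
    using complex_Re_le_cmod norm_sum by (rule order_trans)
  also have "\<dots> \<le> (\<Sum>i<n. ((N (f i))\<^sup>2 + (N (w i))\<^sup>2) / 2)"
  proof (rule sum_mono)
    fix i
    have "norm (bil p k (f i) (w i)) \<le> N (f i) * N (w i)"
      by (rule contr[OF f w])
    also have "\<dots> \<le> ((N (f i))\<^sup>2 + (N (w i))\<^sup>2) / 2"
      using sum_squares_bound[of "N (f i)" "N (w i)"] by simp
    finally show "norm (bil p k (f i) (w i)) \<le> ((N (f i))\<^sup>2 + (N (w i))\<^sup>2) / 2" .
  qed
  also have "\<dots> = ((\<Sum>i<n. (N (f i))\<^sup>2) + (\<Sum>i<n. (N (w i))\<^sup>2)) / 2"
    by (simp add: sum.distrib flip: sum_divide_distrib)
  \<comment> \<open>The bound contains half of \<open>(N p)^2\<close>, which the left side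
    absorbs.\<close>
  also have "\<dots> \<le> ((\<Sum>i<n. (N (f i))\<^sup>2) + ((N p)\<^sup>2 + \<epsilon>)) / 2"
    using Nw by (intro divide_right_mono add_left_mono) auto
  finally have "(N p)\<^sup>2 \<le> (\<Sum>i<n. (N (f i))\<^sup>2) + \<epsilon>"
    by (simp add: field_simps)
  moreover have "\<forall>x\<in>Y. p x * l x = (\<Sum>i<n. f i x * g i x)"
    using lnz by (simp add: p_def)
  ultimately show ?thesis
    using p l Nl by blast
qed

end

section \<open>Restriction to finite sets\<close>

locale pick_embedding = normalized_complete_pick H ip K z0
  for H :: "('x \<Rightarrow> complex) set" and ip K z0 +
  fixes b :: "'x \<Rightarrow> nat \<Rightarrow> complex"
  assumes b_summable: "summable (\<lambda>i. (norm (b z i))\<^sup>2)"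
    and b_less: "(\<Sum>i. (norm (b z i))\<^sup>2) < 1"
    and K_eq: "K z w = 1 / (1 - seq_inner (b z) (b w))"
begin

abbreviation Q :: "'x \<Rightarrow> 'x \<Rightarrow> complex"
  where "Q x y \<equiv> seq_inner (b x) (b y)"

section \<open>The kernel and its embedding into the ball\<close>

lemma ker_mem: "(\<lambda>z. K z w) \<in> H"
  using kernel by (simp add: is_reproducing_kernel_def)

lemma reproducing: "f \<in> H \<Longrightarrow> ip f (\<lambda>z. K z w) = f w"
  using kernel by (simp add: is_reproducing_kernel_def)

lemma K_cnj: "cnj (K x y) = K y x"
  using ip_cnj[OF ker_mem ker_mem, of x y] by (simp add: reproducing ker_mem)

lemma K_normalized: "K z0 z = 1"
  using K_cnj[of z z0] by (simp add: normalized)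

lemma Q_term_bound: "norm (b x i * cnj (b y i)) \<le> ((norm (b x i))\<^sup>2 + (norm (b y i))\<^sup>2) / 2"
  using sum_squares_bound[of "norm (b x i)" "norm (b y i)"] by (simp add: norm_mult)

lemma Q_bound_summable: "summable (\<lambda>i. ((norm (b x i))\<^sup>2 + (norm (b y i))\<^sup>2) / 2)"
  by (intro summable_divide summable_add b_summable)

lemma Q_sums: "(\<lambda>i. b x i * cnj (b y i)) sums Q x y"
  unfolding seq_inner_def
  by (intro summable_sums summable_comparison_test'[OF Q_bound_summable[of x y]]) (rule Q_term_bound)

lemma norm_Q_less: "norm (Q x y) < 1"
proof -
  have "norm (Q x y) \<le> (\<Sum>i. ((norm (b x i))\<^sup>2 + (norm (b y i))\<^sup>2) / 2)"
    unfolding seq_inner_def by (rule norm_suminf_le[OF Q_term_bound Q_bound_summable])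
  also have "\<dots> = ((\<Sum>i. (norm (b x i))\<^sup>2) + (\<Sum>i. (norm (b y i))\<^sup>2)) / 2"
    by (simp add: suminf_divide suminf_add b_summable summable_add)
  also have "\<dots> < 1"
    using b_less[of x] b_less[of y] by simp
  finally show ?thesis .
qed

lemma Q_K: "Q x y * K x y = K x y - 1"
proof -
  have "1 - Q x y \<noteq> 0"
    using norm_Q_less[of x y] by auto
  then show ?thesis
    by (simp add: K_eq field_simps)
qed

lemma Q_cnj: "cnj (Q x y) = Q y x"
proof -
  have "(\<lambda>i. cnj (b x i * cnj (b y i))) sums cnj (Q x y)"
    by (rule sums_cnj[THEN iffD2, OF Q_sums])
  then have "(\<lambda>i. b y i * cnj (b x i)) sums cnj (Q x y)"
    by (simp add: mult.commute)
  then show ?thesis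
    by (rule sums_unique2[OF _ Q_sums])
qed

lemma psd_Q: "psd Y Q"
proof -
  have "0 \<le> Re (sform Y Q c c)" for c
  proof -
    have "(\<Sum>x\<in>Y. \<Sum>y\<in>Y. c x * cnj (c y) * (b x i * cnj (b y i)))
        = of_real ((norm (\<Sum>x\<in>Y. c x * b x i))\<^sup>2)" for i
      unfolding of_real_power mult_cnj_self[symmetric] cnj_sum sum_product by (intro sum.cong refl) (simp add: mult_ac)
    moreover have "(\<lambda>i. \<Sum>x\<in>Y. \<Sum>y\<in>Y. c x * cnj (c y) * (b x i * cnj (b y i))) sums sform Y Q c c"
      unfolding sform_def by (intro sums_sum sums_mult Q_sums)
    ultimately have "(\<lambda>i. complex_of_real ((norm (\<Sum>x\<in>Y. c x * b x i))\<^sup>2)) sums sform Y Q c c"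
      by simp
    from sums_Re[OF this] have "(\<lambda>i. (norm (\<Sum>x\<in>Y. c x * b x i))\<^sup>2) sums Re (sform Y Q c c)"
      by (simp only: Re_complex_of_real)
    then show ?thesis
      by (rule sums_le[OF _ sums_zero, rotated]) simp
  qed
  then show ?thesis
    by (simp add: psd_def Q_cnj)
qed

section \<open>Independence of kernel functions and interpolation\<close>

definition kc :: "'x set \<Rightarrow> ('x \<Rightarrow> complex) \<Rightarrow> 'x \<Rightarrow> complex"
  where "kc Y a = (\<lambda>u. \<Sum>x\<in>Y. a x * K u x)"

lemma kc_mem: "finite Y \<Longrightarrow> kc Y a \<in> H"
  unfolding kc_def by (rule lincomb_mem) (auto intro: ker_mem)

lemma ip_kc: "finite Y \<Longrightarrow> f \<in> H \<Longrightarrow> ip f (kc Y a) = (\<Sum>x\<in>Y. f x * cnj (a x))"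
  unfolding kc_def by (subst ip_lincomb_right) (auto simp: ker_mem reproducing mult.commute)

text \<open>Summed over \<open>j\<close>, the squared norms of the functions in the conclusion give
  \<open>\<parallel>kc Y a\<parallel>\<^sup>2 - |kc Y a z0|\<^sup>2\<close>.\<close>

lemma kc_null_mult:
  assumes fin: "finite Y" and null: "kc Y a = (\<lambda>u. 0)"
  shows "kc Y (\<lambda>x. cnj (b x j) * a x) = (\<lambda>u. 0)"
proof -
  let ?g = "\<lambda>i. kc Y (\<lambda>x. cnj (b x i) * a x)"
  have "(\<lambda>i. \<Sum>y\<in>Y. \<Sum>x\<in>Y. (a x * cnj (a y) * K y x) * (b y i * cnj (b x i))) sums
      (\<Sum>y\<in>Y. \<Sum>x\<in>Y. (a x * cnj (a y) * K y x) * Q y x)"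
    by (intro sums_sum sums_mult Q_sums)
  moreover have "ip (?g i) (?g i) = (\<Sum>y\<in>Y. \<Sum>x\<in>Y. (a x * cnj (a y) * K y x) * (b y i * cnj (b x i)))" for i
  proof -
    have "ip (?g i) (?g i) = (\<Sum>y\<in>Y. ?g i y * (b y i * cnj (a y)))"
      using fin by (simp add: ip_kc kc_mem)
    then show ?thesis
      by (simp add: kc_def sum_distrib_left sum_distrib_right mult_ac)
  qed
  moreover have "(\<Sum>y\<in>Y. \<Sum>x\<in>Y. (a x * cnj (a y) * K y x) * Q y x) = 0"
  proof -
    have "(\<Sum>y\<in>Y. \<Sum>x\<in>Y. (a x * cnj (a y) * K y x) * Q y x)
        = (\<Sum>y\<in>Y. \<Sum>x\<in>Y. a x * K y x * cnj (a y) - a x * cnj (a y))"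
    proof (intro sum.cong refl)
      fix x y
      have "(a x * cnj (a y) * K y x) * Q y x = a x * cnj (a y) * (Q y x * K y x)"
        by (simp add: mult_ac)
      then show "(a x * cnj (a y) * K y x) * Q y x = a x * K y x * cnj (a y) - a x * cnj (a y)"
        unfolding Q_K by (simp add: algebra_simps)
    qed
    also have "\<dots> = (\<Sum>y\<in>Y. kc Y a y * cnj (a y)) - (\<Sum>x\<in>Y. a x) * (\<Sum>y\<in>Y. cnj (a y))"
      by (simp add: kc_def sum_subtractf sum_distrib_right sum_distrib_left)
    also have "(\<Sum>x\<in>Y. a x) = kc Y a z0"
      by (simp add: kc_def K_normalized)
    finally show ?thesis
      by (simp add: null)
  qed
  ultimately have "(\<lambda>i. ip (?g i) (?g i)) sums 0"
    by simp
  from sums_Re[OF this] have s: "(\<lambda>i. Re (ip (?g i) (?g i))) sums 0"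
    by simp
  have "0 \<le> Re (ip (?g i) (?g i))" for i
    by (intro ip_nonneg kc_mem fin)
  then have "Re (ip (?g j) (?g j)) = 0"
    using s suminf_eq_zero_iff[OF sums_summable[OF s]] sums_unique[OF s] by simp
  then show ?thesis
    using ip_self[OF kc_mem[OF fin], of "\<lambda>x. cnj (b x j) * a x"]
    by (intro ip_definite kc_mem fin) (simp flip: of_real_power)
qed

text \<open>By \<open>kc_null_mult\<close>, null combinations stay null when the coefficients are
  multiplied by \<open>cnj (b x j) - cnj (b v j)\<close>. Such factors remove the points
  \<open>v\<close> other than \<open>w\<close> one at a time; the one remaining term is evaluated at
  \<open>z0\<close>, where kernel functions equal 1.\<close>

lemma kc_inj:
  assumes fin: "finite Y" and inj: "inj_on b Y" and null: "kc Y a = (\<lambda>u. 0)" and w: "w \<in> Y"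
  shows "a w = 0"
proof -
  have "\<exists>m. kc Y (\<lambda>x. m x * a x) = (\<lambda>u. 0) \<and> m w \<noteq> 0 \<and> (\<forall>y\<in>S. m y = 0)"
    if "finite S" "S \<subseteq> Y - {w}" for S
    using that
  proof (induction S rule: finite_induct)
    case empty
    then show ?case
      using null by (intro exI[of _ "\<lambda>_. 1"]) simp
  next
    case (insert v S)
    then obtain m where m: "kc Y (\<lambda>x. m x * a x) = (\<lambda>u. 0)" "m w \<noteq> 0" "\<forall>y\<in>S. m y = 0"
      by auto
    have "b v \<noteq> b w"
      using insert w inj by (auto dest: inj_onD)
    then obtain j where j: "b v j \<noteq> b w j"
      by (auto simp: fun_eq_iff)
    define m' where "m' = (\<lambda>x. (cnj (b x j) - cnj (b v j)) * m x)"
    have "kc Y (\<lambda>x. m' x * a x)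
        = (\<lambda>u. kc Y (\<lambda>x. cnj (b x j) * (m x * a x)) u - cnj (b v j) * kc Y (\<lambda>x. m x * a x) u)"
      by (simp add: kc_def m'_def algebra_simps sum_subtractf sum_distrib_left)
    then have "kc Y (\<lambda>x. m' x * a x) = (\<lambda>u. 0)"
      using kc_null_mult[OF fin m(1)] m(1) by simp
    moreover have "m' w \<noteq> 0"
      using m(2) j by (auto simp: m'_def)
    moreover have "\<forall>y\<in>insert v S. m' y = 0"
      using m(3) by (simp add: m'_def)
    ultimately show ?case
      by blast
  qed
  from this[of "Y - {w}"] obtain m where m: "kc Y (\<lambda>x. m x * a x) = (\<lambda>u. 0)" "m w \<noteq> 0"
    and mz: "\<And>y. y \<in> Y - {w} \<Longrightarrow> m y = 0"
    using fin by auto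
  have "0 = kc Y (\<lambda>x. m x * a x) z0"
    by (simp add: m(1))
  also have "\<dots> = (\<Sum>x\<in>Y. if x = w then m w * a w else 0)"
    unfolding kc_def using mz by (intro sum.cong) (auto simp: K_normalized)
  also have "\<dots> = m w * a w"
    using fin w by simp
  finally show ?thesis
    using m(2) by simp
qed

lemma interpolation:
  assumes "finite Y" "inj_on b Y"
  shows "\<exists>a. \<forall>y\<in>Y. kc Y a y = p y"
  using assms
proof (induction Y arbitrary: p rule: finite_induct)
  case (insert w F)
  then have inj: "inj_on b F" and fin: "finite (insert w F)"
    by (auto simp: inj_on_insert)
  have kc_insert: "kc (insert w F) c u = c w * K u w + kc F c u" for c u
    using insert by (simp add: kc_def)
  obtain \<beta> where \<beta>: "\<forall>y\<in>F. kc F \<beta> y = K y w"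
    using insert.IH[OF inj, of "\<lambda>y. K y w"] by blast
  define c where "c = (\<lambda>x. if x = w then 1 else - \<beta> x)"
  \<comment> \<open>The kernel function at \<open>w\<close> minus its interpolant on
    \<open>F\<close>. It vanishes on \<open>F\<close> and has coefficient 1 at \<open>w\<close>,
    hence \<open>ip r r = r w\<close>.\<close>
  define r where "r = kc (insert w F) c"
  have r: "r \<in> H"
    unfolding r_def by (rule kc_mem[OF fin])
  have cF: "kc F c u = - kc F \<beta> u" for u
    using insert(2) unfolding kc_def c_def sum_negf[symmetric] by (intro sum.cong) auto
  have rF: "r y = 0" if "y \<in> F" for y
    using that \<beta> by (simp add: r_def kc_insert cF) (simp add: c_def)
  have "ip r r = (\<Sum>x\<in>insert w F. r x * cnj (c x))"
    using ip_kc[OF fin r, of c] by (simp add: r_def)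
  also have "\<dots> = r w"
    using insert rF by (simp add: c_def)
  finally have rw: "ip r r = r w" .
  have "r w \<noteq> 0"
  proof
    assume "r w = 0"
    then have "r = (\<lambda>u. 0)"
      using rw ip_definite[OF r] by simp
    then have "c w = 0"
      using kc_inj[OF fin insert.prems, of c w] by (simp add: r_def)
    then show False
      by (simp add: c_def)
  qed
  obtain \<alpha> where \<alpha>: "\<forall>y\<in>F. kc F \<alpha> y = p y"
    using insert.IH[OF inj] by blast
  define t where "t = (p w - kc F \<alpha> w) / r w"
  define a where "a = (\<lambda>x. (if x = w then 0 else \<alpha> x) + t * c x)"
  have "kc F (\<lambda>x. if x = w then 0 else \<alpha> x) u = kc F \<alpha> u" for u
    using insert(2) unfolding kc_def by (intro sum.cong) auto
  moreover have "kc (insert w F) a u = kc (insert w F) (\<lambda>x. if x = w then 0 else \<alpha> x) u + t * r u" for u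
    using insert by (simp add: r_def a_def kc_def sum.distrib sum_distrib_left algebra_simps)
  ultimately have a: "kc (insert w F) a u = kc F \<alpha> u + t * r u" for u
    by (simp add: kc_insert)
  have "kc (insert w F) a y = p y" if "y \<in> insert w F" for y
    using that \<open>r w \<noteq> 0\<close> \<alpha> rF by (auto simp: a t_def)
  then show ?case
    by blast
qed simp

section \<open>Transfer of the finite factorization\<close>

lemma same_embedding:
  assumes "b x = b y" "f \<in> H"
  shows "f x = f y"
proof -
  have "(\<lambda>z. K z x) = (\<lambda>z. K z y)"
    using assms by (simp add: K_eq)
  then show ?thesis
    using reproducing[OF assms(2), of x] reproducing[OF assms(2), of y] by simp
qed

text \<open>\<open>H\<close> does not separate points with equal \<open>b\<close>, and a Gram matrix
  containing two of them is singular. The class of \<open>z0\<close> is represented by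
  \<open>z0\<close>, as \<open>finite_pick\<close> demands.\<close>

lemma ex_representatives:
  assumes "finite X"
  shows "\<exists>Y \<subseteq> insert z0 X. z0 \<in> Y \<and> inj_on b Y \<and> (\<forall>x\<in>X. \<exists>y\<in>Y. b y = b x)"
proof -
  let ?X = "{x \<in> X. b x \<noteq> b z0}"
  obtain Y where Y: "Y \<subseteq> ?X" "inj_on b Y" "b ` Y = b ` ?X"
    using subset_image_inj[of "b ` ?X" b ?X] by auto
  have "insert z0 Y \<subseteq> insert z0 X"
    using Y(1) by auto
  moreover have "inj_on b (insert z0 Y)"
    using Y by (auto simp: inj_on_insert)
  moreover have "\<exists>y\<in>insert z0 Y. b y = b x" if "x \<in> X" for x
  proof (cases "b x = b z0")
    case False
    then have "b x \<in> b ` Y"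
      using that Y(3) by auto
    then show ?thesis
      by auto
  qed auto
  ultimately show ?thesis
    by blast
qed

lemma factorization_on_finite_set:
  fixes f g :: "nat \<Rightarrow> 'x \<Rightarrow> complex"
  assumes X: "finite X" and f: "\<And>i. f i \<in> H" and g: "\<And>i. g i \<in> H" and eps: "0 < \<epsilon>"
  shows "\<exists>p\<in>H. \<exists>l\<in>H. (\<forall>x\<in>X. p x * l x = (\<Sum>i<n. f i x * g i x)) \<and>
    (hnorm ip p)\<^sup>2 \<le> (\<Sum>i<n. (hnorm ip (f i))\<^sup>2) + \<epsilon> \<and> (hnorm ip l)\<^sup>2 \<le> (\<Sum>i<n. (hnorm ip (g i))\<^sup>2) + \<epsilon>"
proof -
  obtain Y where Y: "Y \<subseteq> insert z0 X" and z0: "z0 \<in> Y" and inj: "inj_on b Y"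
    and rep: "\<forall>x\<in>X. \<exists>y\<in>Y. b y = b x"
    using ex_representatives[OF X] by blast
  have fin: "finite Y"
    using Y X by (auto intro: finite_subset)
  \<comment> \<open>The rows of \<open>G\<close> are the coefficients of the functions that are 1 at
    one point of \<open>Y\<close> and 0 at the others; \<open>G\<close> is also the Gram matrix of
    these functions.\<close>
  obtain G where G: "\<And>x y. y \<in> Y \<Longrightarrow> kc Y (G x) y = (if x = y then 1 else 0)"
  proof -
    have "\<forall>x. \<exists>a. \<forall>y\<in>Y. kc Y a y = (if x = y then 1 else 0)"
      by (intro allI interpolation fin inj)
    then obtain G where "\<forall>x. \<forall>y\<in>Y. kc Y (G x) y = (if x = y then 1 else 0)"
      by (rule exE[OF choice])
    then show thesis
      using that[of G] by blast
  qed
  define e where "e = (\<lambda>x. kc Y (G x))"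
  have e: "e x \<in> H" for x
    unfolding e_def by (rule kc_mem[OF fin])
  have Ge: "G x y = ip (e x) (e y)" if "x \<in> Y" "y \<in> Y" for x y
  proof -
    have "ip (e y) (e x) = (\<Sum>u\<in>Y. e y u * cnj (G x u))"
      using ip_kc[OF fin e, of y "G x"] by (simp add: e_def)
    also have "\<dots> = (\<Sum>u\<in>Y. if u = y then cnj (G x y) else 0)"
      by (intro sum.cong) (auto simp: e_def G)
    also have "\<dots> = cnj (G x y)"
      using fin that by simp
    finally show ?thesis
      using ip_cnj[OF e e, of y x] by simp
  qed
  have form: "sform Y G c d = ip (\<lambda>u. \<Sum>x\<in>Y. c x * e x u) (\<lambda>u. \<Sum>x\<in>Y. d x * e x u)" for c d
  proof -
    have "ip (\<lambda>u. \<Sum>x\<in>Y. c x * e x u) (\<lambda>u. \<Sum>x\<in>Y. d x * e x u)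
        = (\<Sum>x\<in>Y. c x * (\<Sum>y\<in>Y. cnj (d y) * ip (e x) (e y)))"
      using ip_lincomb_left[OF fin e lincomb_mem[OF fin e]] ip_lincomb_right[OF fin e e] by simp
    then show ?thesis
      by (simp add: sform_def Ge sum_distrib_left mult.assoc)
  qed
  interpret fp: finite_pick Y z0 K Q G
  proof
    show "finite Y" "z0 \<in> Y"
      by (rule fin, rule z0)
    show "cnj (K x y) = K y x" "Q x y * K x y = K x y - 1" "K x z0 = 1" for x y
      by (rule K_cnj, rule Q_K, rule normalized)
    show "psd Y Q"
      by (rule psd_Q)
    show "psd Y G"
      unfolding psd_def form by (auto simp: Ge intro: ip_nonneg[OF lincomb_mem[OF fin e]] ip_cnj[OF e e, symmetric])
    show "(\<Sum>y\<in>Y. G x y * K w y) = (if x = w then 1 else 0)" if "x \<in> Y" "w \<in> Y" for x w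
      using G[OF that(2), of x] by (simp add: kc_def)
  qed
  define ext where "ext = (\<lambda>p u. \<Sum>x\<in>Y. p x * e x u)"
  have ext: "ext p \<in> H" for p
    unfolding ext_def by (rule lincomb_mem[OF fin e])
  have ext_Y: "ext p y = p y" if "y \<in> Y" for p y
  proof -
    have "ext p y = (\<Sum>x\<in>Y. if x = y then p y else 0)"
      unfolding ext_def e_def using that by (intro sum.cong) (auto simp: G)
    then show ?thesis
      using fin that by simp
  qed
  have norm_ext: "hnorm ip (ext p) = fp.N p" for p
    unfolding hnorm_def form ext_def ..
  let ?r = "\<lambda>q x. if x \<in> Y then q x else (0::complex)"
  \<comment> \<open>\<open>?E\<close> is the orthogonal projection of \<open>q\<close> onto the span
    of the kernel functions of \<open>Y\<close>, so restriction does not increase norms.\<close>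
  have restrict: "(fp.N (?r q))\<^sup>2 \<le> (hnorm ip q)\<^sup>2" if q: "q \<in> H" for q
  proof -
    let ?E = "ext (?r q)"
    have "ip u ?E = (\<Sum>x\<in>Y. cnj (q x) * (\<Sum>y\<in>Y. u y * cnj (G x y)))" if "u \<in> H" for u
      unfolding ext_def using that fin e by (subst ip_lincomb_right) (auto simp: e_def ip_kc)
    moreover have "(\<Sum>y\<in>Y. ?E y * cnj (G x y)) = (\<Sum>y\<in>Y. q y * cnj (G x y))" for x
      by (intro sum.cong) (auto simp: ext_Y)
    ultimately have "ip q ?E = ip ?E ?E"
      using q ext by simp
    then have "(hnorm ip (\<lambda>x. q x - ?E x))\<^sup>2 = (hnorm ip q)\<^sup>2 - (hnorm ip ?E)\<^sup>2"
      by (rule hnorm_diff_sq[OF q ext])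
    then show ?thesis
      using zero_le_power2[of "hnorm ip (\<lambda>x. q x - ?E x)"] by (simp add: norm_ext)
  qed
  obtain p l where p: "\<forall>x\<in>Y. p x * l x = (\<Sum>i<n. ?r (f i) x * ?r (g i) x)"
    and Np: "(fp.N p)\<^sup>2 \<le> (\<Sum>i<n. (fp.N (?r (f i)))\<^sup>2) + \<epsilon>" and Nl: "(fp.N l)\<^sup>2 = (\<Sum>i<n. (fp.N (?r (g i)))\<^sup>2) + \<epsilon>"
    using fp.finite_factorization[of "\<lambda>i. ?r (f i)" "\<lambda>i. ?r (g i)", OF fp.restrict_mem fp.restrict_mem eps] by blast
  have "ext p x * ext l x = (\<Sum>i<n. f i x * g i x)" if "x \<in> X" for x
  proof -
    obtain y where y: "y \<in> Y" "b y = b x"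
      using rep \<open>x \<in> X\<close> by blast
    have "ext p x * ext l x = p y * l y"
      using same_embedding[OF y(2) ext] ext_Y[OF y(1)] by metis
    also have "\<dots> = (\<Sum>i<n. f i y * g i y)"
      using p y(1) by simp
    also have "\<dots> = (\<Sum>i<n. f i x * g i x)"
      using same_embedding[OF y(2) f] same_embedding[OF y(2) g] by simp
    finally show ?thesis .
  qed
  moreover have "(hnorm ip (ext p))\<^sup>2 \<le> (\<Sum>i<n. (hnorm ip (f i))\<^sup>2) + \<epsilon>"
    using Np sum_mono[of "{..<n}" "\<lambda>i. (fp.N (?r (f i)))\<^sup>2", OF restrict[OF f]] by (simp add: norm_ext)
  moreover have "(hnorm ip (ext l))\<^sup>2 \<le> (\<Sum>i<n. (hnorm ip (g i))\<^sup>2) + \<epsilon>"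
    using Nl sum_mono[of "{..<n}" "\<lambda>i. (fp.N (?r (g i)))\<^sup>2", OF restrict[OF g]] by (simp add: norm_ext)
  ultimately show ?thesis
    using ext by blast
qed

section \<open>Compactness of balls\<close>

text \<open>The closed ball of radius \<open>c\<close>, described by conditions that persist under pointwise limits.\<close>

definition fball :: "real \<Rightarrow> ('x \<Rightarrow> complex) set"
  where "fball c = {f. \<forall>Y a. finite Y \<longrightarrow> norm (\<Sum>x\<in>Y. f x * cnj (a x)) \<le> c * hnorm ip (kc Y a)}"

lemma fballD: "f \<in> fball c \<Longrightarrow> finite Y \<Longrightarrow> norm (\<Sum>x\<in>Y. f x * cnj (a x)) \<le> c * hnorm ip (kc Y a)"
  by (simp add: fball_def)

lemma closed_fball: "closed (fball c)"
proof -
  have "continuous_on UNIV (\<lambda>f. norm (\<Sum>x\<in>Y. f x * cnj (a x)))" for Y and a :: "'x \<Rightarrow> complex"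
    by (intro continuous_on_norm continuous_on_sum continuous_on_mult continuous_on_const
        continuous_on_product_coordinates)
  then have "closed {f. norm (\<Sum>x\<in>Y. f x * cnj (a x)) \<le> c * hnorm ip (kc Y a)}" for Y a
    by (rule closed_Collect_le[OF _ continuous_on_const])
  then show ?thesis
    unfolding fball_def by (intro closed_Collect_all closed_Collect_imp) simp_all
qed

lemma compact_fball: "compact (fball c)"
proof -
  let ?r = "\<lambda>x. c * hnorm ip (kc {x} (\<lambda>_. 1))"
  have "fball c \<subseteq> {f. \<forall>x. f x \<in> cball 0 (?r x)}"
  proof (intro subsetI CollectI allI)
    fix f x
    assume "f \<in> fball c"
    then show "f x \<in> cball 0 (?r x)"
      using fballD[of f c "{x}" "\<lambda>_. 1"] by simp
  qed
  then have sub: "fball c \<inter> {f. \<forall>x. f x \<in> cball 0 (?r x)} = fball c"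
    by (rule Int_absorb2)
  have "compact {f. \<forall>x. f x \<in> cball (0::complex) (?r x)}"
    by (intro compact_fun_product compact_cball)
  from closed_Int_compact[OF closed_fball[of c] this] show ?thesis
    unfolding sub .
qed

lemma fball_memI:
  assumes "f \<in> H" "hnorm ip f \<le> c"
  shows "f \<in> fball c"
  unfolding fball_def
proof (intro CollectI allI impI)
  fix Y :: "'x set" and a
  assume Y: "finite Y"
  have "norm (ip f (kc Y a)) \<le> hnorm ip f * hnorm ip (kc Y a)"
    by (rule norm_ip_le[OF assms(1) kc_mem[OF Y]])
  also have "\<dots> \<le> c * hnorm ip (kc Y a)"
    by (intro mult_right_mono assms hnorm_nonneg kc_mem Y)
  finally show "norm (\<Sum>x\<in>Y. f x * cnj (a x)) \<le> c * hnorm ip (kc Y a)"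
    by (simp add: ip_kc Y assms(1))
qed

lemma fball_same_embedding:
  assumes f: "f \<in> fball c" and xy: "b x = b y"
  shows "f x = f y"
proof (cases "x = y")
  case False
  define a :: "'x \<Rightarrow> complex" where "a = (\<lambda>u. if u = x then 1 else - 1)"
  have "kc {x, y} a = (\<lambda>u. 0)"
    using False xy by (simp add: kc_def a_def K_eq)
  moreover have "norm (\<Sum>u\<in>{x, y}. f u * cnj (a u)) \<le> c * hnorm ip (kc {x, y} a)"
    by (rule fballD[OF f]) simp
  ultimately have "norm (\<Sum>u\<in>{x, y}. f u * cnj (a u)) \<le> c * 0"
    using hnorm_eq_0[OF zero_mem] by simp
  then show ?thesis
    using False by (simp add: a_def)
qed simp

text \<open>The Gram matrix of \<open>X\<close> may be singular. Interpolation takes place on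
  representatives and extends to \<open>X\<close> because \<open>f\<close> and the interpolant are
  both constant where \<open>b\<close> is.\<close>

lemma fball_interpolation:
  assumes f: "f \<in> fball c" and X: "finite X" "z0 \<in> X"
  shows "\<exists>a. \<forall>x\<in>X. kc X a x = f x"
proof -
  obtain Y where Y: "Y \<subseteq> insert z0 X" "inj_on b Y" and rep: "\<forall>x\<in>X. \<exists>y\<in>Y. b y = b x"
    using ex_representatives[OF X(1)] by blast
  have YX: "Y \<subseteq> X"
    using Y(1) X(2) by auto
  then have fin: "finite Y"
    using X(1) finite_subset by blast
  obtain a where a: "\<forall>y\<in>Y. kc Y a y = f y"
    using interpolation[OF fin Y(2)] by blast
  have eq: "kc X (\<lambda>x. if x \<in> Y then a x else 0) = kc Y a"
    unfolding kc_def using X(1) YX by (intro ext sum.mono_neutral_cong_right) auto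
  have "kc Y a x = f x" if x: "x \<in> X" for x
  proof -
    obtain y where y: "y \<in> Y" "b y = b x"
      using rep x by blast
    then show ?thesis
      using a same_embedding[OF y(2) kc_mem[OF fin], of a] fball_same_embedding[OF f y(2)] by simp
  qed
  then show ?thesis
    using eq by (intro exI[of _ "\<lambda>x. if x \<in> Y then a x else 0"]) simp
qed

text \<open>The inequality defining the ball is tested on the coefficients of the interpolant
  itself.\<close>

lemma fball_interpolant_le:
  assumes f: "f \<in> fball c" and c: "0 \<le> c" and X: "finite X" and a: "\<forall>x\<in>X. kc X a x = f x"
  shows "hnorm ip (kc X a) \<le> c"
proof (cases "hnorm ip (kc X a) = 0")
  case False
  then have pos: "0 < hnorm ip (kc X a)"
    using hnorm_nonneg[OF kc_mem[OF X]] by (simp add: less_le)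
  have "ip (kc X a) (kc X a) = (\<Sum>x\<in>X. f x * cnj (a x))"
    using ip_kc[OF X kc_mem[OF X]] a by simp
  then have "norm (ip (kc X a) (kc X a)) \<le> c * hnorm ip (kc X a)"
    using fballD[OF f X, of a] by simp
  then have "(hnorm ip (kc X a))\<^sup>2 \<le> c * hnorm ip (kc X a)"
    by (simp add: ip_self kc_mem X norm_power)
  then show ?thesis
    using pos by (simp add: power2_eq_square)
qed (simp add: c)

lemma interpolant_dist:
  assumes X: "finite X" and a: "\<forall>x\<in>X. kc X a x = g x" and g: "g \<in> H"
  shows "(hnorm ip (\<lambda>u. g u - kc X a u))\<^sup>2 = (hnorm ip g)\<^sup>2 - (hnorm ip (kc X a))\<^sup>2"
  using a by (intro hnorm_diff_sq g kc_mem X) (simp add: ip_kc X g kc_mem)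

text \<open>\<open>f\<close> is recovered as a norm limit of its interpolants on finite sets. Their
  norms increase with the set and are bounded by \<open>c\<close>, so Pythagoras makes them Cauchy
  along sets that nearly exhaust the supremum.\<close>

lemma fball_hnorm:
  assumes f: "f \<in> fball c" and c: "0 \<le> c"
  shows "f \<in> H \<and> hnorm ip f \<le> c"
proof -
  define \<S> where "\<S> = {X. finite X \<and> z0 \<in> X}"
  obtain A where A: "\<And>X x. X \<in> \<S> \<Longrightarrow> x \<in> X \<Longrightarrow> kc X (A X) x = f x"
  proof -
    have "\<forall>X. \<exists>a. X \<in> \<S> \<longrightarrow> (\<forall>x\<in>X. kc X a x = f x)"
      using fball_interpolation[OF f] unfolding \<S>_def by auto
    then obtain A where "\<forall>X. X \<in> \<S> \<longrightarrow> (\<forall>x\<in>X. kc X (A X) x = f x)"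
      by (rule exE[OF choice])
    then show thesis
      by (intro that[of A]) blast
  qed
  define I where "I = (\<lambda>X. kc X (A X))"
  have I: "I X \<in> H" and I_eq: "x \<in> X \<Longrightarrow> I X x = f x" and I_le: "hnorm ip (I X) \<le> c" if "X \<in> \<S>" for X x
    using that A[OF that] fball_interpolant_le[OF f c, of X "A X"] unfolding I_def \<S>_def by (auto intro: kc_mem)
  have pyth: "(hnorm ip (\<lambda>u. I Y u - I X u))\<^sup>2 = (hnorm ip (I Y))\<^sup>2 - (hnorm ip (I X))\<^sup>2"
    if "X \<in> \<S>" "Y \<in> \<S>" "X \<subseteq> Y" for X Y
  proof -
    have "\<forall>x\<in>X. kc X (A X) x = I Y x"
      using that(3) A[OF that(1)] I_eq[OF that(2)] by auto
    moreover have "finite X"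
      using that(1) by (simp add: \<S>_def)
    ultimately show ?thesis
      using interpolant_dist[OF _ _ I[OF that(2)]] by (simp add: I_def)
  qed
  define s where "s = (SUP X\<in>\<S>. (hnorm ip (I X))\<^sup>2)"
  have bdd: "bdd_above ((\<lambda>X. (hnorm ip (I X))\<^sup>2) ` \<S>)"
    using I_le hnorm_nonneg[OF I] by (intro bdd_aboveI[of _ "c\<^sup>2"]) (auto intro!: power_mono)
  have le_s: "(hnorm ip (I X))\<^sup>2 \<le> s" if "X \<in> \<S>" for X
    unfolding s_def by (rule cSUP_upper[OF that bdd])
  have "{z0} \<in> \<S>"
    by (simp add: \<S>_def)
  then have ne: "\<S> \<noteq> {}"
    by blast
  define \<delta> :: "nat \<Rightarrow> real" where "\<delta> = (\<lambda>n. inverse (real (Suc n)))"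
  have "\<forall>n. \<exists>X. X \<in> \<S> \<and> s - \<delta> n < (hnorm ip (I X))\<^sup>2"
  proof
    fix n
    have "s - \<delta> n < s"
      by (simp add: \<delta>_def)
    then show "\<exists>X. X \<in> \<S> \<and> s - \<delta> n < (hnorm ip (I X))\<^sup>2"
      unfolding s_def less_cSUP_iff[OF ne bdd] by blast
  qed
  then obtain Z where "\<forall>n. Z n \<in> \<S> \<and> s - \<delta> n < (hnorm ip (I (Z n)))\<^sup>2"
    by (rule exE[OF choice])
  then have Z: "\<And>n. Z n \<in> \<S>" "\<And>n. s - \<delta> n < (hnorm ip (I (Z n)))\<^sup>2"
    by blast+
  \<comment> \<open>\<open>pyth\<close> compares nested sets only, so the sets are made
    increasing.\<close>
  define U where "U = (\<lambda>n. \<Union>i\<le>n. Z i)"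
  have U: "U n \<in> \<S>" for n
    using Z(1) by (auto simp: U_def \<S>_def)
  have U_mono: "U m \<subseteq> U n" if "m \<le> n" for m n
    using that by (fastforce simp: U_def)
  have close: "hnorm ip (\<lambda>u. I Y u - I (U n) u) \<le> sqrt (\<delta> n)" if "Y \<in> \<S>" "U n \<subseteq> Y" for Y n
  proof (rule real_le_rsqrt)
    have "Z n \<subseteq> U n"
      by (auto simp: U_def)
    then have "(hnorm ip (I (U n)))\<^sup>2 - (hnorm ip (I (Z n)))\<^sup>2 \<ge> 0"
      using pyth[OF Z(1) U, of n n] by (metis zero_le_power2)
    then show "(hnorm ip (\<lambda>u. I Y u - I (U n) u))\<^sup>2 \<le> \<delta> n"
      using pyth[OF U that] le_s[OF that(1)] Z(2)[of n] by linarith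
  qed
  have \<delta>0: "(\<lambda>n. sqrt (\<delta> n)) \<longlonglongrightarrow> 0"
    using tendsto_real_sqrt[OF LIMSEQ_inverse_real_of_nat] by (simp add: \<delta>_def)
  have "MCauchy (\<lambda>n. I (U n))"
    unfolding MCauchy_def
  proof (intro conjI allI impI)
    show "range (\<lambda>n. I (U n)) \<subseteq> H"
      using I U by auto
    fix e :: real
    assume "0 < e"
    then have "\<forall>\<^sub>F n in sequentially. sqrt (\<delta> n) < e / 2"
      using order_tendstoD(2)[OF \<delta>0, of "e / 2"] by simp
    then obtain n0 where n0: "sqrt (\<delta> n0) < e / 2"
      by (auto simp: eventually_sequentially)
    have half: "hdist H ip (I (U n)) (I (U n0)) < e / 2" if "n0 \<le> n" for n
      using close[OF U U_mono[OF that]] n0 I U by (simp add: hdist_def)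
    show "\<exists>N. \<forall>n n'. N \<le> n \<longrightarrow> N \<le> n' \<longrightarrow> hdist H ip (I (U n)) (I (U n')) < e"
    proof (intro exI[of _ n0] allI impI)
      fix n n'
      assume nn: "n0 \<le> n" "n0 \<le> n'"
      have "hdist H ip (I (U n)) (I (U n')) \<le> hdist H ip (I (U n)) (I (U n0)) + hdist H ip (I (U n0)) (I (U n'))"
        by (intro triangle I U)
      also have "hdist H ip (I (U n0)) (I (U n')) = hdist H ip (I (U n')) (I (U n0))"
        by (rule commute)
      finally show "hdist H ip (I (U n)) (I (U n')) < e"
        using half[OF nn(1)] half[OF nn(2)] by linarith
    qed
  qed
  then obtain F where "limitin mtopology (\<lambda>n. I (U n)) F sequentially"
    using complete by (auto simp: mcomplete_def)
  then have F: "F \<in> H" and lim: "\<forall>e>0. \<exists>N. \<forall>n\<ge>N. I (U n) \<in> H \<and> hdist H ip (I (U n)) F < e"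
    by (auto simp: limit_metric_sequentially)
  define d where "d = (\<lambda>n. hnorm ip (\<lambda>u. F u - I (U n) u))"
  have mem: "(\<lambda>u. F u - I (U n) u) \<in> H" for n
    by (intro diff_mem F I U)
  have d_hdist: "d n = hdist H ip (I (U n)) F" for n
    using commute[of F "I (U n)"] F I[OF U] by (simp add: hdist_def d_def)
  have d0: "d \<longlonglongrightarrow> 0"
    unfolding LIMSEQ_iff using lim hnorm_nonneg[OF mem] by (auto simp: d_hdist) (metis d_def d_hdist)
  have "F x = f x" for x
  proof -
    obtain B where B: "\<forall>g\<in>H. norm (g x) \<le> B * hnorm ip g"
      using bounded_evaluation by blast
    have "norm (F x - f x) \<le> B * d n + B * sqrt (\<delta> n)" if "0 \<le> B" for n
    proof -
      \<comment> \<open>The point \<open>x\<close> may lie in no \<open>U n\<close>; adding it moves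
        the interpolant by at most \<open>sqrt (\<delta> n)\<close>.\<close>
      let ?X = "insert x (U n)"
      have X: "?X \<in> \<S>" "U n \<subseteq> ?X"
        using U[of n] by (auto simp: \<S>_def)
      have "norm (F x - I (U n) x) \<le> B * d n"
        using B mem by (auto simp: d_def)
      moreover have "norm (I ?X x - I (U n) x) \<le> B * hnorm ip (\<lambda>u. I ?X u - I (U n) u)"
        using B diff_mem[OF I[OF X(1)] I[OF U]] by auto
      moreover have "B * hnorm ip (\<lambda>u. I ?X u - I (U n) u) \<le> B * sqrt (\<delta> n)"
        by (intro mult_left_mono close X that)
      moreover have "norm (F x - f x) \<le> norm (F x - I (U n) x) + norm (f x - I (U n) x)"
        using norm_triangle_ineq4[of "F x - I (U n) x" "f x - I (U n) x"] by simp
      moreover have "I ?X x = f x"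
        using I_eq[OF X(1)] by simp
      ultimately show ?thesis
        by simp
    qed
    moreover have "0 \<le> B"
    proof -
      have "1 \<le> B * hnorm ip (\<lambda>z. K z z0)"
        using B ker_mem normalized by (metis norm_one)
      then show ?thesis
        using hnorm_nonneg[OF ker_mem, of z0] mult_nonpos_nonneg[of B "hnorm ip (\<lambda>z. K z z0)"] by linarith
    qed
    moreover have "(\<lambda>n. B * d n + B * sqrt (\<delta> n)) \<longlonglongrightarrow> B * 0 + B * 0"
      by (intro tendsto_intros d0 \<delta>0)
    ultimately have "norm (F x - f x) \<le> 0"
      by (intro LIMSEQ_le_const[of "\<lambda>n. B * d n + B * sqrt (\<delta> n)"]) auto
    then show ?thesis
      by simp
  qed
  then have "F = f"
    by (rule ext)
  moreover have "hnorm ip F \<le> c"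
  proof (rule LIMSEQ_le_const[of "\<lambda>n. d n + c"])
    show "(\<lambda>n. d n + c) \<longlonglongrightarrow> c"
      using tendsto_add[OF d0 tendsto_const[of c]] by simp
    have "hnorm ip F \<le> d n + c" for n
      using hnorm_triangle[OF mem I[OF U], of n n] I_le[OF U, of n] by (simp add: d_def)
    then show "\<exists>N. \<forall>n\<ge>N. hnorm ip F \<le> d n + c"
      by blast
  qed
  ultimately show ?thesis
    using F by simp
qed

section \<open>Factorization of weak products\<close>

text \<open>The finite result applies to partial sums only, so the series is cut where it is within
  \<open>\<delta>\<close> of \<open>h\<close> on all of \<open>X\<close>; this is why equality on
  \<open>X\<close> is lost.\<close>

lemma approximate_factorization:
  assumes rep: "weak_product_representation H ip h f g" and X: "finite X" and \<delta>: "0 < \<delta>"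
  shows "\<exists>p\<in>H. \<exists>l\<in>H. (\<forall>x\<in>X. norm (p x * l x - h x) \<le> \<delta>) \<and>
    (hnorm ip p)\<^sup>2 \<le> (\<Sum>n. hnorm ip (f n) * hnorm ip (g n)) + \<delta> \<and>
    (hnorm ip l)\<^sup>2 \<le> (\<Sum>n. hnorm ip (f n) * hnorm ip (g n)) + \<delta>"
proof -
  define t where "t = (\<lambda>n. hnorm ip (f n) * hnorm ip (g n))"
  have f: "f n \<in> H" and g: "g n \<in> H" and summ: "summable t" and lim: "(\<lambda>n. f n x * g n x) sums h x" for n x
    using rep by (auto simp: weak_product_representation_def t_def)
  have nn: "0 \<le> hnorm ip (f n)" "0 \<le> hnorm ip (g n)" for n
    using f g by (auto intro: hnorm_nonneg)
  \<comment> \<open>The scalar balancing the two norms: both rescaled factors get squared norm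
    \<open>u * v\<close>. If \<open>u * v = 0\<close>, both are scaled to 0, which is harmless as
    their product was already 0.\<close>
  define c where "c = (\<lambda>u v :: real. if u * v = 0 then 0 else sqrt (v / u))"
  have c: "(c u v * u)\<^sup>2 = u * v" if "0 \<le> u" "0 \<le> v" for u v
    using that by (auto simp: c_def power_mult_distrib) (simp add: power2_eq_square)
  define f' where "f' = (\<lambda>n x. of_real (c (hnorm ip (f n)) (hnorm ip (g n))) * f n x)"
  define g' where "g' = (\<lambda>n x. of_real (c (hnorm ip (g n)) (hnorm ip (f n))) * g n x)"
  have f': "f' n \<in> H" and g': "g' n \<in> H" for n
    unfolding f'_def g'_def by (intro scale_mem f g)+
  have sq: "(hnorm ip (f' n))\<^sup>2 = t n" "(hnorm ip (g' n))\<^sup>2 = t n" for n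
    using c[OF nn(1) nn(2), of n n] c[OF nn(2) nn(1), of n n]
    unfolding f'_def g'_def hnorm_scale[OF f] hnorm_scale[OF g] by (simp_all add: t_def power_mult_distrib mult.commute)
  have prod: "f' n x * g' n x = f n x * g n x" for n x
  proof (cases "t n = 0")
    case True
    then have "f n x = 0 \<or> g n x = 0"
      using hnorm_eq_0[OF f] hnorm_eq_0[OF g] by (auto simp: t_def)
    then show ?thesis
      by (auto simp: f'_def g'_def)
  next
    case False
    then have pos: "0 < hnorm ip (f n)" "0 < hnorm ip (g n)"
      using nn[of n] by (auto simp: t_def less_le)
    then have "c (hnorm ip (f n)) (hnorm ip (g n)) * c (hnorm ip (g n)) (hnorm ip (f n)) = 1"
      by (simp add: c_def flip: real_sqrt_mult)
    then have "complex_of_real (c (hnorm ip (f n)) (hnorm ip (g n))) * of_real (c (hnorm ip (g n)) (hnorm ip (f n))) = 1"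
      by (simp flip: of_real_mult)
    then show ?thesis
      by (simp add: f'_def g'_def mult_ac)
  qed
  have "\<forall>\<^sub>F n in sequentially. \<forall>x\<in>X. norm ((\<Sum>i<n. f i x * g i x) - h x) < \<delta>"
  proof (intro eventually_ball_finite X ballI)
    fix x
    have "\<forall>\<^sub>F n in sequentially. dist (\<Sum>i<n. f i x * g i x) (h x) < \<delta>"
      using lim[of x] \<delta> unfolding sums_def by (rule tendstoD)
    then show "\<forall>\<^sub>F n in sequentially. norm ((\<Sum>i<n. f i x * g i x) - h x) < \<delta>"
      by (simp add: dist_norm)
  qed
  then obtain n where n: "\<forall>x\<in>X. norm ((\<Sum>i<n. f i x * g i x) - h x) < \<delta>"
    by (auto simp: eventually_sequentially)
  have le: "(\<Sum>i<n. t i) \<le> suminf t"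
    using nn by (intro sum_le_suminf summ) (auto simp: t_def)
  obtain p l where "p \<in> H" "l \<in> H" and pl: "\<forall>x\<in>X. p x * l x = (\<Sum>i<n. f' i x * g' i x)"
    and "(hnorm ip p)\<^sup>2 \<le> (\<Sum>i<n. (hnorm ip (f' i))\<^sup>2) + \<delta>" "(hnorm ip l)\<^sup>2 \<le> (\<Sum>i<n. (hnorm ip (g' i))\<^sup>2) + \<delta>"
    using factorization_on_finite_set[of X f' g' \<delta> n, OF X f' g' \<delta>] by blast
  then have "p \<in> H" "l \<in> H" "(hnorm ip p)\<^sup>2 \<le> suminf t + \<delta>" "(hnorm ip l)\<^sup>2 \<le> suminf t + \<delta>"
    using le by (simp_all add: sq)
  moreover have "\<forall>x\<in>X. norm (p x * l x - h x) \<le> \<delta>"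
    using pl n by (auto simp: prod intro: less_imp_le)
  ultimately show ?thesis
    unfolding t_def by blast
qed

section \<open>The norm of the weak product\<close>

lemma weak_product_norm_le:
  assumes "weak_product_representation H ip h f g"
  shows "weak_product_norm H ip h \<le> (\<Sum>n. hnorm ip (f n) * hnorm ip (g n))"
  unfolding weak_product_norm_def
proof (rule cInf_lower)
  show "bdd_below {\<Sum>n. hnorm ip (f n) * hnorm ip (g n) |f g. weak_product_representation H ip h f g}"
    by (rule bdd_belowI[of _ 0]) (auto simp: weak_product_representation_def intro!: suminf_nonneg mult_nonneg_nonneg hnorm_nonneg)
qed (use assms in blast)

lemma weak_product_norm_nonneg:
  assumes "h \<in> weak_product H ip"
  shows "0 \<le> weak_product_norm H ip h"
  unfolding weak_product_norm_def using assms
  by (intro cInf_greatest)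
    (auto simp: weak_product_def weak_product_representation_def intro!: suminf_nonneg mult_nonneg_nonneg hnorm_nonneg)

lemma weak_product_norm_approx:
  assumes "h \<in> weak_product H ip" "0 < \<delta>"
  obtains f g where "weak_product_representation H ip h f g"
    "(\<Sum>n. hnorm ip (f n) * hnorm ip (g n)) < weak_product_norm H ip h + \<delta>"
proof -
  let ?S = "{\<Sum>n. hnorm ip (f n) * hnorm ip (g n) |f g. weak_product_representation H ip h f g}"
  have "?S \<noteq> {}"
    using assms(1) by (auto simp: weak_product_def)
  then obtain u where "u \<in> ?S" "u < Inf ?S + \<delta>"
    using cInf_lessD[of ?S "Inf ?S + \<delta>"] assms(2) by auto
  then show thesis
    using that by (auto simp: weak_product_norm_def)
qed

lemma weak_product_norm_mult_le:
  assumes "p \<in> H" "l \<in> H"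
  shows "weak_product_norm H ip (\<lambda>x. p x * l x) \<le> hnorm ip p * hnorm ip l"
proof -
  let ?f = "\<lambda>n::nat. if n = 0 then p else (\<lambda>x. 0)" and ?g = "\<lambda>n::nat. if n = 0 then l else (\<lambda>x. 0)"
  have "hnorm ip (\<lambda>x. 0) = 0"
    using hnorm_eq_0[OF zero_mem] by simp
  then have eq: "(\<lambda>n. hnorm ip (?f n) * hnorm ip (?g n)) = (\<lambda>n. if n = 0 then hnorm ip p * hnorm ip l else 0)"
    by auto
  have sums: "(\<lambda>n. hnorm ip (?f n) * hnorm ip (?g n)) sums (hnorm ip p * hnorm ip l)"
    unfolding eq by (rule sums_single[of 0 "\<lambda>_. hnorm ip p * hnorm ip l"])
  have "(\<lambda>n. ?f n x * ?g n x) = (\<lambda>n. if n = 0 then p x * l x else 0)" for x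
    by auto
  then have "(\<lambda>n. ?f n x * ?g n x) sums (p x * l x)" for x
    using sums_single[of 0 "\<lambda>_. p x * l x"] by simp
  then have "weak_product_representation H ip (\<lambda>x. p x * l x) ?f ?g"
    using assms zero_mem sums_summable[OF sums] unfolding weak_product_representation_def by simp
  from weak_product_norm_le[OF this] show ?thesis
    by (simp only: sums_unique[OF sums, symmetric])
qed

text \<open>An exact pair of factors is a common point of the closed sets
  \<open>C (x, \<delta>)\<close> inside a compact product of balls. Finitely many of these
  conditions are met by an approximate factorization with the smallest tolerance involved.\<close>

lemma weak_product_factorization:
  assumes h: "h \<in> weak_product H ip"
  shows "\<exists>f\<in>H. \<exists>g\<in>H. h = (\<lambda>x. f x * g x) \<and> hnorm ip f * hnorm ip g = weak_product_norm H ip h"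
proof -
  let ?W = "weak_product_norm H ip h"
  \<comment> \<open>One \<open>\<delta>\<close> pays for a nearly optimal representation of
    \<open>h\<close>, the other for its approximate factorization.\<close>
  define B where "B = (\<lambda>\<delta>. fball (sqrt (?W + 2 * \<delta>)))"
  define C where "C = (\<lambda>(x, \<delta>). (B \<delta> \<times> B \<delta>) \<inter> {z. norm (fst z x * snd z x - h x) \<le> \<delta>})"
  define J where "J = (UNIV :: 'x set) \<times> {0<..1::real}"
  have B: "compact (B \<delta>)" for \<delta>
    unfolding B_def by (rule compact_fball)
  have cB: "closed (B \<delta>)" for \<delta>
    unfolding B_def by (rule closed_fball)
  have W: "0 \<le> ?W"
    by (rule weak_product_norm_nonneg[OF h])
  have "B 1 \<times> B 1 \<inter> (\<Inter>i\<in>J. C i) \<noteq> {}"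
  proof (rule compact_imp_fip_image)
    show "compact (B 1 \<times> B 1)"
      by (intro compact_Times B)
    show "closed (C i)" for i
    proof (cases i)
      case (Pair x \<delta>)
      have "continuous_on UNIV (\<lambda>z :: ('x \<Rightarrow> complex) \<times> ('x \<Rightarrow> complex). fst z x)"
        "continuous_on UNIV (\<lambda>z :: ('x \<Rightarrow> complex) \<times> ('x \<Rightarrow> complex). snd z x)"
        using continuous_on_compose2[OF continuous_on_product_coordinates[of x] continuous_on_fst[OF continuous_on_id]]
          continuous_on_compose2[OF continuous_on_product_coordinates[of x] continuous_on_snd[OF continuous_on_id]]
        by simp_all
      then have "continuous_on UNIV (\<lambda>z. norm (fst z x * snd z x - h x))"
        by (intro continuous_on_norm continuous_on_diff continuous_on_mult continuous_on_const)
      then have "closed {z. norm (fst z x * snd z x - h x) \<le> \<delta>}"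
        by (rule closed_Collect_le[OF _ continuous_on_const])
      then show ?thesis
        unfolding C_def Pair prod.case by (intro closed_Int closed_Times cB)
    qed
    fix I
    assume I: "finite I" "I \<subseteq> J"
    \<comment> \<open>The inserted 1 covers the empty family and keeps the pair inside
      \<open>B 1 \<times> B 1\<close>.\<close>
    define \<delta> where "\<delta> = Min (insert 1 (snd ` I))"
    have \<delta>: "0 < \<delta>" "\<delta> \<le> 1" "\<And>x \<epsilon>. (x, \<epsilon>) \<in> I \<Longrightarrow> \<delta> \<le> \<epsilon>"
      using I by (auto simp: \<delta>_def J_def Min_le_iff intro: rev_bexI)
    obtain f g where rep: "weak_product_representation H ip h f g"
      and lt: "(\<Sum>n. hnorm ip (f n) * hnorm ip (g n)) < ?W + \<delta>"
      using weak_product_norm_approx[OF h \<delta>(1)] by blast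
    obtain p l where pl: "p \<in> H" "l \<in> H" "\<forall>x\<in>fst ` I. norm (p x * l x - h x) \<le> \<delta>"
      and le: "(hnorm ip p)\<^sup>2 \<le> (\<Sum>n. hnorm ip (f n) * hnorm ip (g n)) + \<delta>"
        "(hnorm ip l)\<^sup>2 \<le> (\<Sum>n. hnorm ip (f n) * hnorm ip (g n)) + \<delta>"
      using approximate_factorization[OF rep finite_imageI[OF I(1)] \<delta>(1)] by blast
    have mem: "p \<in> B \<epsilon>" "l \<in> B \<epsilon>" if "\<delta> \<le> \<epsilon>" for \<epsilon>
      unfolding B_def using le lt that by (auto intro!: fball_memI pl real_le_rsqrt)
    have "(p, l) \<in> C i" if "i \<in> I" for i
    proof (cases i)
      case (Pair x \<epsilon>)
      then have "norm (p x * l x - h x) \<le> \<delta>" "\<delta> \<le> \<epsilon>"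
        using that pl(3) \<delta>(3) by force+
      then show ?thesis
        using mem by (simp add: C_def Pair)
    qed
    then show "B 1 \<times> B 1 \<inter> (\<Inter>i\<in>I. C i) \<noteq> {}"
      using mem[OF \<delta>(2)] by blast
  qed
  then obtain p l where pl: "\<And>i. i \<in> J \<Longrightarrow> (p, l) \<in> C i"
    by auto
  have C: "p \<in> B \<delta>" "l \<in> B \<delta>" "norm (p x * l x - h x) \<le> \<delta>" if "0 < \<delta>" "\<delta> \<le> 1" for x \<delta>
    using pl[of "(x, \<delta>)"] that by (auto simp: C_def J_def)
  have B_le: "q \<in> H" "(hnorm ip q)\<^sup>2 \<le> ?W + 2 * \<delta>" if "q \<in> B \<delta>" "0 < \<delta>" for q \<delta>
  proof -
    have q: "q \<in> H" "hnorm ip q \<le> sqrt (?W + 2 * \<delta>)"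
      using fball_hnorm[of q "sqrt (?W + 2 * \<delta>)"] that W by (simp_all add: B_def)
    then have "(hnorm ip q)\<^sup>2 \<le> (sqrt (?W + 2 * \<delta>))\<^sup>2"
      by (intro power_mono hnorm_nonneg)
    then show "q \<in> H" "(hnorm ip q)\<^sup>2 \<le> ?W + 2 * \<delta>"
      using q W that by simp_all
  qed
  have small: "u \<le> v" if "\<And>\<delta>. 0 < \<delta> \<Longrightarrow> \<delta> \<le> 1 \<Longrightarrow> u \<le> v + 2 * \<delta>" for u v :: real
  proof (rule field_le_epsilon)
    fix e :: real
    assume "0 < e"
    then show "u \<le> v + e"
      using that[of "min 1 (e / 2)"] by (cases "2 \<le> e") simp_all
  qed
  have p: "p \<in> H" and l: "l \<in> H"
    using B_le(1)[OF C(1)[of 1]] B_le(1)[OF C(2)[of 1]] by simp_all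
  have "norm (p x * l x - h x) \<le> 0" for x
  proof (rule small)
    fix \<delta> :: real
    assume "0 < \<delta>" "\<delta> \<le> 1"
    then show "norm (p x * l x - h x) \<le> 0 + 2 * \<delta>"
      using C(3)[of \<delta> x] by simp
  qed
  then have hpl: "h = (\<lambda>x. p x * l x)"
    by (auto simp: fun_eq_iff)
  have np: "(hnorm ip p)\<^sup>2 \<le> ?W" and nl: "(hnorm ip l)\<^sup>2 \<le> ?W"
    by (rule small, rule B_le(2)[OF C(1)], assumption+) (rule small, rule B_le(2)[OF C(2)], assumption+)
  have "hnorm ip p * hnorm ip l \<le> sqrt ?W * sqrt ?W"
    using np nl by (intro mult_mono real_le_rsqrt hnorm_nonneg l) (auto simp: W)
  then have "hnorm ip p * hnorm ip l \<le> ?W"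
    using W by simp
  moreover have "?W \<le> hnorm ip p * hnorm ip l"
    using weak_product_norm_mult_le[OF p l] by (simp flip: hpl)
  ultimately show ?thesis
    using p l hpl by (intro bexI[of _ p] bexI[of _ l] conjI) auto
qed

end

theorem theorem1p3:
  fixes H :: "('x \<Rightarrow> complex) set"
    and ip :: "('x \<Rightarrow> complex) \<Rightarrow> ('x \<Rightarrow> complex) \<Rightarrow> complex"
    and K :: "'x \<Rightarrow> 'x \<Rightarrow> complex"
    and z0 :: 'x
    and h :: "'x \<Rightarrow> complex"
  assumes "normalized_complete_pick H ip K z0"
    and "h \<in> weak_product H ip"
  shows "\<exists>f\<in>H. \<exists>g\<in>H. h = (\<lambda>x. f x * g x) \<and>
    hnorm ip f * hnorm ip g = weak_product_norm H ip h"
proof -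
  interpret normalized_complete_pick H ip K z0
    by (rule assms(1))
  obtain d b where b: "\<And>z. b z \<in> open_unit_ball d" and K: "\<And>z w. K z w = 1 / (1 - seq_inner (b z) (b w))"
    using complete_pick by blast
  interpret pick_embedding H ip K z0 b
    by unfold_locales (use b K in \<open>auto simp: open_unit_ball_def\<close>)
  show ?thesis
    by (rule weak_product_factorization[OF assms(2)])
qed

end
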